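(* Let $\mathfrak g$ be of type $E_n$ ($n=6,7,8$), and let $\widehat{\mathfrak g}(\sigma)$ act on $V$ by $\pi$. 1) In the case $E_6$: for an arbitrary choice of $c_1,c_3,c_5\in\{\pm1\}$, the $\mathbf C$-linear span of $$\{v(c_1,b_2,c_3,b_4,c_5,b_6)\ ;\ b_2,b_4,b_6\in\{\pm1\}\}$$ tensored with $\mathbf C[x^{(j)}_r;1\le j\le6,\ r\in\mathbf N_{\rm odd}]$ is an irreducible $E^{(2)}_6$-module of level one. 2) In the case $E_7$: for an arbitrary choice of $c_1,c_3,c_5,c\in\{\pm1\}$, the $\mathbf C$-linear span of $$\{v(c_1,b_2,c_3,b_4,c_5,b_6,b_7)\ ;\ b_2,b_4,b_6,b_7\in\{\pm1\},\ b_4b_6b_7=c\}$$ tensored with $\mathbf C[x^{(j)}_r;1\le j\le7,\ r\in\mathbf N_{\rm odd}]$ is an irreducible $E^{(1)}_7$-module of level one. 3) In the case $E_8$: for an arbitrary choice of $c_1,c_3,c_5,c_7\in\{\pm1\}$, the $\mathbf C$-linear span of $$\{v(c_1,b_2,c_3,b_4,c_5,b_6,c_7,b_8)\ ;\ b_2,b_4,b_6,b_8\in\{\pm1\}\}$$ tensored with $\mathbf C[x^{(j)}_r;1\le j\le8,\ r\in\mathbf N_{\rm odd}]$ is an irreducible $E^{(1)}_8$-module of level one.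
   Context: $\mathbf N_{\rm odd}$: positive odd integers; $\mathbf Z_{\rm odd}$: odd integers; $i=\sqrt{-1}$. $\mathfrak g$ is the complex simple Lie algebra of type $E_n$ with Cartan subalgebra $\mathfrak h$, roots $\Delta$, root lattice $Q$, invariant form normalized by $(\alpha|\alpha)=2$ ($\alpha\in\Delta$); $\mathfrak h\cong\mathfrak h^*$ via the form, $H_\alpha\leftrightarrow\alpha$. Simple roots $\alpha_1,\dots,\alpha_n$ are numbered so that $\alpha_1-\alpha_2-\cdots-\alpha_{n-1}$ is a chain and $\alpha_n$ is joined to $\alpha_3$ for $E_6,E_7$ and to $\alpha_5$ for $E_8$. $\nu:Q\times Q\to\{\pm1\}$ is the bimultiplicative function with $\nu(\alpha_j,\alpha_k)=-1$ if $j=k$, or if $\alpha_j,\alpha_k$ are joined and $j\in S$; $\nu(\alpha_j,\alpha_k)=1$ otherwise; here $S=\{1,3,5\}$ for $E_6$ and $E_7$, $S=\{1,3,5,7\}$ for $E_8$. Root vectors $X_\alpha$ satisfy $[X_\alpha,X_\beta]=\nu(\alpha,\beta)X_{\alpha+\beta}$ if $\alpha+\beta\in\Delta$, $[X_\alpha,X_{-\alpha}]=-H_\alpha$. $\sigma$ is the automorphism with $\sigma|_{\mathfrak h}=-1$, $\sigma(X_\alpha)=X_{-\alpha}$; $\mathfrak g_{\bar0},\mathfrak g_{\bar1}$ are its $\pm1$ eigenspaces. $\widehat{\mathfrak g}(\sigma)=\big(\bigoplus_{j\in\mathbf Z}\mathfrak g_{\bar j\bmod2}\otimes t^j\big)\oplus\mathbf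 CK\oplus\mathbf Cd$ with $[X\otimes t^j,Y\otimes t^k]=[X,Y]\otimes t^{j+k}+\frac j2(X|Y)\delta_{j+k,0}K$, $[d,X\otimes t^j]=jX\otimes t^j$, $K$ central. It is the affine algebra of type $E_6^{(2)}$, $E_7^{(1)}$, $E_8^{(1)}$ for $n=6,7,8$ respectively; level one means that $K$ acts as the identity. $\mathbf C\{Q/2Q\}$ is the commutative group algebra of $Q/2Q$ (basis $e^\gamma$, $e^\alpha e^\beta=e^{\alpha+\beta}$), $V=\mathbf C\{Q/2Q\}\otimes\mathbf C[x^{(j)}_r;1\le j\le n,r\in\mathbf N_{\rm odd}]$. With an orthonormal basis $S_1,\dots,S_n$ of $\mathfrak h$, the representation $\pi$ of $\widehat{\mathfrak g}(\sigma)$ on $V$ is (coefficientwise in $z$) $$\sum_{j\in\mathbf Z}(X_\alpha+(-1)^jX_{-\alpha})\otimes t^j\,z^{-j}\mapsto\Gamma_\alpha(z),\quad \sum_{j\in\mathbf Z_{\rm odd}}H\otimes t^j\,z^{-j-1}\mapsto\tfrac1{\sqrt2}\sum_{j}(H|S_j)a^{(j)}(z),$$ $K\mapsto1$, $d\mapsto-\sum_{j,r}r\,x^{(j)}_r\partial/\partial x^{(j)}_r$, where $a^{(j)}(z)=\sum_{r\in\mathbf N_{\rm odd}}\big(z^{-r-1}\partial/\partial x^{(j)}_r+r\,x^{(j)}_rz^{r-1}\big)$ and, with $\lambda_j=\sqrt2(\alpha|S_j)$, $$\Gamma_\alpha(z)(e^\gamma\otimes f)=\tfrac12\nu(\alpha,\gamma)e^{\alpha+\gamma}\otimes\exp\Big(\sum_{j,\,r\in\mathbf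 N_{\rm odd}}\lambda_jx^{(j)}_rz^r\Big)\exp\Big(-\sum_{j,\,r\in\mathbf N_{\rm odd}}\lambda_j\frac{z^{-r}}r\frac\partial{\partial x^{(j)}_r}\Big)f.$$ Set $v(c_1,\dots,c_n)=\prod_{j=1}^n(1+ic_je^{\alpha_j})\in\mathbf C\{Q/2Q\}$ for $c_j\in\{\pm1\}$. *)

theory Defs
  imports Complex_Main "HOL-Library.Poly_Mapping" "HOL-Library.Product_Plus" "HOL-Library.Z2"
    "HOL-Computational_Algebra.Formal_Power_Series"
begin

abbreviation "lookup \<equiv> Poly_Mapping.lookup"
abbreviation "keys \<equiv> Poly_Mapping.keys"
abbreviation "single \<equiv> Poly_Mapping.single"

definition pscale :: "complex \<Rightarrow> ('a \<Rightarrow>\<^sub>0 complex) \<Rightarrow> ('a \<Rightarrow>\<^sub>0 complex)" where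
  "pscale c = Poly_Mapping.map ((*) c)"

section \<open>Root data of type \<open>E\<^sub>n\<close>, for \<open>n = 6, 7, 8\<close>\<close>

definition branch_node :: "nat \<Rightarrow> nat" where
  "branch_node n = (if n = 8 then 5 else 3)"

definition joined :: "nat \<Rightarrow> nat \<Rightarrow> nat \<Rightarrow> bool" where
  "joined n j k \<longleftrightarrow> j \<in> {1..n} \<and> k \<in> {1..n} \<and>
     (j < n \<and> k < n \<and> (k = j + 1 \<or> j = k + 1) \<or> {j, k} = {branch_node n, n})"

definition cartan_matrix :: "nat \<Rightarrow> nat \<Rightarrow> nat \<Rightarrow> int" where
  "cartan_matrix n j k = (if j = k then 2 else if joined n j k then - 1 else 0)"

text \<open>An element \<open>\<Sum>\<^sub>j a\<^sub>j \<alpha>\<^sub>j\<close> of the root lattice \<open>Q\<close>, of \<open>Q/2Q\<close>, or of the Cartan subalgebra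
  (identified with its dual) is given by its coefficients \<open>a\<^sub>j\<close> in \<open>\<int>\<close>, \<open>\<int>/2\<int>\<close>, \<open>\<complex>\<close>, with
  \<open>a\<^sub>j = 0\<close> unless \<open>1 \<le> j \<le> n\<close>.\<close>

type_synonym lattice = "nat \<Rightarrow>\<^sub>0 int"
type_synonym lattice_mod2 = "nat \<Rightarrow>\<^sub>0 bit"
type_synonym cartan = "nat \<Rightarrow>\<^sub>0 complex"

definition bform :: "nat \<Rightarrow> (nat \<Rightarrow>\<^sub>0 'a::comm_ring_1) \<Rightarrow> (nat \<Rightarrow>\<^sub>0 'a) \<Rightarrow> 'a" where
  "bform n a b = (\<Sum>j=1..n. \<Sum>k=1..n. of_int (cartan_matrix n j k) * lookup a j * lookup b k)"

definition simple_root :: "nat \<Rightarrow> lattice" where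
  "simple_root j = single j 1"

text \<open>The roots are the orbit of the simple roots under the Weyl group, generated by the simple
  reflections.\<close>

inductive_set roots :: "nat \<Rightarrow> lattice set" for n where
  simple: "j \<in> {1..n} \<Longrightarrow> simple_root j \<in> roots n"
| reflect: "\<beta> \<in> roots n \<Longrightarrow> j \<in> {1..n} \<Longrightarrow>
    \<beta> - single j (bform n \<beta> (simple_root j)) \<in> roots n"

definition H_of :: "lattice \<Rightarrow> cartan" where
  "H_of \<alpha> = Poly_Mapping.map of_int \<alpha>"

definition nu_set :: "nat \<Rightarrow> nat set" where
  "nu_set n = (if n = 8 then {1, 3, 5, 7} else {1, 3, 5})"

definition nu_simple :: "nat \<Rightarrow> nat \<Rightarrow> nat \<Rightarrow> complex" where
  "nu_simple n j k = (if j = k \<or> joined n j k \<and> j \<in> nu_set n then - 1 else 1)"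

definition nu :: "nat \<Rightarrow> lattice \<Rightarrow> lattice \<Rightarrow> complex" where
  "nu n \<alpha> \<beta> = (\<Prod>j=1..n. \<Prod>k=1..n. nu_simple n j k powi (lookup \<alpha> j * lookup \<beta> k))"

section \<open>The Lie algebra of type \<open>E\<^sub>n\<close> and its involution\<close>

text \<open>The pair \<open>(h, x)\<close> stands for \<open>h + \<Sum>\<^sub>\<alpha> x\<^sub>\<alpha> X\<^sub>\<alpha>\<close>, where \<open>\<alpha>\<close> runs over the roots.\<close>

type_synonym lie = "cartan \<times> (lattice \<Rightarrow>\<^sub>0 complex)"

definition lie_alg :: "nat \<Rightarrow> lie set" where
  "lie_alg n = {(h, x). keys h \<subseteq> {1..n} \<and> keys x \<subseteq> roots n}"

definition H_elt :: "cartan \<Rightarrow> lie" where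
  "H_elt h = (h, 0)"

definition X_elt :: "lattice \<Rightarrow> lie" where
  "X_elt \<alpha> = (0, single \<alpha> 1)"

definition lie_scale :: "complex \<Rightarrow> lie \<Rightarrow> lie" where
  "lie_scale c X = (pscale c (fst X), pscale c (snd X))"

definition X_bracket :: "nat \<Rightarrow> lattice \<Rightarrow> lattice \<Rightarrow> lie" where
  "X_bracket n \<alpha> \<beta> =
     (if \<alpha> + \<beta> \<in> roots n then lie_scale (nu n \<alpha> \<beta>) (X_elt (\<alpha> + \<beta>))
      else if \<alpha> + \<beta> = 0 then - H_elt (H_of \<alpha>)
      else 0)"

fun lie_bracket :: "nat \<Rightarrow> lie \<Rightarrow> lie \<Rightarrow> lie" where
  "lie_bracket n (h, x) (h', x') =
     (\<Sum>\<alpha>\<in>keys x. \<Sum>\<beta>\<in>keys x'. lie_scale (lookup x \<alpha> * lookup x' \<beta>) (X_bracket n \<alpha> \<beta>))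
     + (\<Sum>\<beta>\<in>keys x'. lie_scale (lookup x' \<beta> * bform n h (H_of \<beta>)) (X_elt \<beta>))
     - (\<Sum>\<alpha>\<in>keys x. lie_scale (lookup x \<alpha> * bform n h' (H_of \<alpha>)) (X_elt \<alpha>))"

text \<open>Invariance of the form and \<open>[X\<^sub>\<alpha>, X\<^sub>-\<^sub>\<alpha>] = - H\<^sub>\<alpha>\<close> force \<open>(X\<^sub>\<alpha> | X\<^sub>-\<^sub>\<alpha>) = - 1\<close>.\<close>

fun lie_form :: "nat \<Rightarrow> lie \<Rightarrow> lie \<Rightarrow> complex" where
  "lie_form n (h, x) (h', x') = bform n h h' - (\<Sum>\<alpha>\<in>keys x. lookup x \<alpha> * lookup x' (- \<alpha>))"

definition sigma :: "lie \<Rightarrow> lie" where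
  "sigma X = (- fst X, Poly_Mapping.map_key uminus (snd X))"

definition lie_part :: "nat \<Rightarrow> int \<Rightarrow> lie set" where
  "lie_part n j = {X \<in> lie_alg n. sigma X = (if even j then X else - X)}"

section \<open>The twisted affine algebra\<close>

text \<open>The triple \<open>(u, k, d)\<close> stands for \<open>\<Sum>\<^sub>j u\<^sub>j \<otimes> t\<^sup>j + k K + d d\<close>.\<close>

type_synonym affine = "(int \<Rightarrow>\<^sub>0 lie) \<times> complex \<times> complex"

definition affine_alg :: "nat \<Rightarrow> affine set" where
  "affine_alg n = {(u, k, d). \<forall>j. lookup u j \<in> lie_part n j}"

definition loop_elt :: "lie \<Rightarrow> int \<Rightarrow> affine" where
  "loop_elt X j = (single j X, 0, 0)"

definition K_elt :: affine where
  "K_elt = (0, 1, 0)"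

definition d_elt :: affine where
  "d_elt = (0, 0, 1)"

definition affine_scale :: "complex \<Rightarrow> affine \<Rightarrow> affine" where
  "affine_scale c = (\<lambda>(u, k, d). (Poly_Mapping.map (lie_scale c) u, c * k, c * d))"

fun affine_bracket :: "nat \<Rightarrow> affine \<Rightarrow> affine \<Rightarrow> affine" where
  "affine_bracket n (u, k, d) (u', k', d') =
     ((\<Sum>i\<in>keys u. \<Sum>j\<in>keys u'. single (i + j) (lie_bracket n (lookup u i) (lookup u' j)))
      + (\<Sum>j\<in>keys u'. single j (lie_scale (d * of_int j) (lookup u' j)))
      - (\<Sum>j\<in>keys u. single j (lie_scale (d' * of_int j) (lookup u j))),
      \<Sum>j\<in>keys u. of_int j / 2 * lie_form n (lookup u j) (lookup u' (- j)),
      0)"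

section \<open>The space \<open>V\<close>\<close>

text \<open>Polynomials in the \<open>x\<^sup>(\<^sup>j\<^sup>)\<^sub>r\<close>, the variable being indexed by the pair \<open>(j, r)\<close>. The space
  \<open>\<complex>{Q/2Q} \<otimes> \<complex>[x]\<close> is represented by the finitely supported functions from \<open>Q/2Q\<close> to \<open>\<complex>[x]\<close>:
  the vector \<open>e\<^sup>\<gamma> \<otimes> f\<close> is \<open>single \<gamma> f\<close>.\<close>

type_synonym poly_x = "((nat \<times> nat) \<Rightarrow>\<^sub>0 nat) \<Rightarrow>\<^sub>0 complex"
type_synonym group_alg = "lattice_mod2 \<Rightarrow>\<^sub>0 complex"
type_synonym fock = "lattice_mod2 \<Rightarrow>\<^sub>0 poly_x"

definition x_indices :: "nat \<Rightarrow> (nat \<times> nat) set" where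
  "x_indices n = {1..n} \<times> {r. odd r}"

definition polys :: "nat \<Rightarrow> poly_x set" where
  "polys n = {f. \<forall>m\<in>keys f. keys m \<subseteq> x_indices n}"

definition x_var :: "nat \<Rightarrow> nat \<Rightarrow> poly_x" where
  "x_var j r = single (single (j, r) 1) 1"

definition x_deriv :: "nat \<Rightarrow> nat \<Rightarrow> poly_x \<Rightarrow> poly_x" where
  "x_deriv j r f =
     (\<Sum>m\<in>keys f. single (m - single (j, r) 1) (of_nat (lookup m (j, r)) * lookup f m))"

definition fock_scale :: "complex \<Rightarrow> fock \<Rightarrow> fock" where
  "fock_scale c = Poly_Mapping.map (pscale c)"

definition tensor :: "group_alg \<Rightarrow> poly_x \<Rightarrow> fock" where
  "tensor v f = Poly_Mapping.map (\<lambda>c. pscale c f) v"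

definition tensor_space :: "group_alg set \<Rightarrow> poly_x set \<Rightarrow> fock set" where
  "tensor_space U P = module.span fock_scale {tensor v f | v f. v \<in> U \<and> f \<in> P}"

definition mod2 :: "lattice \<Rightarrow> lattice_mod2" where
  "mod2 \<alpha> = Poly_Mapping.map of_int \<alpha>"

text \<open>A representative in \<open>Q\<close>; \<open>\<nu>(\<alpha>, \<gamma>)\<close> does not depend on its choice.\<close>

definition lift2 :: "lattice_mod2 \<Rightarrow> lattice" where
  "lift2 \<gamma> = Poly_Mapping.map (\<lambda>b. if b = 1 then 1 else 0) \<gamma>"

section \<open>The representation\<close>

definition orthonormal_basis :: "nat \<Rightarrow> (nat \<Rightarrow> cartan) \<Rightarrow> bool" where
  "orthonormal_basis n S \<longleftrightarrow>
     (\<forall>j\<in>{1..n}. keys (S j) \<subseteq> {1..n}) \<and>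
     (\<forall>j\<in>{1..n}. \<forall>k\<in>{1..n}. bform n (S j) (S k) = (if j = k then 1 else 0))"

text \<open>\<open>exp T = \<Sum>\<^sub>k T\<^sup>k / k!\<close> for an operator \<open>T\<close> on power series over \<open>\<complex>[x]\<close> that raises the order
  by at least one; only the terms with \<open>k \<le> m\<close> contribute to the \<open>m\<close>-th coefficient.\<close>

definition series_exp :: "(poly_x fps \<Rightarrow> poly_x fps) \<Rightarrow> poly_x fps \<Rightarrow> poly_x fps" where
  "series_exp T F = Abs_fps (\<lambda>m. \<Sum>k\<le>m. pscale (1 / fact k) (fps_nth ((T ^^ k) F) m))"

definition lam :: "nat \<Rightarrow> (nat \<Rightarrow> cartan) \<Rightarrow> lattice \<Rightarrow> nat \<Rightarrow> complex" where
  "lam n S \<alpha> j = complex_of_real (sqrt 2) * bform n (H_of \<alpha>) (S j)"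

text \<open>\<open>exp (\<Sum> \<lambda>\<^sub>j x\<^sup>(\<^sup>j\<^sup>)\<^sub>r z\<^sup>r)\<close> as a power series in \<open>z\<close>.\<close>

definition exp_plus :: "nat \<Rightarrow> (nat \<Rightarrow> cartan) \<Rightarrow> lattice \<Rightarrow> poly_x fps" where
  "exp_plus n S \<alpha> =
     series_exp
       (\<lambda>F. Abs_fps (\<lambda>r. if odd r then \<Sum>j=1..n. pscale (lam n S \<alpha> j) (x_var j r) else 0) * F)
       1"

text \<open>\<open>exp (- \<Sum> \<lambda>\<^sub>j (z\<^sup>-\<^sup>r / r) \<partial>/\<partial>x\<^sup>(\<^sup>j\<^sup>)\<^sub>r) f\<close> as a power series in \<open>z\<^sup>-\<^sup>1\<close>; it has finitely many
  nonzero coefficients.\<close>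

definition exp_minus :: "nat \<Rightarrow> (nat \<Rightarrow> cartan) \<Rightarrow> lattice \<Rightarrow> poly_x \<Rightarrow> poly_x fps" where
  "exp_minus n S \<alpha> f =
     series_exp
       (\<lambda>F. Abs_fps (\<lambda>m. \<Sum>r\<in>{r. r \<le> m \<and> odd r}. \<Sum>j=1..n.
          pscale (- lam n S \<alpha> j / of_nat r) (x_deriv j r (fps_nth F (m - r)))))
       (fps_const f)"

text \<open>The coefficient of \<open>z\<^sup>p\<close> in the product of the two exponentials applied to \<open>f\<close>. The sum
  over \<open>m\<close> has finite support.\<close>

definition vertex_coeff :: "nat \<Rightarrow> (nat \<Rightarrow> cartan) \<Rightarrow> lattice \<Rightarrow> int \<Rightarrow> poly_x \<Rightarrow> poly_x" where
  "vertex_coeff n S \<alpha> p f =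
     (\<Sum>m. if 0 \<le> p + int m
          then fps_nth (exp_plus n S \<alpha>) (nat (p + int m)) * fps_nth (exp_minus n S \<alpha> f) m
          else 0)"

text \<open>The coefficient of \<open>z\<^sup>-\<^sup>j\<close> in \<open>\<Gamma>\<^sub>\<alpha>(z)\<close>.\<close>

definition Gamma_coeff :: "nat \<Rightarrow> (nat \<Rightarrow> cartan) \<Rightarrow> lattice \<Rightarrow> int \<Rightarrow> fock \<Rightarrow> fock" where
  "Gamma_coeff n S \<alpha> j w =
     (\<Sum>\<gamma>\<in>keys w. single (mod2 \<alpha> + \<gamma>)
        (pscale (1 / 2 * nu n \<alpha> (lift2 \<gamma>)) (vertex_coeff n S \<alpha> (- j) (lookup w \<gamma>))))"

text \<open>The coefficient of \<open>z\<^sup>-\<^sup>i\<^sup>-\<^sup>1\<close> in \<open>a\<^sup>(\<^sup>j\<^sup>)(z)\<close>.\<close>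

definition a_coeff :: "nat \<Rightarrow> int \<Rightarrow> poly_x \<Rightarrow> poly_x" where
  "a_coeff j i f =
     (if even i then 0
      else if i > 0 then x_deriv j (nat i) f
      else pscale (of_int (- i)) (x_var j (nat (- i)) * f))"

definition heisenberg :: "nat \<Rightarrow> (nat \<Rightarrow> cartan) \<Rightarrow> cartan \<Rightarrow> int \<Rightarrow> fock \<Rightarrow> fock" where
  "heisenberg n S h i =
     Poly_Mapping.map
       (\<lambda>f. pscale (1 / complex_of_real (sqrt 2)) (\<Sum>j=1..n. pscale (bform n h (S j)) (a_coeff j i f)))"

definition energy :: "nat \<Rightarrow> fock \<Rightarrow> fock" where
  "energy n =
     Poly_Mapping.map
       (\<lambda>f. \<Sum>(j, r)\<in>x_indices n \<inter> (\<Union>m\<in>keys f. keys m). pscale (of_nat r) (x_var j r * x_deriv j r f))"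

text \<open>For \<open>(h, x)\<close> in the \<open>(-1)\<^sup>i\<close>-eigenspace of \<open>\<sigma>\<close> one has \<open>x\<^sub>-\<^sub>\<alpha> = (-1)\<^sup>i x\<^sub>\<alpha>\<close>, so that
  \<open>h + \<Sum>\<^sub>\<alpha> x\<^sub>\<alpha> X\<^sub>\<alpha> = h + \<Sum>\<^sub>\<alpha> (x\<^sub>\<alpha> / 2) (X\<^sub>\<alpha> + (-1)\<^sup>i X\<^sub>-\<^sub>\<alpha>)\<close>. The action of each
  \<open>(X\<^sub>\<alpha> + (-1)\<^sup>i X\<^sub>-\<^sub>\<alpha>) \<otimes> t\<^sup>i\<close> is confirmed in \<open>rep_X\<close> below.\<close>

definition rep_loop :: "nat \<Rightarrow> (nat \<Rightarrow> cartan) \<Rightarrow> int \<Rightarrow> lie \<Rightarrow> fock \<Rightarrow> fock" where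
  "rep_loop n S i = (\<lambda>(h, x) w.
     heisenberg n S h i w
     + (\<Sum>\<alpha>\<in>keys x. fock_scale (lookup x \<alpha> / 2) (Gamma_coeff n S \<alpha> i w)))"

definition rep :: "nat \<Rightarrow> (nat \<Rightarrow> cartan) \<Rightarrow> affine \<Rightarrow> fock \<Rightarrow> fock" where
  "rep n S = (\<lambda>(u, k, d) w.
     (\<Sum>i\<in>keys u. rep_loop n S i (lookup u i) w) + fock_scale k w - fock_scale d (energy n w))"

section \<open>The defining formulas of the representation\<close>

lemma lookup_pscale: "lookup (pscale c f) k = c * lookup f k"
  unfolding pscale_def by (simp add: Poly_Mapping.map.rep_eq when_def)

lemma lookup_fock_scale: "lookup (fock_scale c w) k = pscale c (lookup w k)"
  unfolding fock_scale_def
  by (auto simp add: Poly_Mapping.map.rep_eq when_def poly_mapping_eq_iff fun_eq_iff lookup_pscale)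

lemma pscale_vector_space: "vector_space pscale"
  by (unfold_locales) (auto intro!: poly_mapping_eqI simp: lookup_pscale lookup_add algebra_simps)

lemma fock_scale_vector_space: "vector_space fock_scale"
  by (unfold_locales)
    (auto intro!: poly_mapping_eqI simp: lookup_fock_scale lookup_pscale lookup_add algebra_simps)

lemma pscale_conv_mult: "pscale c f = single 0 c * (f :: 'a::monoid_add \<Rightarrow>\<^sub>0 complex)"
  unfolding pscale_def by (rule mult_map_scale_conv_mult)

lemma mod2_uminus: "mod2 (- \<alpha>) = mod2 \<alpha>"
  by (rule poly_mapping_eqI) (simp add: mod2_def Poly_Mapping.map.rep_eq when_def)

lemma H_of_uminus: "H_of (- \<alpha>) = - H_of \<alpha>"
  by (rule poly_mapping_eqI) (simp add: H_of_def Poly_Mapping.map.rep_eq when_def)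

lemma nu_uminus: "nu n (- \<alpha>) \<gamma> = nu n \<alpha> \<gamma>"
proof -
  have "nu_simple n j k powi (- m) = nu_simple n j k powi m" for j k m
    by (simp add: nu_simple_def power_int_minus flip: power_int_inverse)
  then show ?thesis
    by (simp add: nu_def)
qed

lemma lam_uminus: "lam n S (- \<alpha>) j = - lam n S \<alpha> j"
  by (simp add: lam_def H_of_uminus bform_def sum_negf)

lemma series_exp_parity:
  assumes step: "\<And>F G. \<forall>m. fps_nth G m = (- 1) ^ m * fps_nth F m \<Longrightarrow>
      \<forall>m. fps_nth (T' G) m = (- 1) ^ m * fps_nth (T F) m"
    and FG: "\<forall>m. fps_nth G m = (- 1) ^ m * fps_nth F m"
  shows "fps_nth (series_exp T' G) m = (- 1) ^ m * fps_nth (series_exp T F) m"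
proof -
  have "\<forall>m. fps_nth ((T' ^^ k) G) m = (- 1) ^ m * fps_nth ((T ^^ k) F) m" for k
    by (induction k) (use FG step in auto)
  then show ?thesis
    by (simp add: series_exp_def pscale_conv_mult sum_distrib_left mult.left_commute)
qed

lemma x_deriv_sign: "x_deriv j r ((- 1) ^ m * f) = (- 1) ^ m * x_deriv j r f"
proof -
  have "x_deriv j r (- f) = - x_deriv j r f"
    by (simp add: x_deriv_def single_uminus sum_negf)
  then show ?thesis
    by (cases "even m") auto
qed

lemma exp_plus_uminus:
  "fps_nth (exp_plus n S (- \<alpha>)) m = (- 1) ^ m * fps_nth (exp_plus n S \<alpha>) m"
  unfolding exp_plus_def
proof (rule series_exp_parity, goal_cases)
  case (1 F G)
  let ?A = "\<lambda>\<alpha>. Abs_fps (\<lambda>r. if odd r then \<Sum>j=1..n. pscale (lam n S \<alpha> j) (x_var j r) else 0)"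
  have A: "fps_nth (?A (- \<alpha>)) r = (- 1) ^ r * fps_nth (?A \<alpha>) r" for r
    by (simp add: lam_uminus pscale_conv_mult single_uminus sum_negf)
  show ?case
  proof
    fix m
    have "fps_nth (?A (- \<alpha>) * G) m =
        (\<Sum>i=0..m. (- 1) ^ i * fps_nth (?A \<alpha>) i * ((- 1) ^ (m - i) * fps_nth F (m - i)))"
      unfolding fps_mult_nth A using 1 by simp
    also have "\<dots> = (\<Sum>i=0..m. (- 1) ^ m * (fps_nth (?A \<alpha>) i * fps_nth F (m - i)))"
    proof (rule sum.cong, simp)
      fix i assume "i \<in> {0..m}"
      then have "(- 1 :: poly_x) ^ m = (- 1) ^ i * (- 1) ^ (m - i)"
        by (simp flip: power_add)
      then show "(- 1) ^ i * fps_nth (?A \<alpha>) i * ((- 1) ^ (m - i) * fps_nth F (m - i)) =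
          (- 1) ^ m * (fps_nth (?A \<alpha>) i * fps_nth F (m - i))"
        by (simp only: mult_ac)
    qed
    also have "\<dots> = (- 1) ^ m * fps_nth (?A \<alpha> * F) m"
      unfolding fps_mult_nth by (simp only: sum_distrib_left)
    finally show "fps_nth (?A (- \<alpha>) * G) m = (- 1) ^ m * fps_nth (?A \<alpha> * F) m" .
  qed
next
  case 2
  show ?case by (simp add: fps_one_def)
qed

lemma exp_minus_uminus:
  "fps_nth (exp_minus n S (- \<alpha>) f) m = (- 1) ^ m * fps_nth (exp_minus n S \<alpha> f) m"
  unfolding exp_minus_def
proof (rule series_exp_parity, goal_cases)
  case (1 F G)
  show ?case
  proof
    fix m
    have "pscale (- lam n S (- \<alpha>) j / of_nat r) (x_deriv j r (fps_nth G (m - r))) =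
        (- 1) ^ m * pscale (- lam n S \<alpha> j / of_nat r) (x_deriv j r (fps_nth F (m - r)))"
      if "r \<le> m \<and> odd r" for j r
    proof -
      have "(- 1 :: poly_x) ^ m = (- 1) ^ r * (- 1) ^ (m - r)"
        using that by (metis le_add_diff_inverse power_add)
      moreover have "(- 1 :: poly_x) ^ r = - 1"
        using that by simp
      ultimately have "(- 1 :: poly_x) ^ m = - ((- 1) ^ (m - r))"
        by (simp only: mult_minus_left mult_1)
      then show ?thesis
        using 1 by (simp add: lam_uminus x_deriv_sign pscale_conv_mult single_uminus mult.left_commute)
    qed
    then show "fps_nth (Abs_fps (\<lambda>m. \<Sum>r\<in>{r. r \<le> m \<and> odd r}. \<Sum>j=1..n.
          pscale (- lam n S (- \<alpha>) j / of_nat r) (x_deriv j r (fps_nth G (m - r))))) m =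
        (- 1) ^ m * fps_nth (Abs_fps (\<lambda>m. \<Sum>r\<in>{r. r \<le> m \<and> odd r}. \<Sum>j=1..n.
          pscale (- lam n S \<alpha> j / of_nat r) (x_deriv j r (fps_nth F (m - r))))) m"
      by (simp add: sum_distrib_left)
  qed
next
  case 2
  show ?case by simp
qed

lemma Gamma_coeff_uminus:
  "Gamma_coeff n S (- \<alpha>) j w = (if even j then Gamma_coeff n S \<alpha> j w else - Gamma_coeff n S \<alpha> j w)"
proof -
  have "vertex_coeff n S (- \<alpha>) (- j) f =
      (if even j then vertex_coeff n S \<alpha> (- j) f else - vertex_coeff n S \<alpha> (- j) f)" for f
  proof -
    have sgn: "(- 1) ^ nat (- j + int m) * a * ((- 1) ^ m * b) = (if even j then a * b else - (a * b))"
      if "0 \<le> - j + int m" for m and a b :: poly_x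
    proof -
      have "even (nat (- j + int m)) \<longleftrightarrow> (even j \<longleftrightarrow> even m)"
        using that by (auto simp: even_nat_iff)
      then show ?thesis by (cases "even m"; cases "even j") auto
    qed
    have neg: "(\<Sum>m. - g m) = - (\<Sum>m. g m)" for g :: "nat \<Rightarrow> poly_x"
      by (simp add: Sum_any.expand_set sum_negf)
    show ?thesis
    proof (cases "even j")
      case True
      then show ?thesis
        unfolding vertex_coeff_def
        by (auto simp: exp_plus_uminus exp_minus_uminus sgn simp del: minus_add_distrib uminus_add_conv_diff add_uminus_conv_diff intro!: Sum_any.cong)
    next
      case False
      then show ?thesis
        unfolding vertex_coeff_def
        by (auto simp: exp_plus_uminus exp_minus_uminus sgn simp del: uminus_add_conv_diff simp flip: neg intro!: Sum_any.cong)
    qed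
  qed
  then show ?thesis
    by (auto simp: Gamma_coeff_def mod2_uminus nu_uminus pscale_conv_mult single_uminus sum_negf)
qed

lemma roots_nonzero:
  assumes "\<alpha> \<in> roots n"
  shows "\<alpha> \<noteq> 0"
proof -
  have sym: "bform n a b = bform n b a" for a b :: lattice
  proof -
    have "cartan_matrix n j k = cartan_matrix n k j" for j k
      by (auto simp: cartan_matrix_def joined_def insert_commute)
    then have "of_int (cartan_matrix n j k) * lookup a j * lookup b k =
        of_int (cartan_matrix n k j) * lookup b k * lookup a j" for j k
      by simp
    then show ?thesis
      unfolding bform_def by (subst (2) sum.swap) (simp only:)
  qed
  have diff: "bform n (a - b) c = bform n a c - bform n b c" for a b c :: lattice
    by (simp add: bform_def lookup_minus algebra_simps sum_subtractf)
  have scal: "bform n (single j m) c = m * bform n (simple_root j) c" for j m and c :: lattice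
    unfolding bform_def simple_root_def sum_distrib_left
    by (intro sum.cong) (auto simp: lookup_single when_def)
  have two: "bform n (simple_root j) (simple_root j) = 2" if "j \<in> {1..n}" for j
    using that
    by (simp add: bform_def simple_root_def lookup_single when_def cartan_matrix_def
        if_distrib[of "\<lambda>x. x * _"] if_distrib[of "\<lambda>x. _ * x"] sum.delta cong: if_cong)
  from assms have "bform n \<alpha> \<alpha> = 2"
  proof induction
    case (simple j)
    then show ?case by (rule two)
  next
    case (reflect \<beta> j)
    have "bform n (\<beta> - single j m) (\<beta> - single j m) =
        bform n \<beta> \<beta> - 2 * m * bform n \<beta> (simple_root j) + m * m * 2" for m
    proof -
      have "bform n x (\<beta> - single j m) = bform n x \<beta> - m * bform n x (simple_root j)" for x
        by (simp add: sym[of x] diff scal)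
      then show ?thesis
        using two[OF reflect(2)]
        by (simp only: diff scal sym[of "simple_root j" \<beta>]) (simp add: algebra_simps)
    qed
    then show ?case using reflect by simp
  qed
  then show ?thesis by (auto simp: bform_def)
qed

theorem rep_X:
  assumes "\<alpha> \<in> roots n"
  shows "rep n S (loop_elt (X_elt \<alpha> + (if even i then X_elt (- \<alpha>) else - X_elt (- \<alpha>))) i) =
    Gamma_coeff n S \<alpha> i"
proof
  fix w
  define e :: complex where "e = (if even i then 1 else - 1)"
  define x where "x = single \<alpha> 1 + single (- \<alpha>) e"
  have X: "X_elt \<alpha> + (if even i then X_elt (- \<alpha>) else - X_elt (- \<alpha>)) = (0, x)"
    by (simp add: X_elt_def x_def e_def plus_prod_def uminus_prod_def minus_prod_def single_uminus)
  have ne: "\<alpha> \<noteq> - \<alpha>"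
  proof
    assume "\<alpha> = - \<alpha>"
    then have "lookup \<alpha> k = - lookup \<alpha> k" for k
      by (metis lookup_uminus)
    then have "\<alpha> = 0"
      by (intro poly_mapping_eqI) simp
    with roots_nonzero[OF assms] show False by simp
  qed
  have lk: "lookup x \<alpha> = 1" "lookup x (- \<alpha>) = e"
    using ne ne[symmetric] by (auto simp: x_def lookup_add lookup_single when_def)
  have kx: "keys x = {\<alpha>, - \<alpha>}"
  proof
    show "keys x \<subseteq> {\<alpha>, - \<alpha>}"
      unfolding x_def by (rule order.trans[OF keys_add]) auto
    show "{\<alpha>, - \<alpha>} \<subseteq> keys x"
      using lk by (auto simp: in_keys_iff e_def)
  qed
  interpret vector_space fock_scale by (rule fock_scale_vector_space)
  have x0: "(0 :: cartan, x) \<noteq> 0"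
    using lk(1) by (auto simp: zero_prod_def)
  have h0: "heisenberg n S 0 i w = 0"
    by (rule poly_mapping_eqI)
      (simp add: heisenberg_def Poly_Mapping.map.rep_eq bform_def pscale_conv_mult)
  have "rep n S (loop_elt (0, x) i) w = rep_loop n S i (0, x) w"
    using x0 by (simp add: rep_def loop_elt_def)
  also have "\<dots> = fock_scale (1 / 2) (Gamma_coeff n S \<alpha> i w)
      + fock_scale (e / 2) (Gamma_coeff n S (- \<alpha>) i w)"
    using ne by (simp add: rep_loop_def h0 kx lk)
  also have "fock_scale (e / 2) (Gamma_coeff n S (- \<alpha>) i w) = fock_scale (1 / 2) (Gamma_coeff n S \<alpha> i w)"
    by (auto simp: Gamma_coeff_uminus e_def)
  also have "fock_scale (1 / 2) (Gamma_coeff n S \<alpha> i w) + \<dots> = Gamma_coeff n S \<alpha> i w"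
    by (simp flip: scale_left_distrib)
  finally show "rep n S (loop_elt (X_elt \<alpha> + (if even i then X_elt (- \<alpha>) else - X_elt (- \<alpha>))) i) w =
      Gamma_coeff n S \<alpha> i w"
    unfolding X .
qed

theorem rep_H: "rep n S (loop_elt (H_elt h) i) = heisenberg n S h i"
proof
  fix w
  interpret vector_space fock_scale by (rule fock_scale_vector_space)
  have h0: "heisenberg n S 0 i w = 0"
    by (rule poly_mapping_eqI)
      (simp add: heisenberg_def Poly_Mapping.map.rep_eq bform_def pscale_conv_mult)
  show "rep n S (loop_elt (H_elt h) i) w = heisenberg n S h i w"
    by (cases "h = 0") (auto simp: rep_def loop_elt_def H_elt_def rep_loop_def h0 zero_prod_def)
qed

theorem rep_K: "rep n S K_elt w = w"
proof -
  interpret vector_space fock_scale by (rule fock_scale_vector_space)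
  show ?thesis by (simp add: rep_def K_elt_def)
qed

theorem rep_d: "rep n S d_elt w = - energy n w"
proof -
  interpret vector_space fock_scale by (rule fock_scale_vector_space)
  show ?thesis by (simp add: rep_def d_elt_def)
qed

section \<open>Modules\<close>

definition lie_submodule :: "'l set \<Rightarrow> (complex \<Rightarrow> 'v \<Rightarrow> 'v) \<Rightarrow> ('l \<Rightarrow> 'v \<Rightarrow> 'v) \<Rightarrow> 'v::ab_group_add set \<Rightarrow> bool"
  where "lie_submodule L sV \<rho> U \<longleftrightarrow>
    module.subspace sV U \<and> (\<forall>x\<in>L. \<forall>v\<in>U. \<rho> x v \<in> U)"

definition lie_module ::
  "'l::ab_group_add set \<Rightarrow> (complex \<Rightarrow> 'l \<Rightarrow> 'l) \<Rightarrow> ('l \<Rightarrow> 'l \<Rightarrow> 'l) \<Rightarrow>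
   (complex \<Rightarrow> 'v \<Rightarrow> 'v) \<Rightarrow> ('l \<Rightarrow> 'v \<Rightarrow> 'v) \<Rightarrow> 'v::ab_group_add set \<Rightarrow> bool"
  where "lie_module L sL br sV \<rho> W \<longleftrightarrow>
    lie_submodule L sV \<rho> W \<and>
    (\<forall>x\<in>L. \<forall>v\<in>W. \<forall>w\<in>W. \<rho> x (v + w) = \<rho> x v + \<rho> x w) \<and>
    (\<forall>x\<in>L. \<forall>v\<in>W. \<forall>c. \<rho> x (sV c v) = sV c (\<rho> x v)) \<and>
    (\<forall>x\<in>L. \<forall>y\<in>L. \<forall>v\<in>W. \<rho> (x + y) v = \<rho> x v + \<rho> y v) \<and>
    (\<forall>x\<in>L. \<forall>v\<in>W. \<forall>c. \<rho> (sL c x) v = sV c (\<rho> x v)) \<and>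
    (\<forall>x\<in>L. \<forall>y\<in>L. \<forall>v\<in>W. \<rho> (br x y) v = \<rho> x (\<rho> y v) - \<rho> y (\<rho> x v))"

definition irreducible_lie_module ::
  "'l::ab_group_add set \<Rightarrow> (complex \<Rightarrow> 'l \<Rightarrow> 'l) \<Rightarrow> ('l \<Rightarrow> 'l \<Rightarrow> 'l) \<Rightarrow>
   (complex \<Rightarrow> 'v \<Rightarrow> 'v) \<Rightarrow> ('l \<Rightarrow> 'v \<Rightarrow> 'v) \<Rightarrow> 'v::ab_group_add set \<Rightarrow> bool"
  where "irreducible_lie_module L sL br sV \<rho> W \<longleftrightarrow>
    lie_module L sL br sV \<rho> W \<and> W \<noteq> {0} \<and>
    (\<forall>U. U \<subseteq> W \<and> lie_submodule L sV \<rho> U \<longrightarrow> U = {0} \<or> U = W)"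

definition irreducible_level_one :: "nat \<Rightarrow> (nat \<Rightarrow> cartan) \<Rightarrow> fock set \<Rightarrow> bool" where
  "irreducible_level_one n S W \<longleftrightarrow>
     irreducible_lie_module (affine_alg n) affine_scale (affine_bracket n) fock_scale (rep n S) W \<and>
     (\<forall>w\<in>W. rep n S K_elt w = w)"

section \<open>The vectors \<open>v(c\<^sub>1, \<dots>, c\<^sub>n)\<close>\<close>

definition v_elt :: "complex list \<Rightarrow> group_alg" where
  "v_elt cs = (\<Prod>j=1..length cs. 1 + single (mod2 (simple_root j)) (\<i> * cs ! (j - 1)))"

abbreviation lin_span :: "group_alg set \<Rightarrow> group_alg set" where
  "lin_span \<equiv> module.span pscale"

end

theory Submission
  imports Defs
begin

text \<open>There are two things to prove: that the operators represent the affine algebra at all, and that the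
  resulting modules are irreducible.

  For the first, write \<open>V\<^sub>\<alpha>(p)\<close> for the coefficient of \<open>z\<^sup>p\<close> in the product of the two exponentials of \<open>\<Gamma>\<^sub>\<alpha>(z)\<close>.
  Three properties of these operators carry the argument: \<open>[a\<^sub>i, V\<^sub>\<alpha>(p)] = \<lambda> V\<^sub>\<alpha>(p - i)\<close> for the
  Heisenberg operators (\<open>a_coeff_vertex_coeff\<close>), \<open>V\<^sub>\<alpha>(p) 1 = 0\<close> for \<open>p < 0\<close>, and the constant term of
  \<open>V\<^sub>\<alpha>(p) 1\<close>, which is \<open>1\<close> for \<open>p = 0\<close> and \<open>0\<close> otherwise. A family of operators with such commutators with the
  Heisenberg algebra that kills the vacuum in negative weight is determined by its vacuum expectation values (\<open>heisenberg_uniqueness\<close>): annihilation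
  operators determine its action on the vacuum up to constants, and creation operators its action on everything else.
  This takes the place of the usual calculations with delta functions. Every commutation relation between two
  vertex operators reduces to the expectation values of \<open>V\<^sub>\<alpha>(-i) V\<^sub>\<beta>(i)\<close>, and the Euler identity for the energy operator gives a
  recurrence for these numbers (\<open>two_point_recurrence\<close>) that is easily solved for \<open>(\<alpha>|\<beta>) = 0, -1, -2\<close>. The other
  values of \<open>(\<alpha>|\<beta>)\<close> follow from \<open>\<Gamma>\<^sub>-\<^sub>\<beta>(z) = \<Gamma>\<^sub>\<beta>(-z)\<close>. The cocycle \<open>\<nu>\<close> provides the signs that turn these relations
  into commutators (\<open>Gamma_commutator_root_term\<close>), and summing over roots and powers of \<open>t\<close> yields the bracket
  relation of the affine algebra (\<open>rep_bracket\<close>).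

  For the second, \<open>\<Gamma>\<^sub>\<alpha>(z)\<close> acts on the factor \<open>\<complex>{Q/2Q}\<close> by \<open>e\<^sup>\<gamma> \<mapsto> \<nu>(\<alpha>, \<gamma>) e\<^sup>\<alpha>\<^sup>+\<^sup>\<gamma>\<close>. For \<open>\<alpha> = \<alpha>\<^sub>j\<close> this maps
  \<open>v(c\<^sub>1, \<dots>, c\<^sub>n)\<close> to a multiple of the vector in which \<open>c\<^sub>k\<close> has been multiplied by \<open>\<nu>(\<alpha>\<^sub>j, \<alpha>\<^sub>k)\<close> for all \<open>k \<noteq> j\<close>
  (\<open>shift_op_v_elt\<close>). Hence the signs at the nodes in \<open>nu_set n\<close> are never changed, and the given spans are stable; for
  \<open>E\<^sub>7\<close>, each of these nodes changes an even number of the signs \<open>b\<^sub>4\<close>, \<open>b\<^sub>6\<close>, \<open>b\<^sub>7\<close>. A nonzero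
  submodule contains a vector \<open>v \<otimes> 1\<close>, by applying annihilation operators as long as the result is not \<open>0\<close>
  (\<open>submodule_contains_vacuum\<close>). The remaining nodes have the vectors \<open>v(c\<^sub>1, \<dots>, c\<^sub>n)\<close> of the span as simultaneous
  eigenvectors with distinct eigenvalues, so one of them, tensored with \<open>1\<close>, lies in the submodule
  (\<open>invariant_subspace_contains_eigenvector\<close>). The sign changes induced by the nodes in \<open>nu_set n\<close> act transitively
  on the given vectors, and creation operators produce the rest.\<close>

section \<open>Bilinear forms and root systems\<close>

lemma lookup_H_of [simp]: "lookup (H_of \<alpha>) k = of_int (lookup \<alpha> k)"
  by (simp add: H_of_def Poly_Mapping.map.rep_eq when_def)

lemma H_of_add: "H_of (\<alpha> + \<beta>) = H_of \<alpha> + H_of \<beta>"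
  by (rule poly_mapping_eqI) (simp add: lookup_add)

lemma cartan_matrix_sym: "cartan_matrix n j k = cartan_matrix n k j"
  by (auto simp: cartan_matrix_def joined_def insert_commute)

lemma bform_sym: "bform n a b = bform n b a"
  unfolding bform_def
  by (subst sum.swap, subst cartan_matrix_sym) (simp add: mult_ac)

lemma bform_add_left: "bform n (a + b) c = bform n a c + bform n b c"
  by (simp add: bform_def lookup_add algebra_simps sum.distrib)

lemma bform_add_right: "bform n a (b + c) = bform n a b + bform n a c"
  by (simp add: bform_def lookup_add algebra_simps sum.distrib)

lemma bform_minus_left: "bform n (- a) b = - bform n a b"
  by (simp add: bform_def sum_negf)

lemma bform_minus_right: "bform n a (- b) = - bform n a b"
  by (simp add: bform_def sum_negf)

lemma bform_diff_left: "bform n (a - b) c = bform n a c - bform n b c"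
  by (metis bform_add_left bform_minus_left diff_conv_add_uminus)

lemma bform_diff_right: "bform n a (b - c) = bform n a b - bform n a c"
  by (metis bform_add_right bform_minus_right diff_conv_add_uminus)

lemma bform_zero_left [simp]: "bform n 0 b = 0"
  by (simp add: bform_def)

lemma bform_zero_right [simp]: "bform n a 0 = 0"
  by (simp add: bform_def)

lemma bform_pscale_left: "bform n (pscale c a) b = c * bform n a b"
  by (simp add: bform_def lookup_pscale sum_distrib_left mult_ac)

lemma bform_pscale_right: "bform n a (pscale c b) = c * bform n a b"
  by (simp add: bform_def lookup_pscale sum_distrib_left mult_ac)

lemma bform_H_of: "bform n (H_of \<alpha>) (H_of \<beta>) = of_int (bform n \<alpha> \<beta>)"
  by (simp add: bform_def)

lemma bform_single_right: "bform n a (single j m) = m * bform n a (simple_root j)"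
  unfolding bform_def simple_root_def sum_distrib_left
  by (intro sum.cong) (auto simp: lookup_single when_def)

lemma bform_single_left: "bform n (single j m) a = m * bform n (simple_root j) a"
  using bform_single_right bform_sym by metis

lemma bform_simple_root: "j \<in> {1..n} \<Longrightarrow> k \<in> {1..n} \<Longrightarrow>
    bform n (simple_root j) (simple_root k) = cartan_matrix n j k"
  by (simp add: bform_def simple_root_def lookup_single when_def
      if_distrib[of "\<lambda>x. x * _"] if_distrib[of "\<lambda>x. _ * x"] sum.delta cong: if_cong)

lemma bform_simple_root_self: "j \<in> {1..n} \<Longrightarrow> bform n (simple_root j) (simple_root j) = 2"
  by (simp add: bform_simple_root cartan_matrix_def)

lemma keys_roots: "\<alpha> \<in> roots n \<Longrightarrow> keys \<alpha> \<subseteq> {1..n}"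
proof (induction rule: roots.induct)
  case (reflect \<beta> j)
  then show ?case using keys_diff[of \<beta>] by (fastforce split: if_splits)
qed (auto simp: simple_root_def)

lemma roots_norm: "\<alpha> \<in> roots n \<Longrightarrow> bform n \<alpha> \<alpha> = 2"
proof (induction rule: roots.induct)
  case (simple j)
  then show ?case by (rule bform_simple_root_self)
next
  case (reflect \<beta> j)
  then show ?case
    using bform_simple_root_self[OF reflect(2)] bform_sym[of n "simple_root j" \<beta>]
    by (simp add: bform_diff_left bform_diff_right bform_single_left bform_single_right algebra_simps)
qed

abbreviation zsmul :: "int \<Rightarrow> lattice \<Rightarrow> lattice" where
  "zsmul m \<alpha> \<equiv> Poly_Mapping.map ((*) m) \<alpha>"

lemma lookup_zsmul [simp]: "lookup (zsmul m \<alpha>) k = m * lookup \<alpha> k"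
  by (simp add: Poly_Mapping.map.rep_eq when_def)

lemma bform_zsmul_left: "bform n (zsmul m \<alpha>) \<beta> = m * bform n \<alpha> \<beta>"
  by (simp add: bform_def sum_distrib_left mult_ac)

text \<open>The set of roots is defined as an orbit of the simple reflections only. Since
  \<open>s\<^bsub>s\<^sub>j\<alpha>\<^esub> = s\<^sub>j s\<^sub>\<alpha> s\<^sub>j\<close>, it is stable under the reflection in every root.\<close>

lemma roots_reflect:
  assumes "\<alpha> \<in> roots n" "\<beta> \<in> roots n"
  shows "\<beta> - zsmul (bform n \<beta> \<alpha>) \<alpha> \<in> roots n"
  using assms
proof (induction arbitrary: \<beta> rule: roots.induct)
  case (simple j)
  have "zsmul m (simple_root j) = single j m" for m
    by (rule poly_mapping_eqI) (simp add: simple_root_def lookup_single when_def)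
  then show ?case using roots.reflect[OF simple(2,1)] by simp
next
  case (reflect \<alpha> j)
  define s where "s \<gamma> = \<gamma> - single j (bform n \<gamma> (simple_root j))" for \<gamma> :: lattice
  have sr: "\<gamma> \<in> roots n \<Longrightarrow> s \<gamma> \<in> roots n" for \<gamma>
    unfolding s_def using roots.reflect reflect.hyps(2) by blast
  note two = bform_simple_root_self[OF reflect.hyps(2)]
  have "s (s \<beta> - zsmul (bform n (s \<beta>) \<alpha>) \<alpha>) \<in> roots n"
    by (intro sr reflect.IH reflect.prems)
  also have "s (s \<beta> - zsmul (bform n (s \<beta>) \<alpha>) \<alpha>) = \<beta> - zsmul (bform n \<beta> (s \<alpha>)) (s \<alpha>)"
  proof -
    have "bform n (s \<beta>) \<alpha> = bform n \<beta> (s \<alpha>)"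
      using bform_sym[of n "simple_root j" \<alpha>]
      by (simp add: s_def bform_diff_left bform_diff_right bform_single_left bform_single_right)
    moreover have "s (s \<beta> - zsmul m \<alpha>) = \<beta> - zsmul m (s \<alpha>)" for m
      using two
      by (intro poly_mapping_eqI)
        (simp add: s_def lookup_minus lookup_single when_def bform_diff_left bform_diff_right
          bform_single_left bform_single_right bform_zsmul_left ring_distribs)
    ultimately show ?thesis by simp
  qed
  finally show ?case by (simp add: s_def)
qed

lemma roots_uminus: "\<alpha> \<in> roots n \<Longrightarrow> - \<alpha> \<in> roots n"
proof -
  assume a: "\<alpha> \<in> roots n"
  have *: "\<alpha> - zsmul 2 \<alpha> = - \<alpha>" by (rule poly_mapping_eqI) (simp add: lookup_minus)
  show ?thesis using roots_reflect[OF a a] unfolding roots_norm[OF a] * .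
qed

text \<open>Completing squares from the ends of the three arms of the diagram towards its branch node
  shows that the form is positive definite. The coefficient left over at the branch node is
  \<open>2 - p/(p+1) - q/(q+1) - 1/2\<close> for arms with \<open>p\<close>, \<open>q\<close> and \<open>1\<close> nodes, that is \<open>1/6\<close>, \<open>1/12\<close> and
  \<open>1/30\<close> for \<open>n = 6\<close>, \<open>7\<close> and \<open>8\<close>.\<close>

lemma bform_self:
  fixes a :: lattice
  shows "real_of_int (bform 6 a a) = (let a = \<lambda>j. real_of_int (lookup a j) in 2 * (a 1 - a 2 / 2)\<^sup>2 + 3/2 * (a 2 - 2/3 * a 3)\<^sup>2
      + 2 * (a 5 - a 4 / 2)\<^sup>2 + 3/2 * (a 4 - 2/3 * a 3)\<^sup>2 + 2 * (a 6 - a 3 / 2)\<^sup>2 + 1/6 * (a 3)\<^sup>2)"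
    and "real_of_int (bform 7 a a) = (let a = \<lambda>j. real_of_int (lookup a j) in 2 * (a 1 - a 2 / 2)\<^sup>2 + 3/2 * (a 2 - 2/3 * a 3)\<^sup>2
      + 2 * (a 6 - a 5 / 2)\<^sup>2 + 3/2 * (a 5 - 2/3 * a 4)\<^sup>2 + 4/3 * (a 4 - 3/4 * a 3)\<^sup>2
      + 2 * (a 7 - a 3 / 2)\<^sup>2 + 1/12 * (a 3)\<^sup>2)"
    and "real_of_int (bform 8 a a) = (let a = \<lambda>j. real_of_int (lookup a j) in 2 * (a 1 - a 2 / 2)\<^sup>2 + 3/2 * (a 2 - 2/3 * a 3)\<^sup>2
      + 4/3 * (a 3 - 3/4 * a 4)\<^sup>2 + 5/4 * (a 4 - 4/5 * a 5)\<^sup>2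
      + 2 * (a 7 - a 6 / 2)\<^sup>2 + 3/2 * (a 6 - 2/3 * a 5)\<^sup>2
      + 2 * (a 8 - a 5 / 2)\<^sup>2 + 1/30 * (a 5)\<^sup>2)"
  by (simp_all add: bform_def Let_def eval_nat_numeral sum.atLeast_Suc_atMost cartan_matrix_def joined_def
      branch_node_def doubleton_eq_iff power2_eq_square algebra_simps)

lemma numeral_intervals:
  "{1..6::nat} = {1, 2, 3, 4, 5, 6}"
  "{1..7::nat} = {1, 2, 3, 4, 5, 6, 7}"
  "{1..8::nat} = {1, 2, 3, 4, 5, 6, 7, 8}"
  by auto

lemma bform_pos_def:
  fixes \<alpha> :: lattice
  assumes n: "n \<in> {6, 7, 8}" and k: "keys \<alpha> \<subseteq> {1..n}"
  shows "bform n \<alpha> \<alpha> \<ge> 0" and "bform n \<alpha> \<alpha> = 0 \<Longrightarrow> \<alpha> = 0"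
proof -
  have "real_of_int (bform n \<alpha> \<alpha>) \<ge> 0"
    using n by (auto simp: bform_self Let_def simp del: of_int_0_le_iff intro!: add_nonneg_nonneg)
  then show "bform n \<alpha> \<alpha> \<ge> 0" by simp
  assume "bform n \<alpha> \<alpha> = 0"
  then have "real_of_int (bform n \<alpha> \<alpha>) = 0" by simp
  then have "\<forall>j\<in>{1..n}. real_of_int (lookup \<alpha> j) = 0"
    using n
    by (auto simp del: of_int_eq_0_iff atLeastAtMost_iff One_nat_def simp: bform_self Let_def add_nonneg_eq_0_iff numeral_intervals)
  then show "\<alpha> = 0"
    using k by (intro poly_mapping_eqI) (metis in_keys_iff lookup_zero of_int_eq_0_iff subsetD)
qed

text \<open>Both \<open>(\<alpha> + \<beta>|\<alpha> + \<beta>) = 4 + 2 (\<alpha>|\<beta>)\<close> and \<open>(\<alpha> - \<beta>|\<alpha> - \<beta>) = 4 - 2 (\<alpha>|\<beta>)\<close> are nonnegative, and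
  definiteness identifies the roots for which one of them vanishes.\<close>

lemma roots_bform_cases:
  assumes n: "n \<in> {6, 7, 8}" and r: "\<alpha> \<in> roots n" "\<beta> \<in> roots n"
  shows "\<beta> = - \<alpha> \<and> bform n \<alpha> \<beta> = - 2 \<or> bform n \<alpha> \<beta> = - 1 \<or> bform n \<alpha> \<beta> = 0 \<or>
    bform n \<alpha> \<beta> = 1 \<or> \<beta> = \<alpha> \<and> bform n \<alpha> \<beta> = 2"
proof -
  note nn = roots_norm[OF r(1)] roots_norm[OF r(2)] bform_sym[of n \<beta> \<alpha>]
  have k: "keys (\<alpha> + \<beta>) \<subseteq> {1..n}" "keys (\<alpha> - \<beta>) \<subseteq> {1..n}"
    using keys_roots r keys_add[of \<alpha> \<beta>] keys_diff[of \<alpha> \<beta>] by blast+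
  have p: "bform n (\<alpha> + \<beta>) (\<alpha> + \<beta>) = 4 + 2 * bform n \<alpha> \<beta>"
    "bform n (\<alpha> - \<beta>) (\<alpha> - \<beta>) = 4 - 2 * bform n \<alpha> \<beta>"
    using nn by (simp_all add: bform_add_left bform_add_right bform_diff_left bform_diff_right)
  have "bform n \<alpha> \<beta> = - 2 \<Longrightarrow> \<beta> = - \<alpha>"
    using bform_pos_def(2)[OF n k(1)] p by (simp add: eq_neg_iff_add_eq_0 add.commute)
  moreover have "bform n \<alpha> \<beta> = 2 \<Longrightarrow> \<beta> = \<alpha>"
    using bform_pos_def(2)[OF n k(2)] p by simp
  moreover have "bform n \<alpha> \<beta> \<ge> - 2" "bform n \<alpha> \<beta> \<le> 2"
    using bform_pos_def(1)[OF n k(1)] bform_pos_def(1)[OF n k(2)] p by simp_all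
  ultimately show ?thesis by linarith
qed

text \<open>If \<open>(\<alpha>|\<beta>) = -1\<close>, then \<open>\<alpha> + \<beta>\<close> is the image of \<open>\<alpha>\<close> under the reflection in \<open>\<beta>\<close>. Conversely, a root
  \<open>\<alpha> + \<beta>\<close> has norm \<open>2 = 4 + 2 (\<alpha>|\<beta>)\<close>.\<close>

lemma add_in_roots_iff:
  assumes r: "\<alpha> \<in> roots n" "\<beta> \<in> roots n"
  shows "\<alpha> + \<beta> \<in> roots n \<longleftrightarrow> bform n \<alpha> \<beta> = - 1"
proof
  note nn = roots_norm[OF r(1)] roots_norm[OF r(2)] bform_sym[of n \<beta> \<alpha>]
  assume "\<alpha> + \<beta> \<in> roots n"
  from roots_norm[OF this] show "bform n \<alpha> \<beta> = - 1"
    using nn by (simp add: bform_add_left bform_add_right)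
next
  assume "bform n \<alpha> \<beta> = - 1"
  moreover have "\<alpha> - zsmul (- 1) \<beta> = \<alpha> + \<beta>"
    by (rule poly_mapping_eqI) (simp add: lookup_minus lookup_add)
  ultimately show "\<alpha> + \<beta> \<in> roots n"
    using roots_reflect[OF r(2,1)] by (simp only:)
qed

section \<open>The cocycle\<close>

lemma nu_simple_cases: "nu_simple n j k = 1 \<or> nu_simple n j k = - 1"
  by (simp add: nu_simple_def)

lemma nu_simple_nonzero [simp]: "nu_simple n j k \<noteq> 0"
  using nu_simple_cases[of n j k] by auto

lemma nu_add_left: "nu n (\<alpha> + \<beta>) \<gamma> = nu n \<alpha> \<gamma> * nu n \<beta> \<gamma>"
  by (simp add: nu_def lookup_add power_int_add prod.distrib distrib_right)

lemma nu_add_right: "nu n \<alpha> (\<beta> + \<gamma>) = nu n \<alpha> \<beta> * nu n \<alpha> \<gamma>"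
  by (simp add: nu_def lookup_add power_int_add prod.distrib distrib_left)

lemma nu_zero [simp]: "nu n 0 \<alpha> = 1" "nu n \<alpha> 0 = 1"
  by (simp_all add: nu_def)

lemma powi_sign: "c = 1 \<or> c = - 1 \<Longrightarrow> c powi m = (if even m then 1 else c)" for c :: complex
  by (auto simp: power_int_minus_one_minus power_int_minus_left)

lemma prod_sign: "(\<And>j. j \<in> A \<Longrightarrow> f j = 1 \<or> f j = - 1) \<Longrightarrow> prod f A = 1 \<or> prod f A = - 1"
  for f :: "'a \<Rightarrow> complex"
proof (induction A rule: infinite_finite_induct)
  case (insert x A)
  then have "f x = 1 \<or> f x = - 1" "prod f A = 1 \<or> prod f A = - 1" by auto
  with insert(1,2) show ?case by auto
qed auto

lemma nu_cases: "nu n \<alpha> \<beta> = 1 \<or> nu n \<alpha> \<beta> = - 1"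
  unfolding nu_def using nu_simple_cases by (intro prod_sign) (auto simp: powi_sign)

lemma nu_square [simp]: "nu n \<alpha> \<beta> * nu n \<alpha> \<beta> = 1"
  using nu_cases[of n \<alpha> \<beta>] by auto

lemma nu_nonzero [simp]: "nu n \<alpha> \<beta> \<noteq> 0"
  using nu_cases[of n \<alpha> \<beta>] by auto

lemma nu_uminus_right: "nu n \<alpha> (- \<beta>) = nu n \<alpha> \<beta>"
  using nu_add_right[of n \<alpha> \<beta> "- \<beta>"] nu_cases[of n \<alpha> \<beta>] nu_cases[of n \<alpha> "- \<beta>"] by auto

lemma lookup_mod2 [simp]: "lookup (mod2 \<alpha>) k = of_int (lookup \<alpha> k)"
  by (simp add: mod2_def Poly_Mapping.map.rep_eq when_def)

lemma of_int_bit_eq_iff: "(of_int a :: bit) = of_int b \<longleftrightarrow> (even a \<longleftrightarrow> even b)"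
proof -
  have *: "(of_int a :: bit) = (if even a then 0 else 1)" for a
    by (cases "even a") (auto elim!: evenE oddE)
  show ?thesis by (simp add: *)
qed

lemma mod2_lift2 [simp]: "mod2 (lift2 \<gamma>) = \<gamma>"
  by (rule poly_mapping_eqI) (auto simp: lift2_def Poly_Mapping.map.rep_eq when_def)

lemma mod2_add: "mod2 (\<alpha> + \<beta>) = mod2 \<alpha> + mod2 \<beta>"
  by (rule poly_mapping_eqI) (simp add: lookup_add)

lemma nu_cong_right:
  assumes "mod2 \<beta> = mod2 \<gamma>"
  shows "nu n \<alpha> \<beta> = nu n \<alpha> \<gamma>"
proof -
  have "lookup (mod2 \<beta>) k = lookup (mod2 \<gamma>) k" for k
    using assms by simp
  then have "even (lookup \<beta> k) \<longleftrightarrow> even (lookup \<gamma> k)" for k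
    by (simp add: of_int_bit_eq_iff)
  then show ?thesis
    unfolding nu_def using nu_simple_cases by (intro prod.cong refl) (simp add: powi_sign)
qed

text \<open>Exactly one of any two joined nodes belongs to \<open>nu_set n\<close>. This gives the identity for simple roots, and both
  sides are bimultiplicative.\<close>

lemma nu_swap:
  assumes n: "n \<in> {6, 7, 8}"
  shows "nu n \<alpha> \<beta> * nu n \<beta> \<alpha> = (- 1) powi bform n \<alpha> \<beta>"
proof -
  have s: "nu_simple n j k * nu_simple n k j = (- 1) powi cartan_matrix n j k"
    if "j \<in> {1..n}" "k \<in> {1..n}" for j k
  proof -
    have "(j \<in> nu_set n) \<noteq> (k \<in> nu_set n)" if "joined n j k"
      using n that
      by (auto simp: joined_def nu_set_def branch_node_def doubleton_eq_iff eval_nat_numeral le_Suc_eq)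
    then show ?thesis
      by (auto simp: nu_simple_def cartan_matrix_def joined_def insert_commute)
  qed
  have "nu n \<beta> \<alpha> = (\<Prod>j=1..n. \<Prod>k=1..n. nu_simple n k j powi (lookup \<beta> k * lookup \<alpha> j))"
    unfolding nu_def by (rule prod.swap)
  then have "nu n \<alpha> \<beta> * nu n \<beta> \<alpha> =
      (\<Prod>j=1..n. \<Prod>k=1..n. (nu_simple n j k * nu_simple n k j) powi (lookup \<alpha> j * lookup \<beta> k))"
    unfolding nu_def by (simp add: prod.distrib[symmetric] power_int_mult_distrib mult.commute)
  also have "\<dots> = (\<Prod>j=1..n. \<Prod>k=1..n. (- 1) powi (cartan_matrix n j k * lookup \<alpha> j * lookup \<beta> k))"
    by (intro prod.cong refl) (simp add: s power_int_mult mult.assoc)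
  also have "\<dots> = (- 1) powi bform n \<alpha> \<beta>"
  proof -
    have *: "(\<Prod>j\<in>A. (- 1 :: complex) powi f j) = (- 1) powi (\<Sum>j\<in>A. f j)" for f :: "nat \<Rightarrow> int" and A
      by (induction A rule: infinite_finite_induct) (simp_all add: power_int_add)
    show ?thesis unfolding bform_def * by simp
  qed
  finally show ?thesis .
qed

lemma nu_commute:
  assumes n: "n \<in> {6, 7, 8}"
  shows "nu n \<beta> \<alpha> = (if even (bform n \<alpha> \<beta>) then nu n \<alpha> \<beta> else - nu n \<alpha> \<beta>)"
  using nu_swap[OF n, of \<alpha> \<beta>] nu_cases[of n \<alpha> \<beta>]  nu_cases[of n \<beta> \<alpha>]
  by (auto simp: powi_sign split: if_splits)

lemma nu_simple_root: "j \<in> {1..n} \<Longrightarrow> k \<in> {1..n} \<Longrightarrow>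
    nu n (simple_root j) (simple_root k) = nu_simple n j k"
  by (simp add: nu_def simple_root_def lookup_single when_def
      if_distrib[of "\<lambda>x. x * _"] if_distrib[of "\<lambda>x. _ * x"] if_distrib[of "\<lambda>x. _ powi x"] prod.delta cong: if_cong)

text \<open>Along a simple reflection \<open>\<beta> \<mapsto> \<beta> - m \<alpha>\<^sub>j\<close>, \<open>m = (\<beta>|\<alpha>\<^sub>j)\<close>, the value \<open>\<nu>(\<beta>, \<beta>)\<close> is multiplied by
  \<open>(\<nu>(\<beta>, \<alpha>\<^sub>j) \<nu>(\<alpha>\<^sub>j, \<beta>))\<^sup>m \<nu>(\<alpha>\<^sub>j, \<alpha>\<^sub>j)\<^bsup>m\<^sup>2\<^esup>\<close>, where both factors equal \<open>(-1)\<^sup>m\<close>.\<close>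

lemma nu_root_self:
  assumes n: "n \<in> {6, 7, 8}" and "\<alpha> \<in> roots n"
  shows "nu n \<alpha> \<alpha> = - 1"
  using assms(2)
proof (induction rule: roots.induct)
  case (simple j)
  then show ?case by (simp add: nu_simple_root nu_simple_def)
next
  case (reflect \<beta> j)
  define m where "m = bform n \<beta> (simple_root j)"
  define s where "s = single j m"
  have e: "mod2 s = (if even m then mod2 0 else mod2 (simple_root j))"
    unfolding s_def simple_root_def
    by (intro poly_mapping_eqI) (use of_int_bit_eq_iff[of m 1] of_int_bit_eq_iff[of m 0] in \<open>auto simp: lookup_single when_def\<close>)
  have m: "even (bform n \<beta> s) \<longleftrightarrow> even m"
    by (simp add: s_def bform_single_right m_def[symmetric])
  have ss: "nu n s s = (if even m then 1 else - 1)"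
  proof -
    have "nu n s s = nu n s (if even m then 0 else simple_root j)"
      by (rule nu_cong_right) (simp add: e)
    also have "\<dots> = nu n (if even m then 0 else simple_root j) s"
      using nu_commute[OF n, of "simple_root j" s] reflect(2)
      by (auto simp: s_def bform_single_right bform_single_left bform_simple_root_self)
    also have "\<dots> = nu n (if even m then 0 else simple_root j) (if even m then 0 else simple_root j)"
      by (rule nu_cong_right) (simp add: e)
    finally show ?thesis using reflect(2) by (simp add: nu_simple_root nu_simple_def)
  qed
  have "nu n (\<beta> - s) (\<beta> - s) = nu n \<beta> \<beta> * (nu n \<beta> s * nu n s \<beta>) * nu n s s"
    using nu_add_left[of n \<beta> "- s"] nu_add_right[of n _ \<beta> "- s"]
    by (simp add: nu_uminus nu_uminus_right)
  then show ?case
    using reflect.IH m ss nu_commute[OF n, of s \<beta>] unfolding s_def m_def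
    by (simp split: if_splits)
qed

section \<open>Orthonormal bases\<close>

lemma pscale_single: "pscale c (single k a) = single k (c * a)"
  by (rule poly_mapping_eqI) (simp add: lookup_pscale lookup_single when_def)

text \<open>The \<open>n\<close> orthonormal vectors are linearly independent in the \<open>n\<close>-dimensional space spanned by
  the simple roots, so they span it.\<close>

lemma orthonormal_basis_span:
  assumes S: "orthonormal_basis n S" and h: "keys h \<subseteq> {1..n}"
  shows "h \<in> module.span pscale (S ` {1..n})"
proof (rule ccontr)
  interpret V: vector_space "pscale :: complex \<Rightarrow> cartan \<Rightarrow> cartan" by (rule pscale_vector_space)
  define T :: "cartan set" where "T = (\<lambda>j. single j 1) ` {1..n}"
  have inT: "g \<in> V.span T" if "keys g \<subseteq> {1..n}" for g
  proof -
    have "g = (\<Sum>j\<in>keys g. pscale (lookup g j) (single j 1))"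
      by (rule poly_mapping_eqI)
        (simp add: lookup_sum lookup_pscale lookup_single when_def if_distrib[of "\<lambda>x. _ * x"] sum.delta in_keys_iff cong: if_cong)
    also have "\<dots> \<in> V.span T"
      using that by (intro V.span_sum V.span_scale V.span_base) (auto simp: T_def)
    finally show ?thesis .
  qed
  have S': "bform n (S j) (S k) = (if j = k then 1 else 0)" "keys (S j) \<subseteq> {1..n}"
    if "j \<in> {1..n}" "k \<in> {1..n}" for j k
    using S that by (auto simp: orthonormal_basis_def)
  have inj: "inj_on S {1..n}"
    by (rule inj_onI) (metis S'(1) zero_neq_one)
  have sum: "bform n (S j) (\<Sum>x\<in>A. g x) = (\<Sum>x\<in>A. bform n (S j) (g x))" for j A and g :: "cartan \<Rightarrow> cartan"
    by (induction A rule: infinite_finite_induct) (simp_all add: bform_add_right)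
  have ind: "V.independent (S ` {1..n})"
  proof (rule V.independent_if_scalars_zero)
    fix f x assume 0: "(\<Sum>x\<in>S ` {1..n}. pscale (f x) x) = 0" and "x \<in> S ` {1..n}"
    then obtain j where j: "j \<in> {1..n}" "x = S j" by blast
    have "0 = bform n (S j) (\<Sum>x\<in>S ` {1..n}. pscale (f x) x)"
      using 0 by simp
    also have "\<dots> = (\<Sum>k\<in>{1..n}. f (S k) * bform n (S j) (S k))"
      unfolding sum by (subst sum.reindex[OF inj]) (simp add: bform_pscale_right)
    also have "\<dots> = (\<Sum>k\<in>{1..n}. if k = j then f (S k) else 0)"
      using j by (intro sum.cong refl) (auto simp: S')
    finally show "f x = 0" using j by simp
  qed simp
  (* Otherwise h and the basis would be n + 1 independent vectors in the span of n vectors. *)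
  assume "h \<notin> V.span (S ` {1..n})"
  then have "V.independent (insert h (S ` {1..n}))"
    using ind by (simp add: V.independent_insert)
  moreover have "insert h (S ` {1..n}) \<subseteq> V.span T"
    using S' h inT by auto
  ultimately have "card (insert h (S ` {1..n})) \<le> card T"
    using V.independent_span_bound[of T] by (auto simp: T_def)
  moreover have "h \<notin> S ` {1..n}"
    using \<open>h \<notin> V.span (S ` {1..n})\<close> V.span_base by blast
  moreover have "card T \<le> n" using card_image_le[of "{1..n}"] unfolding T_def by fastforce
  ultimately show False using inj by (simp add: card_image)
qed

text \<open>Both sides are linear in \<open>h\<close>, and they agree for the elements of the orthonormal basis.\<close>

lemma orthonormal_basis_parseval:
  assumes S: "orthonormal_basis n S" and h: "keys h \<subseteq> {1..n}"
  shows "(\<Sum>j=1..n. bform n h (S j) * bform n g (S j)) = bform n h g"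
proof -
  interpret V: vector_space "pscale :: complex \<Rightarrow> cartan \<Rightarrow> cartan" by (rule pscale_vector_space)
  from orthonormal_basis_span[OF S h] show ?thesis
  proof (induction rule: V.span_induct)
    show "V.subspace {h. (\<Sum>j=1..n. bform n h (S j) * bform n g (S j)) = bform n h g}"
      by (rule V.subspaceI)
        (simp_all add: bform_add_left bform_pscale_left distrib_right sum.distrib mult.assoc
          flip: sum_distrib_left)
  next
    fix x assume "x \<in> S ` {1..n}"
    then obtain k where k: "k \<in> {1..n}" "x = S k" by blast
    have "(\<Sum>j=1..n. bform n x (S j) * bform n g (S j)) = (\<Sum>j=1..n. if j = k then bform n g (S j) else 0)"
      using k S by (intro sum.cong refl) (auto simp: orthonormal_basis_def)
    then show "(\<Sum>j=1..n. bform n x (S j) * bform n g (S j)) = bform n x g"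
      using k by (simp add: bform_sym[of n g])
  qed
qed

section \<open>Polynomials\<close>

(* Node numbers and exponents are written with the numeral 1 throughout. *)
declare One_nat_def [simp del]

global_interpretation PS: vector_space "pscale :: complex \<Rightarrow> ('a \<Rightarrow>\<^sub>0 complex) \<Rightarrow> 'a \<Rightarrow>\<^sub>0 complex"
  by (rule pscale_vector_space)

lemma pscale_mult_left: "pscale c f * g = pscale c (f * g)"
  for f g :: "'a::comm_monoid_add \<Rightarrow>\<^sub>0 complex"
  by (simp add: pscale_conv_mult mult.assoc)

lemma pscale_mult_right: "f * pscale c g = pscale c (f * g)"
  for f g :: "'a::comm_monoid_add \<Rightarrow>\<^sub>0 complex"
  by (simp add: pscale_conv_mult mult.left_commute)

lemma poly_mapping_sum_single: "(f :: 'a \<Rightarrow>\<^sub>0 'b::comm_monoid_add) = (\<Sum>k\<in>keys f. single k (lookup f k))"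
  by (rule poly_mapping_eqI)
    (simp add: lookup_sum lookup_single when_def sum.delta in_keys_iff cong: if_cong)

lemma poly_mapping_induct_single [case_names zero single add]:
  assumes "P 0" "\<And>k c. P (single k c)" "\<And>f g. P f \<Longrightarrow> P g \<Longrightarrow> P (f + g)"
  shows "P (f :: 'a \<Rightarrow>\<^sub>0 'b::comm_monoid_add)"
proof -
  have "P (\<Sum>k\<in>A. single k (lookup f k))" for A
    by (induction A rule: infinite_finite_induct) (use assms in auto)
  then show ?thesis using poly_mapping_sum_single by metis
qed

lemma diff_single_add:
  fixes m :: "'a \<Rightarrow>\<^sub>0 nat"
  assumes "lookup m e \<noteq> 0"
  shows "m - single e 1 + single e 1 = m"
  using assms by (intro poly_mapping_eqI) (auto simp: lookup_add lookup_minus lookup_single when_def)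

lemma lookup_x_deriv:
  "lookup (x_deriv j r f) m = of_nat (lookup m (j, r) + 1) * lookup f (m + single (j, r) 1)"
proof -
  let ?e = "single (j, r) 1 :: nat \<times> nat \<Rightarrow>\<^sub>0 nat"
  have "(of_nat (lookup k (j, r)) * lookup f k when k - ?e = m) =
      (if k = m + ?e then of_nat (lookup m (j, r) + 1) * lookup f (m + ?e) else 0)" for k
    using diff_single_add[of k "(j, r)"]
    by (cases "lookup k (j, r) = 0") (auto simp: when_def lookup_add)
  then show ?thesis
    by (simp add: x_deriv_def lookup_sum lookup_single sum.delta in_keys_iff)
qed

lemma lookup_x_deriv_eq_0_iff:
  "lookup (x_deriv j r f) m = 0 \<longleftrightarrow> lookup f (m + single (j, r) 1) = 0"
proof -
  have "(of_nat (lookup m (j, r) + 1) :: complex) \<noteq> 0"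
    unfolding of_nat_eq_0_iff by simp
  then show ?thesis unfolding lookup_x_deriv by simp
qed

lemma lookup_x_var_mult:
  "lookup (x_var j r * f) m = (if lookup m (j, r) = 0 then 0 else lookup f (m - single (j, r) 1))"
proof -
  let ?e = "single (j, r) 1 :: nat \<times> nat \<Rightarrow>\<^sub>0 nat"
  have "lookup (x_var j r * f) m = (\<Sum>q. lookup f q when m = ?e + q)"
    by (simp add: x_var_def lookup_mult lookup_single when_mult)
  also have "(\<lambda>q. lookup f q when m = ?e + q) =
      (\<lambda>q. (if lookup m (j, r) = 0 then 0 else lookup f q) when q = m - ?e)"
    using diff_single_add[of m "(j, r)"] by (auto simp: fun_eq_iff when_def lookup_add add.commute)
  finally show ?thesis by simp
qed

lemma x_deriv_add: "x_deriv j r (f + g) = x_deriv j r f + x_deriv j r g"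
  by (rule poly_mapping_eqI) (simp add: lookup_x_deriv lookup_add distrib_left)

lemma x_deriv_pscale: "x_deriv j r (pscale c f) = pscale c (x_deriv j r f)"
  by (rule poly_mapping_eqI) (simp add: lookup_x_deriv lookup_pscale)

lemma x_deriv_zero [simp]: "x_deriv j r 0 = 0"
  by (simp add: x_deriv_def)

lemma x_deriv_uminus: "x_deriv j r (- f) = - x_deriv j r f"
  by (rule poly_mapping_eqI) (simp add: lookup_x_deriv)

lemma x_deriv_sum: "x_deriv j r (sum f A) = (\<Sum>a\<in>A. x_deriv j r (f a))"
  by (induction A rule: infinite_finite_induct) (simp_all add: x_deriv_add)

lemma x_deriv_one [simp]: "x_deriv j r 1 = 0"
  by (simp add: x_deriv_def lookup_one)

lemma x_deriv_single:
  "x_deriv j r (single m c) = single (m - single (j, r) 1) (of_nat (lookup m (j, r)) * c)"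
  by (simp add: x_deriv_def)

lemma x_deriv_mult: "x_deriv j r (f * g) = x_deriv j r f * g + f * x_deriv j r g"
proof (induction f rule: poly_mapping_induct_single)
  case (single m c)
  show ?case
  proof (induction g rule: poly_mapping_induct_single)
    case (single m' c')
    have shift: "a - single (j, r) 1 + b = a + b - single (j, r) 1" if "lookup a (j, r) \<noteq> 0"
      for a b :: "nat \<times> nat \<Rightarrow>\<^sub>0 nat"
      using that by (intro poly_mapping_eqI) (auto simp: lookup_add lookup_minus lookup_single when_def)
    have "single (m - single (j, r) 1 + m') (of_nat (lookup m (j, r)) * c * c') =
        single (m + m' - single (j, r) 1) (of_nat (lookup m (j, r)) * c * c')"
      by (cases "lookup m (j, r) = 0") (simp_all add: shift)
    moreover have "single (m + (m' - single (j, r) 1)) (c * (of_nat (lookup m' (j, r)) * c')) =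
        single (m + m' - single (j, r) 1) (c * (of_nat (lookup m' (j, r)) * c'))"
      by (cases "lookup m' (j, r) = 0") (simp_all add: shift add.commute[of m])
    ultimately show ?case
      by (simp add: mult_single x_deriv_single lookup_add distrib_left distrib_right mult_ac single_add
          add.commute[of m'])
  qed (simp_all add: x_deriv_add distrib_left)
qed (simp_all add: x_deriv_add distrib_right)

lemma x_deriv_x_var: "x_deriv j r (x_var l s) = (if j = l \<and> r = s then 1 else 0)"
  by (auto simp: x_var_def x_deriv_single lookup_single)

lemma x_deriv_commute: "x_deriv j r (x_deriv l s f) = x_deriv l s (x_deriv j r f)"
  by (rule poly_mapping_eqI) (auto simp: lookup_x_deriv lookup_add lookup_single when_def add_ac)

text \<open>The creation operator \<open>r x\<^sup>(\<^sup>j\<^sup>)\<^sub>r\<close> carries the factor \<open>r\<close>, so that the central term of the Heisenberg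
  relations is \<open>i\<close> for both signs of \<open>i\<close>.\<close>

lemma a_coeff_commutator:
  assumes "odd i" "odd k"
  shows "a_coeff j i (a_coeff l k f) =
    a_coeff l k (a_coeff j i f) + (if j = l \<and> i + k = 0 then pscale (of_int i) f else 0)"
proof (cases "i > 0"; cases "k > 0")
  assume "i > 0" "k > 0"
  then show ?thesis using assms by (auto simp: a_coeff_def x_deriv_commute)
next
  assume "i > 0" "\<not> k > 0"
  then show ?thesis using assms
    by (auto simp: a_coeff_def x_deriv_pscale x_deriv_mult x_deriv_x_var PS.scale_right_distrib
        x_deriv_uminus nat_eq_iff add_eq_0_iff)
next
  assume "\<not> i > 0" "k > 0"
  then show ?thesis using assms
    by (auto simp: a_coeff_def x_deriv_pscale x_deriv_mult x_deriv_x_var PS.scale_right_distrib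
        x_deriv_uminus nat_eq_iff add_eq_0_iff)
next
  assume *: "\<not> i > 0" "\<not> k > 0"
  then have "i + k \<noteq> 0" using assms by presburger
  with * show ?thesis using assms
    by (auto simp: a_coeff_def pscale_mult_right mult_ac)
qed

lemma a_coeff_add: "a_coeff j i (f + g) = a_coeff j i f + a_coeff j i g"
  by (simp add: a_coeff_def x_deriv_add distrib_left PS.scale_right_distrib)

lemma a_coeff_pscale: "a_coeff j i (pscale c f) = pscale c (a_coeff j i f)"
  by (auto simp: a_coeff_def x_deriv_pscale pscale_mult_right pscale_mult_left mult.commute)

lemma a_coeff_zero [simp]: "a_coeff j i 0 = 0"
  by (simp add: a_coeff_def)

lemma a_coeff_uminus: "a_coeff j i (- f) = - a_coeff j i f"
  by (simp add: a_coeff_def x_deriv_uminus)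

lemma a_coeff_diff: "a_coeff j i (f - g) = a_coeff j i f - a_coeff j i g"
  by (metis a_coeff_add a_coeff_uminus diff_conv_add_uminus)

lemma a_coeff_sum: "a_coeff j i (sum f A) = (\<Sum>a\<in>A. a_coeff j i (f a))"
  by (induction A rule: infinite_finite_induct) (simp_all add: a_coeff_add)

lemma lookup_a_coeff_0: "i < 0 \<Longrightarrow> lookup (a_coeff j i f) 0 = 0"
  by (simp add: a_coeff_def lookup_pscale lookup_x_var_mult)

subsection \<open>The polynomials in the given variables\<close>

lemma polys_iff: "f \<in> polys n \<longleftrightarrow> (\<forall>m. lookup f m \<noteq> 0 \<longrightarrow> keys m \<subseteq> x_indices n)"
  unfolding polys_def by (auto simp: in_keys_iff)

lemma polys_zero [simp]: "0 \<in> polys n"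
  by (simp add: polys_iff)

lemma polys_one [simp]: "1 \<in> polys n"
  by (simp add: polys_iff lookup_one)

lemma polys_add [intro]: "f \<in> polys n \<Longrightarrow> g \<in> polys n \<Longrightarrow> f + g \<in> polys n"
  unfolding polys_iff lookup_add by (metis add.right_neutral add.left_neutral)

lemma polys_pscale [intro]: "f \<in> polys n \<Longrightarrow> pscale c f \<in> polys n"
  unfolding polys_iff lookup_pscale by auto

lemma polys_uminus [intro]: "f \<in> polys n \<Longrightarrow> - f \<in> polys n"
  unfolding polys_iff by auto

lemma polys_diff [intro]: "f \<in> polys n \<Longrightarrow> g \<in> polys n \<Longrightarrow> f - g \<in> polys n"
  using polys_add polys_uminus by (metis diff_conv_add_uminus)

lemma polys_sum [intro]: "(\<And>a. a \<in> A \<Longrightarrow> f a \<in> polys n) \<Longrightarrow> sum f A \<in> polys n"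
  by (induction A rule: infinite_finite_induct) auto

lemma polys_mult [intro]:
  assumes "f \<in> polys n" "g \<in> polys n"
  shows "f * g \<in> polys n"
proof -
  have "keys m \<subseteq> x_indices n" if "m \<in> keys (f * g)" for m
  proof -
    from that obtain a b where "m = a + b" "a \<in> keys f" "b \<in> keys g"
      using keys_mult[of f g] by blast
    then show ?thesis using assms keys_add[of a b] unfolding polys_def by blast
  qed
  then show ?thesis by (simp add: polys_def)
qed

lemma polys_x_var [intro]: "j \<in> {1..n} \<Longrightarrow> odd r \<Longrightarrow> x_var j r \<in> polys n"
  by (simp add: polys_def x_var_def x_indices_def)

lemma polys_x_deriv [intro]:
  assumes "f \<in> polys n"
  shows "x_deriv j r f \<in> polys n"
  unfolding polys_iff
proof (intro allI impI)
  fix m assume "lookup (x_deriv j r f) m \<noteq> 0"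
  then have "lookup f (m + single (j, r) 1) \<noteq> 0"
    by (simp add: lookup_x_deriv)
  then have "keys (m + single (j, r) 1) \<subseteq> x_indices n"
    using assms by (simp add: polys_iff)
  moreover have "keys m \<subseteq> keys (m + single (j, r) 1)"
    by (auto simp: in_keys_iff lookup_add)
  ultimately show "keys m \<subseteq> x_indices n" by blast
qed

lemma polys_a_coeff [intro]: "j \<in> {1..n} \<Longrightarrow> f \<in> polys n \<Longrightarrow> a_coeff j i f \<in> polys n"
  by (auto simp: a_coeff_def even_nat_iff intro!: polys_pscale polys_mult polys_uminus)

lemma polys_induct [consumes 1, case_names one x_var add pscale]:
  assumes f: "f \<in> polys n" and one: "P 1"
    and x_var: "\<And>j r f. j \<in> {1..n} \<Longrightarrow> odd r \<Longrightarrow> f \<in> polys n \<Longrightarrow> P f \<Longrightarrow> P (x_var j r * f)"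
    and add: "\<And>f g. f \<in> polys n \<Longrightarrow> g \<in> polys n \<Longrightarrow> P f \<Longrightarrow> P g \<Longrightarrow> P (f + g)"
    and pscale: "\<And>c f. f \<in> polys n \<Longrightarrow> P f \<Longrightarrow> P (pscale c f)"
  shows "P f"
proof -
  have mono: "single m 1 \<in> polys n \<and> P (single m 1)" if "keys m \<subseteq> x_indices n" for m
  proof -
    have step: "single (single (j, r) a + k) 1 \<in> polys n \<and> P (single (single (j, r) a + k) 1)"
      if "j \<in> {1..n}" "odd r" "single k 1 \<in> polys n \<and> P (single k 1)" for j r a and k :: "nat \<times> nat \<Rightarrow>\<^sub>0 nat"
    proof (induction a)
      case (Suc a)
      have "single (single (j, r) (Suc a) + k) 1 = x_var j r * single (single (j, r) a + k) 1"
        using single_add[of "(j, r)" 1 a] by (simp add: x_var_def mult_single add.assoc[symmetric] plus_1_eq_Suc)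
      then show ?case using Suc that(1,2) x_var polys_mult polys_x_var by auto
    qed (use that in auto)
    have "single (\<Sum>k\<in>A. single k (lookup m k)) 1 \<in> polys n \<and>
        P (single (\<Sum>k\<in>A. single k (lookup m k)) 1)" if "A \<subseteq> x_indices n" for A
      using that
    proof (induction A rule: infinite_finite_induct)
      case (insert k A)
      then show ?case
        using step[of "fst k" "snd k"] by (auto simp: x_indices_def)
    qed (use one in auto)
    from this[OF that] show ?thesis using poly_mapping_sum_single[of m] by simp
  qed
  have zero: "P 0" using pscale[of 1 0] one by simp
  have "(\<Sum>m\<in>A. single m (lookup f m)) \<in> polys n \<and> P (\<Sum>m\<in>A. single m (lookup f m))"
    if "A \<subseteq> keys f" for A
    using that
  proof (induction A rule: infinite_finite_induct)
    case (insert m A)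
    then have "keys m \<subseteq> x_indices n" using f by (auto simp: polys_def)
    moreover have "single m (lookup f m) = pscale (lookup f m) (single m 1)"
      by (simp add: pscale_single)
    ultimately have "single m (lookup f m) \<in> polys n \<and> P (single m (lookup f m))"
      using mono pscale by auto
    then show ?case using insert add by auto
  qed (use zero in auto)
  from this[of "keys f"] show ?thesis using poly_mapping_sum_single[of f] by simp
qed

lemma polys_constant:
  assumes f: "f \<in> polys n" and d: "\<And>j r. j \<in> {1..n} \<Longrightarrow> odd r \<Longrightarrow> x_deriv j r f = 0"
  shows "f = pscale (lookup f 0) 1"
proof (rule poly_mapping_eqI)
  fix m
  have "m = 0" if "lookup f m \<noteq> 0"
  proof (rule ccontr)
    assume "m \<noteq> 0"
    then obtain e where e: "lookup m e \<noteq> 0" by (metis lookup_zero poly_mapping_eqI)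
    then have "e \<in> x_indices n" using that f by (metis polys_iff in_keys_iff subsetD)
    then have "lookup (x_deriv (fst e) (snd e) f) (m - single e 1) = 0"
      using d[of "fst e" "snd e"] by (auto simp: x_indices_def)
    then show False using that e diff_single_add[OF e]
      by (auto simp: lookup_x_deriv_eq_0_iff)
  qed
  then show "lookup f m = lookup (pscale (lookup f 0) 1) m"
    by (auto simp: lookup_pscale lookup_one when_def)
qed

subsection \<open>The energy operator\<close>

text \<open>A variable with lower index \<open>r\<close> has weight \<open>r\<close>. The Euler operator below, which is the action of the energy
  operator on one component of the Fock space, multiplies each monomial by its weight.\<close>

definition weight :: "(nat \<times> nat \<Rightarrow>\<^sub>0 nat) \<Rightarrow> nat" where
  "weight m = (\<Sum>e\<in>keys m. snd e * lookup m e)"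

lemma weight_zero [simp]: "weight 0 = 0"
  by (simp add: weight_def)

lemma weight_add_single: "weight (m + single (j, r) 1) = weight m + r"
  unfolding weight_def by (subst setsum_keys_plus_distrib) (auto simp: distrib_left)

definition euler :: "nat \<Rightarrow> poly_x \<Rightarrow> poly_x" where
  "euler n f =
    (\<Sum>(j, r)\<in>x_indices n \<inter> (\<Union>m\<in>keys f. keys m). pscale (of_nat r) (x_var j r * x_deriv j r f))"

lemma lookup_x_var_x_deriv:
  "lookup (x_var j r * x_deriv j r f) m = of_nat (lookup m (j, r)) * lookup f m"
  using diff_single_add[of m "(j, r)"]
  by (auto simp: lookup_x_var_mult lookup_x_deriv lookup_minus simp del: of_nat_Suc)

lemma lookup_euler:
  assumes "f \<in> polys n"
  shows "lookup (euler n f) m = of_nat (weight m) * lookup f m"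
proof (cases "lookup f m = 0")
  case False
  let ?A = "x_indices n \<inter> (\<Union>m\<in>keys f. keys m)"
  have fin: "finite ?A" by auto
  have sub: "keys m \<subseteq> ?A" using assms False by (auto simp: polys_iff in_keys_iff)
  have "lookup (euler n f) m = (\<Sum>e\<in>?A. of_nat (snd e * lookup m e) * lookup f m)"
    by (auto simp: euler_def lookup_sum lookup_pscale lookup_x_var_x_deriv case_prod_unfold intro!: sum.cong)
  also have "\<dots> = (\<Sum>e\<in>keys m. of_nat (snd e * lookup m e) * lookup f m)"
    using fin sub by (intro sum.mono_neutral_right) (auto simp: in_keys_iff)
  also have "\<dots> = of_nat (weight m) * lookup f m"
    by (simp add: weight_def flip: sum_distrib_right)
  finally show ?thesis .
qed (simp add: euler_def lookup_sum lookup_pscale lookup_x_var_x_deriv case_prod_unfold)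

lemma polys_euler [intro]: "f \<in> polys n \<Longrightarrow> euler n f \<in> polys n"
  by (auto simp: polys_iff[of "euler n f"] lookup_euler polys_iff[of f])

lemma euler_add: "f \<in> polys n \<Longrightarrow> g \<in> polys n \<Longrightarrow> euler n (f + g) = euler n f + euler n g"
  by (rule poly_mapping_eqI) (simp add: lookup_euler polys_add lookup_add distrib_left)

lemma euler_pscale: "f \<in> polys n \<Longrightarrow> euler n (pscale c f) = pscale c (euler n f)"
  by (rule poly_mapping_eqI) (simp add: lookup_euler polys_pscale lookup_pscale)

lemma euler_zero [simp]: "euler n 0 = 0"
  by (simp add: euler_def)

lemma euler_one [simp]: "euler n 1 = 0"
  by (simp add: euler_def)

lemma lookup_euler_0: "f \<in> polys n \<Longrightarrow> lookup (euler n f) 0 = 0"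
  by (simp add: lookup_euler)

lemma euler_a_coeff:
  assumes "j \<in> {1..n}" "odd i" "f \<in> polys n"
  shows "euler n (a_coeff j i f) = a_coeff j i (euler n f) - pscale (of_int i) (a_coeff j i f)"
proof (cases "i > 0")
  case True
  then show ?thesis using assms
    by (intro poly_mapping_eqI)
      (simp add: a_coeff_def lookup_euler polys_x_deriv lookup_x_deriv lookup_minus lookup_pscale
        weight_add_single algebra_simps del: of_nat_Suc)
next
  case False
  define r where "r = nat (- i)"
  have r: "odd r" "i = - int r" using False assms by (auto simp: r_def even_nat_iff)
  have "euler n (x_var j r * f) = x_var j r * euler n f + pscale (of_nat r) (x_var j r * f)"
  proof (rule poly_mapping_eqI)
    fix m
    have "weight m = weight (m - single (j, r) 1) + r" if "lookup m (j, r) \<noteq> 0"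
      using weight_add_single[of "m - single (j, r) 1" j r] diff_single_add[OF that] by simp
    then show "lookup (euler n (x_var j r * f)) m =
        lookup (x_var j r * euler n f + pscale (of_nat r) (x_var j r * f)) m"
      using assms r by (auto simp: lookup_euler polys_mult polys_x_var lookup_x_var_mult lookup_add
          lookup_pscale distrib_right distrib_left)
  qed
  then show ?thesis using r assms
    by (auto simp: a_coeff_def euler_pscale polys_mult polys_x_var PS.scale_right_distrib
        PS.scale_minus_left)
qed

text \<open>Expressing the Euler operator by Heisenberg operators allows to evaluate it on a polynomial of which only
  the commutators with the Heisenberg operators are known. The bound \<open>N\<close> makes the sum finite.\<close>

lemma euler_conv_a_coeff:
  assumes f: "f \<in> polys n" and N: "\<And>j r. j \<in> {1..n} \<Longrightarrow> odd r \<Longrightarrow> r > N \<Longrightarrow> x_deriv j r f = 0"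
  shows "euler n f = (\<Sum>j=1..n. \<Sum>r\<in>{r. odd r \<and> r \<le> N}. a_coeff j (- int r) (a_coeff j (int r) f))"
proof (rule poly_mapping_eqI)
  fix m
  let ?B = "{1..n} \<times> {r. odd r \<and> r \<le> N}"
  have "lookup (\<Sum>j=1..n. \<Sum>r\<in>{r. odd r \<and> r \<le> N}. a_coeff j (- int r) (a_coeff j (int r) f)) m =
      (\<Sum>j=1..n. \<Sum>r\<in>{r. odd r \<and> r \<le> N}. of_nat (r * lookup m (j, r)) * lookup f m)"
    unfolding lookup_sum
    by (intro sum.cong refl)
      (auto simp: a_coeff_def lookup_pscale lookup_x_var_x_deriv elim!: oddE)
  also have "\<dots> = (\<Sum>e\<in>?B. of_nat (snd e * lookup m e) * lookup f m)"
    by (simp add: sum.cartesian_product case_prod_unfold)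
  also have "\<dots> = (\<Sum>e\<in>keys m. of_nat (snd e * lookup m e) * lookup f m)"
  proof (cases "lookup f m = 0")
    case False
    have "keys m \<subseteq> ?B"
    proof
      fix e assume e: "e \<in> keys m"
      then have "e \<in> x_indices n" using f False by (auto simp: polys_iff)
      then have e': "fst e \<in> {1..n}" "odd (snd e)" "lookup m e \<noteq> 0"
        using e by (auto simp: x_indices_def in_keys_iff)
      have "lookup (x_deriv (fst e) (snd e) f) (m - single e 1) \<noteq> 0"
        using False e' diff_single_add[OF e'(3)] by (auto simp: lookup_x_deriv_eq_0_iff)
      then have "snd e \<le> N" using N[of "fst e" "snd e"] e' by (auto intro: leI)
      then show "e \<in> ?B" using e' by (cases e) auto
    qed
    then show ?thesis by (intro sum.mono_neutral_right) (auto simp: in_keys_iff)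
  qed simp
  also have "\<dots> = lookup (euler n f) m"
    by (simp add: lookup_euler[OF f] weight_def flip: sum_distrib_right)
  finally show "lookup (euler n f) m =
    lookup (\<Sum>j=1..n. \<Sum>r\<in>{r. odd r \<and> r \<le> N}. a_coeff j (- int r) (a_coeff j (int r) f)) m" by simp
qed

section \<open>Vertex operators\<close>

subsection \<open>Exponentials of operators\<close>

lemma pscale_one: "pscale c 1 = single (0 :: 'a::comm_monoid_add) c"
  by (simp add: pscale_conv_mult)

lemma pscale_of_nat: "of_nat k * f = pscale (of_nat k) (f :: poly_x)"
  by (simp add: pscale_conv_mult)

text \<open>The exponential series of an operator of this kind is finite in each coefficient.\<close>

locale order_raising =
  fixes T :: "poly_x fps \<Rightarrow> poly_x fps"
  assumes T_add: "T (F + G) = T F + T G"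
    and T_raises: "(\<forall>i<m. fps_nth F i = 0) \<Longrightarrow> i \<le> m \<Longrightarrow> fps_nth (T F) i = 0"
begin

lemma T_zero [simp]: "T 0 = 0"
  using T_add[of 0 0] by simp

lemma T_of_nat: "T (of_nat k * F) = of_nat k * T F"
  by (induction k) (simp_all add: distrib_right T_add)

lemma T_power_raises: "m < k \<Longrightarrow> fps_nth ((T ^^ k) F) m = 0"
proof (induction k arbitrary: m)
  case (Suc k)
  then show ?case using T_raises[of k "(T ^^ k) F" m] by simp
qed simp

lemma fps_nth_series_exp:
  assumes "m \<le> N"
  shows "fps_nth (series_exp T F) m = (\<Sum>k\<le>N. pscale (1 / fact k) (fps_nth ((T ^^ k) F) m))"
  unfolding series_exp_def fps_nth_Abs_fps
  using assms by (intro sum.mono_neutral_left) (auto simp: T_power_raises)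

lemma series_exp_add: "series_exp T (F + G) = series_exp T F + series_exp T G"
proof -
  have "(T ^^ k) (F + G) = (T ^^ k) F + (T ^^ k) G" for k
    by (induction k) (simp_all add: T_add)
  then show ?thesis
    by (intro fps_ext) (simp add: series_exp_def PS.scale_right_distrib sum.distrib)
qed

lemma series_exp_kernel: "T F = 0 \<Longrightarrow> series_exp T F = F"
proof (rule fps_ext)
  fix m assume "T F = 0"
  have "(T ^^ Suc k) F = 0" for k
    by (induction k) (simp_all add: \<open>T F = 0\<close>)
  then have "(T ^^ k) F = (if k = 0 then F else 0)" for k by (cases k) auto
  then show "fps_nth (series_exp T F) m = fps_nth F m"
    by (simp add: series_exp_def if_distrib[of "\<lambda>x. fps_nth x _"] if_distrib[of "pscale _"] cong: if_cong)
qed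

lemma series_exp_scale:
  assumes "\<And>F. T (Z * F) = Z * T F" "Z = fps_const (single 0 c)"
  shows "series_exp T (Z * F) = Z * series_exp T F"
proof -
  have "(T ^^ k) (Z * F) = Z * (T ^^ k) F" for k
    by (induction k) (simp_all add: assms(1))
  then show ?thesis
    by (intro fps_ext) (simp add: series_exp_def assms(2) sum_distrib_left pscale_conv_mult mult_ac)
qed

text \<open>If the commutator \<open>[D, T] = Z\<close> commutes with \<open>T\<close>, then \<open>[D, T\<^sup>k] = k Z T\<^bsup>k-1\<^esup>\<close>, and hence
  \<open>[D, exp T] = Z exp T\<close>. In both exponentials of a vertex operator, \<open>Z\<close> is a scalar multiple of a power of
  the formal variable.\<close>

lemma series_exp_commutator:
  fixes d :: "poly_x \<Rightarrow> poly_x"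
  defines "D \<equiv> \<lambda>F. Abs_fps (\<lambda>m. d (fps_nth F m))"
  assumes d_add: "\<And>f g. d (f + g) = d f + d g" and d_pscale: "\<And>c f. d (pscale c f) = pscale c (d f)"
    and Z: "Z = fps_const (single 0 c) * fps_X ^ r" "r \<ge> 1"
    and TZ: "\<And>F. T (Z * F) = Z * T F"
    and comm: "\<And>F. D (T F) = T (D F) + Z * F"
  shows "D (series_exp T F) = series_exp T (D F) + Z * series_exp T F"
proof (rule fps_ext)
  fix m
  have D_pow: "D ((T ^^ k) F) = (T ^^ k) (D F) + of_nat k * (Z * (T ^^ (k - 1)) F)" for k
  proof (induction k)
    case (Suc k)
    have "T (of_nat k * (Z * (T ^^ (k - 1)) F)) = of_nat k * (Z * (T ^^ k) F)"
      by (cases k) (simp_all add: T_of_nat TZ del: of_nat_Suc)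
    then show ?case by (simp add: comm Suc T_add distrib_right)
  qed simp
  have d_sum: "d (sum g A) = (\<Sum>a\<in>A. d (g a))" for g :: "nat \<Rightarrow> poly_x" and A
    by (induction A rule: infinite_finite_induct) (use d_add d_pscale[of 0 0] in auto)
  have Z_nth: "fps_nth (Z * G) m = (if m < r then 0 else pscale c (fps_nth G (m - r)))" for G m
    by (simp add: Z mult.assoc fps_X_power_mult_nth pscale_conv_mult)
  have d_pow: "d (fps_nth ((T ^^ k) F) m) =
      fps_nth ((T ^^ k) (D F)) m + pscale (of_nat k) (fps_nth (Z * (T ^^ (k - 1)) F) m)" for k
    using arg_cong[OF D_pow, of "\<lambda>F. fps_nth F m" k]
    by (simp add: D_def pscale_of_nat flip: fps_of_nat)
  have "fps_nth (D (series_exp T F)) m = (\<Sum>k\<le>m. pscale (1 / fact k) (d (fps_nth ((T ^^ k) F) m)))"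
    by (simp add: D_def series_exp_def d_sum d_pscale)
  also have "\<dots> = (\<Sum>k\<le>m. pscale (1 / fact k) (fps_nth ((T ^^ k) (D F)) m)) +
      (\<Sum>k\<le>m. pscale (of_nat k / fact k) (fps_nth (Z * (T ^^ (k - 1)) F) m))"
    by (simp add: d_pow PS.scale_right_distrib sum.distrib)
  also have "(\<Sum>k\<le>m. pscale (of_nat k / fact k) (fps_nth (Z * (T ^^ (k - 1)) F) m)) =
      fps_nth (Z * series_exp T F) m"
  proof (cases "m < r")
    case False
    then obtain m' where m': "m = Suc m'" using Z(2) by (cases m) auto
    have "(\<Sum>k\<le>m. pscale (of_nat k / fact k) (fps_nth (Z * (T ^^ (k - 1)) F) m)) =
        (\<Sum>k\<le>m'. pscale (of_nat (Suc k) / fact (Suc k)) (fps_nth (Z * (T ^^ k) F) m))"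
      unfolding m' by (subst sum.atMost_Suc_shift) simp
    also have "\<dots> = (\<Sum>k\<le>m'. pscale (1 / fact k) (fps_nth (Z * (T ^^ k) F) m))"
    proof -
      have "of_nat (Suc k) / fact (Suc k) = (1 / fact k :: complex)" for k
        by (simp add: fact_Suc del: of_nat_Suc)
      then show ?thesis by simp
    qed
    also have "\<dots> = pscale c (fps_nth (series_exp T F) (m - r))"
      using False Z(2) m' by (simp add: Z_nth fps_nth_series_exp[of "Suc m' - r" m'] PS.scale_sum_right mult.commute)
    finally show ?thesis using False by (simp add: Z_nth)
  qed (simp add: Z_nth)
  finally show "fps_nth (D (series_exp T F)) m = fps_nth (series_exp T (D F) + Z * series_exp T F) m"
    by (simp add: series_exp_def)
qed

end

subsection \<open>The creation part\<close>

definition plus_series :: "nat \<Rightarrow> (nat \<Rightarrow> cartan) \<Rightarrow> lattice \<Rightarrow> poly_x fps" where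
  "plus_series n S \<alpha> =
     Abs_fps (\<lambda>r. if odd r then \<Sum>j=1..n. pscale (lam n S \<alpha> j) (x_var j r) else 0)"

lemma exp_plus_conv: "exp_plus n S \<alpha> = series_exp ((*) (plus_series n S \<alpha>)) 1"
  by (simp add: exp_plus_def plus_series_def)

interpretation EP: order_raising "(*) (plus_series n S \<alpha>)"
proof
  fix F :: "poly_x fps" and m i :: nat assume *: "\<forall>i<m. fps_nth F i = 0" "i \<le> m"
  have "fps_nth (plus_series n S \<alpha>) k * fps_nth F (i - k) = 0" if "k \<le> i" for k
    using * that by (cases "k = 0") (auto simp: plus_series_def)
  then show "fps_nth (plus_series n S \<alpha> * F) i = 0"
    by (simp add: fps_mult_nth)
qed (simp add: distrib_left)

lemma exp_plus_0: "fps_nth (exp_plus n S \<alpha>) 0 = 1"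
  by (simp add: exp_plus_conv series_exp_def)

lemma lookup_exp_plus_0: "lookup (fps_nth (exp_plus n S \<alpha>) m) 0 = (if m = 0 then 1 else 0)"
proof (cases "m = 0")
  case False
  have "lookup (fps_nth (plus_series n S \<alpha> * F) m) 0 = 0" for F
    by (auto simp: fps_mult_nth lookup_sum plus_series_def sum_distrib_right pscale_mult_left
        lookup_pscale lookup_x_var_mult intro!: sum.neutral)
  then have "lookup (fps_nth (((*) (plus_series n S \<alpha>) ^^ k) 1) m) 0 = 0" for k
    using False by (cases k) simp_all
  then show ?thesis
    using False by (simp add: exp_plus_conv series_exp_def lookup_sum lookup_pscale)
qed (simp add: exp_plus_0)

lemma polys_exp_plus: "fps_nth (exp_plus n S \<alpha>) m \<in> polys n"
proof -
  have "\<forall>m. fps_nth (((*) (plus_series n S \<alpha>) ^^ k) 1) m \<in> polys n" for k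
    by (induction k) (auto simp: fps_mult_nth plus_series_def fps_one_def intro!: polys_sum polys_mult polys_pscale polys_x_var)
  then show ?thesis
    by (auto simp: exp_plus_conv series_exp_def intro!: polys_sum polys_pscale)
qed

lemma x_deriv_exp_plus:
  assumes j: "j \<in> {1..n}" and r: "odd r"
  shows "x_deriv j r (fps_nth (exp_plus n S \<alpha>) m) =
    (if m < r then 0 else pscale (lam n S \<alpha> j) (fps_nth (exp_plus n S \<alpha>) (m - r)))"
proof -
  define A where "A = plus_series n S \<alpha>"
  define D where "D = (\<lambda>F :: poly_x fps. Abs_fps (\<lambda>m. x_deriv j r (fps_nth F m)))"
  define Z :: "poly_x fps" where "Z = fps_const (single 0 (lam n S \<alpha> j)) * fps_X ^ r"
  have r1: "r \<ge> 1" using r by (cases r) auto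
  have DA: "D A = Z"
  proof (rule fps_ext)
    fix m
    have "x_deriv j r (fps_nth A m) = (if m = r then single 0 (lam n S \<alpha> j) else 0)"
      using j r by (auto simp: A_def plus_series_def x_deriv_sum x_deriv_pscale x_deriv_x_var pscale_one
          if_distrib[of "pscale _"] cong: if_cong)
    then show "fps_nth (D A) m = fps_nth Z m"
      using j r by (auto simp: D_def Z_def fps_X_power_nth)
  qed
  have "D (A * F) = A * D F + Z * F" for F
    unfolding DA[symmetric]
    by (intro fps_ext) (simp add: D_def fps_mult_nth x_deriv_sum x_deriv_mult sum.distrib)
  then have "D (series_exp ((*) A) 1) = series_exp ((*) A) (D 1) + Z * series_exp ((*) A) 1"
    unfolding A_def D_def
    by (intro EP.series_exp_commutator[OF _ _ Z_def r1])
      (simp_all add: x_deriv_add x_deriv_pscale mult_ac)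
  also have "D 1 = 0" by (intro fps_ext) (simp add: D_def fps_one_def)
  also have "series_exp ((*) A) 0 = 0" unfolding A_def by (intro EP.series_exp_kernel) simp
  finally have "D (exp_plus n S \<alpha>) = Z * exp_plus n S \<alpha>"
    by (simp add: exp_plus_conv A_def)
  from arg_cong[OF this, of "\<lambda>F. fps_nth F m"] show ?thesis
    by (simp add: D_def Z_def mult.assoc fps_X_power_mult_nth pscale_conv_mult)
qed

subsection \<open>The annihilation part\<close>

definition minus_op :: "nat \<Rightarrow> (nat \<Rightarrow> cartan) \<Rightarrow> lattice \<Rightarrow> poly_x fps \<Rightarrow> poly_x fps" where
  "minus_op n S \<alpha> F = Abs_fps (\<lambda>m. \<Sum>r\<in>{r. r \<le> m \<and> odd r}. \<Sum>j=1..n.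
          pscale (- lam n S \<alpha> j / of_nat r) (x_deriv j r (fps_nth F (m - r))))"

lemma exp_minus_conv: "exp_minus n S \<alpha> f = series_exp (minus_op n S \<alpha>) (fps_const f)"
proof -
  have "minus_op n S \<alpha> = (\<lambda>F. Abs_fps (\<lambda>m. \<Sum>r\<in>{r. r \<le> m \<and> odd r}. \<Sum>j=1..n.
          pscale (- lam n S \<alpha> j / of_nat r) (x_deriv j r (fps_nth F (m - r)))))"
    by (rule ext) (rule minus_op_def)
  then show ?thesis by (simp only: exp_minus_def)
qed

interpretation EM: order_raising "minus_op n S \<alpha>"
proof
  show "minus_op n S \<alpha> (F + G) = minus_op n S \<alpha> F + minus_op n S \<alpha> G" for F G
    by (intro fps_ext)
      (simp add: minus_op_def x_deriv_add PS.scale_right_distrib sum.distrib del: PS.scale_minus_left)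
next
  fix F :: "poly_x fps" and m i :: nat assume *: "\<forall>i<m. fps_nth F i = 0" "i \<le> m"
  have "fps_nth F (i - r) = 0" if "r \<le> i" "odd r" for r
    using * that by (cases r) auto
  then show "fps_nth (minus_op n S \<alpha> F) i = 0"
    by (simp add: minus_op_def)
qed

lemma minus_op_monom_mult:
  fixes F :: "poly_x fps"
  assumes Z: "Z = fps_const (single 0 c) * fps_X ^ s"
  shows "minus_op n S \<alpha> (Z * F) = Z * minus_op n S \<alpha> F"
proof (rule fps_ext)
  fix m
  have Z_nth: "fps_nth (Z * G) m = (if m < s then 0 else pscale c (fps_nth G (m - s)))" for G m
    by (simp add: Z mult.assoc fps_X_power_mult_nth pscale_conv_mult)
  have "fps_nth (minus_op n S \<alpha> (Z * F)) m = (\<Sum>r\<in>{r. r \<le> m \<and> odd r}. \<Sum>j=1..n.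
      pscale (- lam n S \<alpha> j / of_nat r) (x_deriv j r (if m - r < s then 0 else pscale c (fps_nth F (m - r - s)))))"
    by (simp add: minus_op_def Z_nth)
  also have "\<dots> = (\<Sum>r\<in>{r. r + s \<le> m \<and> odd r}. \<Sum>j=1..n.
      pscale (- lam n S \<alpha> j / of_nat r) (x_deriv j r (if m - r < s then 0 else pscale c (fps_nth F (m - r - s)))))"
    by (rule sum.mono_neutral_right) auto
  also have "\<dots> = (\<Sum>r\<in>{r. r + s \<le> m \<and> odd r}. pscale c (\<Sum>j=1..n.
      pscale (- lam n S \<alpha> j / of_nat r) (x_deriv j r (fps_nth F (m - s - r)))))"
    by (intro sum.cong refl) (auto simp: x_deriv_pscale PS.scale_sum_right mult.commute add.commute[of s] intro!: sum.cong)
  also have "\<dots> = fps_nth (Z * minus_op n S \<alpha> F) m"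
  proof (cases "m < s")
    case False
    then have "{r. r + s \<le> m \<and> odd r} = {r. r \<le> m - s \<and> odd r}" by auto
    with False show ?thesis by (simp add: Z_nth minus_op_def PS.scale_sum_right)
  next
    case True
    then have "{r. r + s \<le> m \<and> odd r} = {}" by auto
    with True show ?thesis by (simp add: Z_nth)
  qed
  finally show "fps_nth (minus_op n S \<alpha> (Z * F)) m = fps_nth (Z * minus_op n S \<alpha> F) m" .
qed

lemma exp_minus_add: "exp_minus n S \<alpha> (f + g) = exp_minus n S \<alpha> f + exp_minus n S \<alpha> g"
  by (simp add: exp_minus_conv EM.series_exp_add flip: fps_const_add)

lemma exp_minus_pscale:
  "fps_nth (exp_minus n S \<alpha> (pscale c f)) m = pscale c (fps_nth (exp_minus n S \<alpha> f) m)"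
proof -
  have "series_exp (minus_op n S \<alpha>) (fps_const (single 0 c) * fps_const f) =
      fps_const (single 0 c) * series_exp (minus_op n S \<alpha>) (fps_const f)"
    by (rule EM.series_exp_scale[OF minus_op_monom_mult[of _ c 0] refl]) simp
  then show ?thesis by (simp add: exp_minus_conv pscale_conv_mult)
qed

lemma exp_minus_one: "exp_minus n S \<alpha> 1 = 1"
proof -
  have "minus_op n S \<alpha> 1 = 0"
    by (intro fps_ext) (auto simp: minus_op_def fps_one_def intro!: sum.neutral)
  then show ?thesis by (simp add: exp_minus_conv EM.series_exp_kernel)
qed

lemma exp_minus_x_deriv:
  "fps_nth (exp_minus n S \<alpha> (x_deriv l s f)) m = x_deriv l s (fps_nth (exp_minus n S \<alpha> f) m)"
proof -
  define D where "D = (\<lambda>F :: poly_x fps. Abs_fps (\<lambda>m. x_deriv l s (fps_nth F m)))"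
  have "D (minus_op n S \<alpha> F) = minus_op n S \<alpha> (D F) + fps_const (single 0 0) * fps_X ^ 1 * F" for F
    by (intro fps_ext) (simp add: D_def minus_op_def x_deriv_sum x_deriv_pscale x_deriv_commute[of l s]
        del: PS.scale_minus_left)
  then have "D (series_exp (minus_op n S \<alpha>) (fps_const f)) = series_exp (minus_op n S \<alpha>) (D (fps_const f)) +
      fps_const (single 0 0) * fps_X ^ 1 * series_exp (minus_op n S \<alpha>) (fps_const f)"
    unfolding D_def
    by (intro EM.series_exp_commutator[OF _ _ refl le_refl])
      (simp_all add: x_deriv_add x_deriv_pscale)
  moreover have "D (fps_const f) = fps_const (x_deriv l s f)"
    by (intro fps_ext) (simp add: D_def)
  ultimately have "D (exp_minus n S \<alpha> f) = exp_minus n S \<alpha> (x_deriv l s f)"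
    by (simp add: exp_minus_conv)
  from arg_cong[OF this, of "\<lambda>F. fps_nth F m"] show ?thesis
    by (simp add: D_def)
qed

lemma exp_minus_x_var:
  assumes l: "l \<in> {1..n}" and s: "odd s"
  shows "fps_nth (exp_minus n S \<alpha> (x_var l s * f)) m = x_var l s * fps_nth (exp_minus n S \<alpha> f) m -
    (if m < s then 0 else pscale (lam n S \<alpha> l / of_nat s) (fps_nth (exp_minus n S \<alpha> f) (m - s)))"
proof -
  define D where "D = (\<lambda>F :: poly_x fps. Abs_fps (\<lambda>m. x_var l s * fps_nth F m))"
  define c where "c = lam n S \<alpha> l / of_nat s"
  define Z :: "poly_x fps" where "Z = fps_const (single 0 c) * fps_X ^ s"
  have s1: "s \<ge> 1" using s by (cases s) auto
  have Z_nth: "fps_nth (Z * G) m = (if m < s then 0 else pscale c (fps_nth G (m - s)))" for G m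
    by (simp add: Z_def mult.assoc fps_X_power_mult_nth pscale_conv_mult)
  have comm: "D (minus_op n S \<alpha> F) = minus_op n S \<alpha> (D F) + Z * F" for F
  proof (rule fps_ext)
    fix m :: nat
    let ?A = "{r. r \<le> m \<and> odd r}"
    have "fps_nth (minus_op n S \<alpha> (D F)) m = (\<Sum>r\<in>?A. \<Sum>j=1..n.
        pscale (- lam n S \<alpha> j / of_nat r) (x_var l s * x_deriv j r (fps_nth F (m - r)))) +
        (\<Sum>r\<in>?A. \<Sum>j=1..n. if j = l then if r = s then pscale (- lam n S \<alpha> j / of_nat r) (fps_nth F (m - r)) else 0 else 0)"
      unfolding sum.distrib[symmetric] minus_op_def
      by (auto simp: D_def x_deriv_mult x_deriv_x_var PS.scale_right_distrib PS.scale_right_diff_distrib intro!: sum.cong)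
    also have "(\<Sum>r\<in>?A. \<Sum>j=1..n. if j = l then if r = s then pscale (- lam n S \<alpha> j / of_nat r) (fps_nth F (m - r)) else 0 else 0)
        = - fps_nth (Z * F) m"
      using l s by (simp add: Z_nth c_def)
    finally show "fps_nth (D (minus_op n S \<alpha> F)) m = fps_nth (minus_op n S \<alpha> (D F) + Z * F) m"
      by (simp add: D_def minus_op_def sum_distrib_left pscale_mult_right)
  qed
  then have "D (series_exp (minus_op n S \<alpha>) (fps_const f)) = series_exp (minus_op n S \<alpha>) (D (fps_const f)) +
      Z * series_exp (minus_op n S \<alpha>) (fps_const f)"
    unfolding D_def
    by (intro EM.series_exp_commutator[OF _ _ Z_def s1])
      (simp_all add: distrib_left pscale_mult_right minus_op_monom_mult[OF Z_def])
  moreover have "D (fps_const f) = fps_const (x_var l s * f)"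
    by (intro fps_ext) (simp add: D_def)
  ultimately have "D (exp_minus n S \<alpha> f) = exp_minus n S \<alpha> (x_var l s * f) + Z * exp_minus n S \<alpha> f"
    by (simp add: exp_minus_conv)
  from arg_cong[OF this, of "\<lambda>F. fps_nth F m"] show ?thesis
    by (simp add: D_def Z_nth c_def)
qed

text \<open>Multiplication by \<open>x\<^sup>(\<^sup>l\<^sup>)\<^sub>s\<close> moves the last nonzero coefficient by at most \<open>s\<close>. So the sum over \<open>m\<close> in the
  definition of the vertex operators has finite support.\<close>

lemma exp_minus_finite:
  assumes "f \<in> polys n"
  shows "\<exists>M. \<forall>m>M. fps_nth (exp_minus n S \<alpha> f) m = 0"
  using assms
proof (induction rule: polys_induct)
  case one
  then show ?case by (auto simp: exp_minus_one fps_one_def)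
next
  case (x_var j r f)
  then obtain M where "\<forall>m>M. fps_nth (exp_minus n S \<alpha> f) m = 0" by blast
  then have "\<forall>m>M + r. fps_nth (exp_minus n S \<alpha> (x_var j r * f)) m = 0"
    using x_var by (simp add: exp_minus_x_var)
  then show ?case by blast
next
  case (add f g)
  then obtain M M' where "\<forall>m>M. fps_nth (exp_minus n S \<alpha> f) m = 0" "\<forall>m>M'. fps_nth (exp_minus n S \<alpha> g) m = 0" by blast
  then have "\<forall>m>max M M'. fps_nth (exp_minus n S \<alpha> (f + g)) m = 0"
    by (simp add: exp_minus_add)
  then show ?case by blast
next
  case (pscale c f)
  then show ?case by (auto simp: exp_minus_pscale)
qed

lemma polys_exp_minus:
  assumes "f \<in> polys n"
  shows "fps_nth (exp_minus n S \<alpha> f) m \<in> polys n"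
  using assms
proof (induction arbitrary: m rule: polys_induct)
  case one
  then show ?case by (simp add: exp_minus_one fps_one_def)
qed (auto simp: exp_minus_x_var exp_minus_add exp_minus_pscale intro!: polys_mult polys_diff polys_x_var)

subsection \<open>The coefficients of the vertex operators\<close>

text \<open>Extending the coefficients of the creation part by \<open>0\<close> to negative exponents makes the relation with the
  derivations uniform, and turns the sum for the vertex operator into a convolution.\<close>

definition plus_coeff :: "nat \<Rightarrow> (nat \<Rightarrow> cartan) \<Rightarrow> lattice \<Rightarrow> int \<Rightarrow> poly_x" where
  "plus_coeff n S \<alpha> p = (if 0 \<le> p then fps_nth (exp_plus n S \<alpha>) (nat p) else 0)"

lemma x_deriv_plus_coeff:
  "j \<in> {1..n} \<Longrightarrow> odd r \<Longrightarrow>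
    x_deriv j r (plus_coeff n S \<alpha> p) = pscale (lam n S \<alpha> j) (plus_coeff n S \<alpha> (p - int r))"
  by (auto simp: plus_coeff_def x_deriv_exp_plus nat_diff_distrib)

lemma vertex_coeff_eq:
  assumes "\<forall>m>M. fps_nth (exp_minus n S \<alpha> f) m = 0"
  shows "vertex_coeff n S \<alpha> p f =
    (\<Sum>m\<le>M. plus_coeff n S \<alpha> (p + int m) * fps_nth (exp_minus n S \<alpha> f) m)"
proof -
  have "vertex_coeff n S \<alpha> p f = (\<Sum>m. plus_coeff n S \<alpha> (p + int m) * fps_nth (exp_minus n S \<alpha> f) m)"
    unfolding vertex_coeff_def by (rule Sum_any.cong) (simp add: plus_coeff_def)
  also have "\<dots> = (\<Sum>m\<le>M. plus_coeff n S \<alpha> (p + int m) * fps_nth (exp_minus n S \<alpha> f) m)"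
    using assms by (intro Sum_any.expand_superset) (auto intro: leI)
  finally show ?thesis .
qed

lemma vertex_coeff_add:
  assumes "f \<in> polys n" "g \<in> polys n"
  shows "vertex_coeff n S \<alpha> p (f + g) = vertex_coeff n S \<alpha> p f + vertex_coeff n S \<alpha> p g"
proof -
  obtain M M' where "\<forall>m>M. fps_nth (exp_minus n S \<alpha> f) m = 0" "\<forall>m>M'. fps_nth (exp_minus n S \<alpha> g) m = 0"
    using exp_minus_finite assms by metis
  then have *: "\<forall>m>max M M'. fps_nth (exp_minus n S \<alpha> f) m = 0" "\<forall>m>max M M'. fps_nth (exp_minus n S \<alpha> g) m = 0"
    "\<forall>m>max M M'. fps_nth (exp_minus n S \<alpha> (f + g)) m = 0"
    by (simp_all add: exp_minus_add)
  show ?thesis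
    unfolding vertex_coeff_eq[OF *(1)] vertex_coeff_eq[OF *(2)] vertex_coeff_eq[OF *(3)]
    by (simp add: exp_minus_add distrib_left sum.distrib)
qed

lemma vertex_coeff_pscale:
  assumes "f \<in> polys n"
  shows "vertex_coeff n S \<alpha> p (pscale c f) = pscale c (vertex_coeff n S \<alpha> p f)"
proof -
  obtain M where *: "\<forall>m>M. fps_nth (exp_minus n S \<alpha> f) m = 0"
    using exp_minus_finite assms by metis
  then have **: "\<forall>m>M. fps_nth (exp_minus n S \<alpha> (pscale c f)) m = 0"
    by (simp add: exp_minus_pscale)
  show ?thesis
    unfolding vertex_coeff_eq[OF *] vertex_coeff_eq[OF **]
    by (simp add: exp_minus_pscale pscale_mult_right PS.scale_sum_right)
qed

lemma vertex_coeff_zero [simp]: "vertex_coeff n S \<alpha> p 0 = 0"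
  using vertex_coeff_pscale[of 1 n S \<alpha> p 0] by simp

lemma vertex_coeff_sum:
  assumes "\<And>a. a \<in> A \<Longrightarrow> f a \<in> polys n"
  shows "vertex_coeff n S \<alpha> p (sum f A) = (\<Sum>a\<in>A. vertex_coeff n S \<alpha> p (f a))"
  using assms
  by (induction A rule: infinite_finite_induct) (auto simp: vertex_coeff_add polys_sum)

lemma vertex_coeff_one: "vertex_coeff n S \<alpha> p 1 = plus_coeff n S \<alpha> p"
proof -
  have "\<forall>m>0. fps_nth (exp_minus n S \<alpha> 1) m = 0" by (simp add: exp_minus_one fps_one_def)
  from vertex_coeff_eq[OF this] show ?thesis by (simp add: exp_minus_one)
qed

lemma vertex_coeff_one_neg: "p < 0 \<Longrightarrow> vertex_coeff n S \<alpha> p 1 = 0"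
  by (simp add: vertex_coeff_one plus_coeff_def)

lemma vertex_coeff_one_0: "vertex_coeff n S \<alpha> 0 1 = 1"
  by (simp add: vertex_coeff_one plus_coeff_def exp_plus_0)

lemma lookup_vertex_coeff_one_0: "lookup (vertex_coeff n S \<alpha> p 1) 0 = (if p = 0 then 1 else 0)"
  by (auto simp: vertex_coeff_one plus_coeff_def lookup_exp_plus_0)

lemma polys_vertex_coeff [intro]:
  assumes "f \<in> polys n"
  shows "vertex_coeff n S \<alpha> p f \<in> polys n"
proof -
  obtain M where *: "\<forall>m>M. fps_nth (exp_minus n S \<alpha> f) m = 0"
    using exp_minus_finite assms by metis
  show ?thesis
    unfolding vertex_coeff_eq[OF *]
    using assms by (auto simp: plus_coeff_def intro!: polys_sum polys_mult polys_exp_plus polys_exp_minus)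
qed

lemma x_deriv_vertex_coeff:
  assumes "j \<in> {1..n}" "odd r" "f \<in> polys n"
  shows "x_deriv j r (vertex_coeff n S \<alpha> p f) =
    vertex_coeff n S \<alpha> p (x_deriv j r f) + pscale (lam n S \<alpha> j) (vertex_coeff n S \<alpha> (p - int r) f)"
proof -
  obtain M where *: "\<forall>m>M. fps_nth (exp_minus n S \<alpha> f) m = 0"
    using exp_minus_finite assms by metis
  then have **: "\<forall>m>M. fps_nth (exp_minus n S \<alpha> (x_deriv j r f)) m = 0"
    by (simp add: exp_minus_x_deriv)
  show ?thesis
    unfolding vertex_coeff_eq[OF *] vertex_coeff_eq[OF **]
    using assms
    by (simp add: x_deriv_sum x_deriv_mult x_deriv_plus_coeff exp_minus_x_deriv sum.distrib
        PS.scale_sum_right pscale_mult_left diff_add_eq)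
qed

lemma x_var_vertex_coeff:
  assumes "j \<in> {1..n}" "odd r" "f \<in> polys n"
  shows "x_var j r * vertex_coeff n S \<alpha> p f =
    vertex_coeff n S \<alpha> p (x_var j r * f) + pscale (lam n S \<alpha> j / of_nat r) (vertex_coeff n S \<alpha> (p + int r) f)"
proof -
  define c where "c = lam n S \<alpha> j / of_nat r"
  obtain M where *: "\<forall>m>M. fps_nth (exp_minus n S \<alpha> f) m = 0"
    using exp_minus_finite assms by metis
  then have **: "\<forall>m>M+r. fps_nth (exp_minus n S \<alpha> (x_var j r * f)) m = 0"
    and shift: "\<forall>m>M+r. fps_nth (exp_minus n S \<alpha> f) m = 0"
    using assms by (simp_all add: exp_minus_x_var)
  have "(\<Sum>m\<le>M + r. plus_coeff n S \<alpha> (p + int m) *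
      (if m < r then 0 else pscale c (fps_nth (exp_minus n S \<alpha> f) (m - r)))) =
      (\<Sum>m\<in>{0+r..M+r}. plus_coeff n S \<alpha> (p + int m) *
      (if m < r then 0 else pscale c (fps_nth (exp_minus n S \<alpha> f) (m - r))))"
    by (rule sum.mono_neutral_right) auto
  also have "\<dots> = (\<Sum>m\<in>{0..M}. pscale c (plus_coeff n S \<alpha> (p + int r + int m) * fps_nth (exp_minus n S \<alpha> f) m))"
    unfolding sum.shift_bounds_cl_nat_ivl
    by (intro sum.cong refl) (simp add: pscale_mult_right add_ac)
  also have "\<dots> = pscale c (vertex_coeff n S \<alpha> (p + int r) f)"
    by (simp add: vertex_coeff_eq[OF *] PS.scale_sum_right atLeast0AtMost)
  finally show ?thesis
    unfolding vertex_coeff_eq[OF **] vertex_coeff_eq[OF shift, of p] c_def[symmetric]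
    using assms
    by (simp add: exp_minus_x_var[of j n r S \<alpha> f, folded c_def] right_diff_distrib sum_subtractf sum_distrib_left
        mult.left_commute[of "x_var j r"])
qed

text \<open>A derivation fails to commute with the creation part only, and a multiplication with the annihilation part
  only. In terms of the Heisenberg operators the two commutators have the same form
  \<open>[a\<^sub>i, \<Gamma>\<^sub>\<alpha>(z)] = \<lambda> z\<^sup>i \<Gamma>\<^sub>\<alpha>(z)\<close>.\<close>

lemma a_coeff_vertex_coeff:
  assumes "j \<in> {1..n}" "odd i" "f \<in> polys n"
  shows "a_coeff j i (vertex_coeff n S \<alpha> p f) =
    vertex_coeff n S \<alpha> p (a_coeff j i f) + pscale (lam n S \<alpha> j) (vertex_coeff n S \<alpha> (p - i) f)"
proof (cases "i > 0")
  case True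
  then have "odd (nat i)" using assms by (simp add: even_nat_iff)
  with True show ?thesis using assms by (simp add: a_coeff_def x_deriv_vertex_coeff)
next
  case False
  define r where "r = nat (- i)"
  have r: "odd r" "i = - int r" using False assms by (auto simp: r_def even_nat_iff)
  have r0: "r \<noteq> 0" using odd_pos[OF r(1)] by simp
  have "a_coeff j i g = pscale (of_nat r) (x_var j r * g)" for g
    using r by (simp add: a_coeff_def)
  then show ?thesis using r0 assms r
    by (simp add: x_var_vertex_coeff vertex_coeff_pscale polys_mult polys_x_var PS.scale_right_distrib)
qed

subsection \<open>Uniqueness\<close>

text \<open>A family of operators that obeys the commutation relations of a product of two vertex operators
  with the Heisenberg algebra, and kills the vacuum in negative weight, is determined by its vacuum expectation values. The annihilation
  operators reduce the action on the vacuum to constants, and the creation operators reduce the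
  action on arbitrary polynomials to the action on the vacuum.\<close>

lemma heisenberg_uniqueness:
  fixes B :: "int \<Rightarrow> int \<Rightarrow> poly_x \<Rightarrow> poly_x"
  assumes poly: "\<And>p q f. f \<in> polys n \<Longrightarrow> B p q f \<in> polys n"
    and add: "\<And>p q f g. f \<in> polys n \<Longrightarrow> g \<in> polys n \<Longrightarrow> B p q (f + g) = B p q f + B p q g"
    and scale: "\<And>p q c f. f \<in> polys n \<Longrightarrow> B p q (pscale c f) = pscale c (B p q f)"
    and rel: "\<And>p q j i f. j \<in> {1..n} \<Longrightarrow> odd i \<Longrightarrow> f \<in> polys n \<Longrightarrow> a_coeff j i (B p q f) =
      B p q (a_coeff j i f) + pscale (l j) (B (p - i) q f) + pscale (m j) (B p (q - i) f)"
    and neg: "\<And>p q. p + q < 0 \<Longrightarrow> B p q 1 = 0"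
    and vac: "\<And>p q. lookup (B p q 1) 0 = 0"
    and f: "f \<in> polys n"
  shows "B p q f = 0"
proof -
  have B0: "B p q 0 = 0" for p q using scale[of 1 p q 0] by simp
  (* An annihilation operator lowers the weight p + q, so by induction it kills B p q 1. *)
  have one: "B p q 1 = 0" for p q
  proof (induction "nat (p + q + 1)" arbitrary: p q rule: less_induct)
    case less
    show ?case
    proof (cases "p + q < 0")
      case False
      have "x_deriv j r (B p q 1) = 0" if "j \<in> {1..n}" "odd r" for j r
      proof -
        have "r > 0" using that by (cases r) auto
        then have "a_coeff j (int r) g = x_deriv j r g" for g
          using that by (simp add: a_coeff_def)
        moreover have "B (p - int r) q 1 = 0" "B p (q - int r) 1 = 0"
          using less[of "p - int r" q] less[of p "q - int r"] False \<open>r > 0\<close> by auto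
        ultimately show ?thesis using rel[of j "int r" 1 p q] that by (simp add: B0)
      qed
      then show ?thesis using polys_constant[OF poly, of 1 p q] vac[of p q] by simp
    qed (rule neg)
  qed
  show ?thesis using f
  proof (induction arbitrary: p q rule: polys_induct)
    case (x_var j r f)
    have r: "r > 0" using x_var by (cases r) auto
    have a: "a_coeff j (- int r) f = pscale (of_nat r) (x_var j r * f)"
      using x_var r by (simp add: a_coeff_def)
    have "pscale (of_nat r) (B p q (x_var j r * f)) = 0"
      using rel[of j "- int r" f p q] x_var by (simp add: a scale polys_mult polys_x_var)
    then show ?case using r by simp
  qed (simp_all add: one add scale)
qed

text \<open>Both sides satisfy the commutation relations of a single vertex operator with the Heisenberg algebra.
  Uniqueness applies with a family that depends on \<open>p + q\<close> only.\<close>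

lemma euler_vertex_coeff:
  assumes f: "f \<in> polys n"
  shows "euler n (vertex_coeff n S \<alpha> p f) =
    vertex_coeff n S \<alpha> p (euler n f) + pscale (of_int p) (vertex_coeff n S \<alpha> p f)"
proof -
  define B where "B p q f = euler n (vertex_coeff n S \<alpha> (p + q) f) - vertex_coeff n S \<alpha> (p + q) (euler n f)
    - pscale (of_int (p + q)) (vertex_coeff n S \<alpha> (p + q) f)" for p q f
  have "B p 0 f = 0"
  proof (rule heisenberg_uniqueness[of n B "lam n S \<alpha>" "\<lambda>_. 0", OF _ _ _ _ _ _ f])
    fix p q i :: int and j and f :: poly_x assume *: "j \<in> {1..n}" "odd i" "f \<in> polys n"
    have e: "a_coeff j i (euler n g) = euler n (a_coeff j i g) + pscale (of_int i) (a_coeff j i g)"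
      if "g \<in> polys n" for g
      using euler_a_coeff[OF *(1,2) that] by simp
    show "a_coeff j i (B p q f) = B p q (a_coeff j i f) + pscale (lam n S \<alpha> j) (B (p - i) q f) + pscale 0 (B p (q - i) f)"
      unfolding B_def a_coeff_diff
      using * by (simp add: e a_coeff_vertex_coeff polys_vertex_coeff polys_euler polys_a_coeff a_coeff_pscale a_coeff_add
          euler_add euler_pscale vertex_coeff_add vertex_coeff_pscale polys_pscale PS.scale_right_distrib
          PS.scale_right_diff_distrib PS.scale_left_diff_distrib PS.scale_left_distrib
          add_diff_eq diff_add_eq mult.commute diff_diff_eq)
  qed (auto simp: B_def euler_add euler_pscale polys_vertex_coeff polys_euler vertex_coeff_add vertex_coeff_pscale
      PS.scale_right_distrib PS.scale_right_diff_distrib vertex_coeff_one_neg lookup_minus lookup_euler_0 lookup_pscale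
      lookup_vertex_coeff_one_0 mult.commute simp del: of_int_add)
  then show ?thesis by (simp add: B_def algebra_simps)
qed

subsection \<open>Two-point functions\<close>

definition two_point :: "nat \<Rightarrow> (nat \<Rightarrow> cartan) \<Rightarrow> lattice \<Rightarrow> lattice \<Rightarrow> nat \<Rightarrow> complex" where
  "two_point n S \<alpha> \<beta> i =
     lookup (vertex_coeff n S \<alpha> (- int i) (vertex_coeff n S \<beta> (int i) 1)) 0"

definition lam_prod :: "nat \<Rightarrow> (nat \<Rightarrow> cartan) \<Rightarrow> lattice \<Rightarrow> lattice \<Rightarrow> complex" where
  "lam_prod n S \<alpha> \<beta> = (\<Sum>j=1..n. lam n S \<alpha> j * lam n S \<beta> j)"

lemma lam_prod_sym: "lam_prod n S \<alpha> \<beta> = lam_prod n S \<beta> \<alpha>"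
  by (simp add: lam_prod_def mult.commute)

lemma lam_prod_eq:
  assumes "orthonormal_basis n S" "keys \<alpha> \<subseteq> {1..n}"
  shows "lam_prod n S \<alpha> \<beta> = 2 * of_int (bform n \<alpha> \<beta>)"
proof -
  have "keys (H_of \<alpha>) \<subseteq> {1..n}" using assms(2) by (auto simp: in_keys_iff subset_iff)
  note p = orthonormal_basis_parseval[OF assms(1) this, of "H_of \<beta>"]
  have "complex_of_real (sqrt 2) * complex_of_real (sqrt 2) = 2"
    by (simp flip: of_real_mult)
  then have "lam_prod n S \<alpha> \<beta> = 2 * (\<Sum>j=1..n. bform n (H_of \<alpha>) (S j) * bform n (H_of \<beta>) (S j))"
    unfolding lam_prod_def lam_def sum_distrib_left
    by (intro sum.cong refl) (metis (no_types, lifting) mult.assoc mult.left_commute)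
  then show ?thesis by (simp add: p bform_H_of)
qed

text \<open>By the Euler identity, \<open>i V\<^sub>\<beta>(i) 1\<close> is a sum of terms \<open>\<lambda>\<^sub>j a\<^sub>-\<^sub>r V\<^sub>\<beta>(i - r) 1\<close>. Moving the creation operator
  \<open>a\<^sub>-\<^sub>r\<close> to the left through \<open>V\<^sub>\<alpha>(-i)\<close> produces the two-point function at \<open>i - r\<close>; the remaining term has no
  constant part.\<close>

lemma two_point_recurrence:
  "of_nat i * two_point n S \<alpha> \<beta> i =
    - lam_prod n S \<alpha> \<beta> * (\<Sum>r\<in>{r. odd r \<and> r \<le> i}. two_point n S \<alpha> \<beta> (i - r))"
proof -
  define V where "V p = vertex_coeff n S \<beta> p 1" for p
  have V: "V p \<in> polys n" for p unfolding V_def by (intro polys_vertex_coeff) simp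
  have aV: "a_coeff j k (V p) = pscale (lam n S \<beta> j) (V (p - k))" if "j \<in> {1..n}" "odd k" "k > 0" for j k p
    using a_coeff_vertex_coeff[of j n k 1 S \<beta> p] that by (simp add: V_def a_coeff_def)
  (* The vacuum expectation value of the operator V_alpha(-i) applied to g. *)
  define L where "L g = lookup (vertex_coeff n S \<alpha> (- int i) g) 0" for g
  have L_sum: "L (\<Sum>a\<in>A. g a) = (\<Sum>a\<in>A. L (g a))" if "\<And>a. a \<in> A \<Longrightarrow> g a \<in> polys n"
    for A and g :: "nat \<Rightarrow> poly_x"
    using that by (simp add: L_def vertex_coeff_sum lookup_sum)
  have L_pscale: "L (pscale c g) = c * L g" if "g \<in> polys n" for c g
    using that by (simp add: L_def vertex_coeff_pscale lookup_pscale)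
  have L_a: "L (a_coeff j (- int r) g) = - lam n S \<alpha> j * lookup (vertex_coeff n S \<alpha> (- int (i - r)) g) 0"
    if "j \<in> {1..n}" "odd r" "r \<le> i" "g \<in> polys n" for j r g
  proof -
    have "r > 0" using that odd_pos by blast
    moreover have "- int i - - int r = - int (i - r)" using that by simp
    ultimately show ?thesis
      using a_coeff_vertex_coeff[of j n "- int r" g S \<alpha> "- int i"] that
        lookup_a_coeff_0[of "- int r" j "vertex_coeff n S \<alpha> (- int i) g"]
      by (simp add: L_def lookup_add lookup_pscale add_eq_0_iff)
  qed
  have "pscale (of_nat i) (V (int i)) = euler n (V (int i))"
    by (simp add: V_def euler_vertex_coeff)
  also have "\<dots> = (\<Sum>j=1..n. \<Sum>r\<in>{r. odd r \<and> r \<le> i}. a_coeff j (- int r) (a_coeff j (int r) (V (int i))))"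
  proof (rule euler_conv_a_coeff[OF V])
    fix j r assume "j \<in> {1..n}" "odd r" "i < r"
    then show "x_deriv j r (V (int i)) = 0"
      using aV[of j "int r" "int i"] by (simp add: a_coeff_def V_def vertex_coeff_one_neg)
  qed
  also have "\<dots> = (\<Sum>j=1..n. \<Sum>r\<in>{r. odd r \<and> r \<le> i}.
      pscale (lam n S \<beta> j) (a_coeff j (- int r) (V (int (i - r)))))"
    by (intro sum.cong refl) (auto simp: aV a_coeff_pscale of_nat_diff odd_pos)
  finally have "of_nat i * L (V (int i)) = L (\<Sum>j=1..n. \<Sum>r\<in>{r. odd r \<and> r \<le> i}.
      pscale (lam n S \<beta> j) (a_coeff j (- int r) (V (int (i - r)))))"
    using L_pscale[OF V] by metis
  also have "\<dots> = (\<Sum>j=1..n. L (\<Sum>r\<in>{r. odd r \<and> r \<le> i}.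
      pscale (lam n S \<beta> j) (a_coeff j (- int r) (V (int (i - r))))))"
    by (rule L_sum) (auto intro!: polys_sum polys_pscale polys_a_coeff V)
  also have "\<dots> = (\<Sum>j=1..n. \<Sum>r\<in>{r. odd r \<and> r \<le> i}.
      L (pscale (lam n S \<beta> j) (a_coeff j (- int r) (V (int (i - r))))))"
    by (intro sum.cong refl L_sum) (auto intro!: polys_pscale polys_a_coeff V)
  also have "\<dots> = (\<Sum>j=1..n. \<Sum>r\<in>{r. odd r \<and> r \<le> i}.
      - (lam n S \<alpha> j * lam n S \<beta> j) * two_point n S \<alpha> \<beta> (i - r))"
    by (intro sum.cong refl)
      (auto simp: L_pscale L_a V polys_a_coeff two_point_def V_def[symmetric])
  also have "\<dots> = - lam_prod n S \<alpha> \<beta> * (\<Sum>r\<in>{r. odd r \<and> r \<le> i}. two_point n S \<alpha> \<beta> (i - r))"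
    unfolding lam_prod_def sum_negf[symmetric] sum_product by simp
  finally show ?thesis by (simp add: L_def V_def two_point_def)
qed

lemma two_point_0: "two_point n S \<alpha> \<beta> 0 = 1"
  by (simp add: two_point_def vertex_coeff_one_0 lookup_vertex_coeff_one_0)

lemma two_point_1: "two_point n S \<alpha> \<beta> 1 = - lam_prod n S \<alpha> \<beta>"
proof -
  have "{r :: nat. odd r \<and> r \<le> 1} = {1}" by (auto simp: le_Suc_eq One_nat_def)
  then show ?thesis using two_point_recurrence[of 1 n S \<alpha> \<beta>] by (simp add: two_point_0)
qed

text \<open>The sums in the recurrences for \<open>i + 2\<close> and \<open>i\<close> differ by the term for \<open>r = 1\<close> only.\<close>

lemma two_point_step:
  "of_nat (i + 2) * two_point n S \<alpha> \<beta> (i + 2) =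
    of_nat i * two_point n S \<alpha> \<beta> i - lam_prod n S \<alpha> \<beta> * two_point n S \<alpha> \<beta> (i + 1)"
proof -
  have "{r. odd r \<and> r \<le> i + 2} = insert 1 ((+) 2 ` {r. odd r \<and> r \<le> i})" (is "?A = ?B")
  proof
    show "?A \<subseteq> ?B"
    proof
      fix r assume r: "r \<in> ?A"
      show "r \<in> ?B"
      proof (cases "r = 1")
        case False
        then have "r \<ge> 2" using r by (cases r) (auto simp: Suc_le_eq One_nat_def)
        then have "r = 2 + (r - 2)" "odd (r - 2)" "r - 2 \<le> i" using r by auto
        then show ?thesis by blast
      qed simp
    qed
  qed auto
  moreover have "1 \<notin> (+) 2 ` {r. odd r \<and> r \<le> i}" by auto
  ultimately have *: "(\<Sum>r\<in>{r. odd r \<and> r \<le> i + 2}. two_point n S \<alpha> \<beta> (i + 2 - r)) =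
      two_point n S \<alpha> \<beta> (i + 1) + (\<Sum>r\<in>{r. odd r \<and> r \<le> i}. two_point n S \<alpha> \<beta> (i - r))"
    by (simp add: sum.reindex Suc_eq_plus1 add.commute del: add_2_eq_Suc add_2_eq_Suc')
  show ?thesis
    unfolding two_point_recurrence[of "i + 2" n S \<alpha> \<beta>] two_point_recurrence[of i n S \<alpha> \<beta>] *
    by (simp only: distrib_left minus_mult_left[symmetric]) simp
qed

text \<open>The recurrence says that the two-point function is the expansion of \<open>((1 - u) / (1 + u))\<^bsup>K/2\<^esup>\<close>, where
  \<open>K = 2 (\<alpha>|\<beta>)\<close>. For \<open>K = 0, -2, -4\<close> this is \<open>1\<close>, \<open>1 + 2 \<Sum>\<^sub>i u\<^sup>i\<close> and \<open>1 + 4 \<Sum>\<^sub>i i u\<^sup>i\<close>.\<close>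

lemma two_point_values:
  shows "lam_prod n S \<alpha> \<beta> = 0 \<Longrightarrow> two_point n S \<alpha> \<beta> i = (if i = 0 then 1 else 0)"
    and "lam_prod n S \<alpha> \<beta> = - 2 \<Longrightarrow> two_point n S \<alpha> \<beta> i = (if i = 0 then 1 else 2)"
    and "lam_prod n S \<alpha> \<beta> = - 4 \<Longrightarrow> two_point n S \<alpha> \<beta> i = (if i = 0 then 1 else 4 * of_nat i)"
proof -
  assume "lam_prod n S \<alpha> \<beta> = 0"
  then show "two_point n S \<alpha> \<beta> i = (if i = 0 then 1 else 0)"
    using two_point_recurrence[of i n S \<alpha> \<beta>] by (auto simp: two_point_0)
next
  assume K: "lam_prod n S \<alpha> \<beta> = - 2"
  show "two_point n S \<alpha> \<beta> i = (if i = 0 then 1 else 2)"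
  proof (induction i rule: induct_nat_012)
    case (ge2 i)
    then have "of_nat (i + 2) * two_point n S \<alpha> \<beta> (i + 2) = of_nat (i + 2) * 2"
      using two_point_step[of i n S \<alpha> \<beta>] K by (auto simp: One_nat_def)
    then show ?case unfolding mult_cancel_left of_nat_eq_0_iff by simp
  qed (use K two_point_1[of n S \<alpha> \<beta>] in \<open>simp_all add: two_point_0 One_nat_def\<close>)
next
  assume K: "lam_prod n S \<alpha> \<beta> = - 4"
  show "two_point n S \<alpha> \<beta> i = (if i = 0 then 1 else 4 * of_nat i)"
  proof (induction i rule: induct_nat_012)
    case (ge2 i)
    then have "of_nat (i + 2) * two_point n S \<alpha> \<beta> (i + 2) = of_nat (i + 2) * (4 * of_nat (i + 2))"
      using two_point_step[of i n S \<alpha> \<beta>] K by (auto simp: algebra_simps One_nat_def)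
    then show ?case unfolding mult_cancel_left of_nat_eq_0_iff by simp
  qed (use K two_point_1[of n S \<alpha> \<beta>] in \<open>simp_all add: two_point_0 One_nat_def\<close>)
qed

subsection \<open>Products of two vertex operators\<close>

lemma a_coeff_vertex_product:
  assumes "j \<in> {1..n}" "odd i" "f \<in> polys n"
  shows "a_coeff j i (vertex_coeff n S \<alpha> p (vertex_coeff n S \<beta> q f)) =
    vertex_coeff n S \<alpha> p (vertex_coeff n S \<beta> q (a_coeff j i f))
    + pscale (lam n S \<alpha> j) (vertex_coeff n S \<alpha> (p - i) (vertex_coeff n S \<beta> q f))
    + pscale (lam n S \<beta> j) (vertex_coeff n S \<alpha> p (vertex_coeff n S \<beta> (q - i) f))"
  using assms
  by (simp add: a_coeff_vertex_coeff polys_vertex_coeff polys_a_coeff polys_pscale vertex_coeff_add vertex_coeff_pscale)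

text \<open>The product \<open>V\<^sub>\<alpha>(p) V\<^sub>\<beta>(q)\<close> raises the weight by \<open>p + q\<close>. Hence it kills the vacuum if \<open>p + q < 0\<close>, and has no
  vacuum expectation value unless \<open>p + q = 0\<close>.\<close>

lemma euler_vertex_product_one:
  "euler n (vertex_coeff n S \<alpha> p (vertex_coeff n S \<beta> q 1)) =
    pscale (of_int (p + q)) (vertex_coeff n S \<alpha> p (vertex_coeff n S \<beta> q 1))"
  by (simp add: euler_vertex_coeff polys_vertex_coeff vertex_coeff_pscale PS.scale_left_distrib)

lemma vertex_product_one_neg:
  assumes "p + q < 0"
  shows "vertex_coeff n S \<alpha> p (vertex_coeff n S \<beta> q 1) = 0" (is "?f = 0")
proof (rule poly_mapping_eqI)
  fix m
  have "of_nat (weight m) * lookup ?f m = of_int (p + q) * lookup ?f m"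
    using arg_cong[OF euler_vertex_product_one, of "\<lambda>f. lookup f m" n S \<alpha> p \<beta> q]
    by (simp add: lookup_euler polys_vertex_coeff lookup_pscale)
  moreover have "of_nat (weight m) \<noteq> (of_int (p + q) :: complex)"
  proof
    assume "of_nat (weight m) = (of_int (p + q) :: complex)"
    then have "(of_int (int (weight m)) :: complex) = of_int (p + q)" by simp
    then show False using assms by (simp only: of_int_eq_iff)
  qed
  ultimately show "lookup ?f m = lookup 0 m" by simp
qed

lemma lookup_vertex_product_one_0:
  "lookup (vertex_coeff n S \<alpha> p (vertex_coeff n S \<beta> q 1)) 0 =
    (if p + q = 0 \<and> q \<ge> 0 then two_point n S \<alpha> \<beta> (nat q) else 0)"
proof (cases "p + q = 0")
  case True
  then have "p = - q" by simp
  then show ?thesis by (auto simp: two_point_def vertex_coeff_one_neg)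
next
  case False
  then have "(of_int (p + q) :: complex) \<noteq> 0" by (simp only: of_int_eq_0_iff not_False_eq_True)
  then show ?thesis
    using arg_cong[OF euler_vertex_product_one, of "\<lambda>f. lookup f 0" n S \<alpha> p \<beta> q] False
    by (simp add: lookup_euler_0 polys_vertex_coeff lookup_pscale)
qed

lemma lam_add: "lam n S (\<alpha> + \<beta>) j = lam n S \<alpha> j + lam n S \<beta> j"
  by (simp add: lam_def H_of_add bform_add_left distrib_left)

text \<open>In each of the following three relations, the difference of the two sides satisfies the commutation
  relations of a product of two vertex operators with the Heisenberg algebra. By uniqueness it suffices to
  compare vacuum expectation values, which are given by the two-point functions.\<close>

lemma vertex_commute:
  assumes K: "lam_prod n S \<alpha> \<beta> = 0" and f: "f \<in> polys n"
  shows "vertex_coeff n S \<alpha> p (vertex_coeff n S \<beta> q f) = vertex_coeff n S \<beta> q (vertex_coeff n S \<alpha> p f)"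
proof -
  define B where "B p q f = vertex_coeff n S \<alpha> p (vertex_coeff n S \<beta> q f) -
    vertex_coeff n S \<beta> q (vertex_coeff n S \<alpha> p f)" for p q f
  note K' = K[unfolded lam_prod_sym[of n S \<alpha>]]
  have "B p q f = 0"
  proof (rule heisenberg_uniqueness[of n B "lam n S \<alpha>" "lam n S \<beta>", OF _ _ _ _ _ _ f])
    show "lookup (B p q 1) 0 = 0" for p q
      using two_point_values(1)[OF K, of "nat q"] two_point_values(1)[OF K', of "nat p"]
      by (auto simp: B_def lookup_minus lookup_vertex_product_one_0)
  qed (simp_all add: B_def polys_diff polys_vertex_coeff vertex_coeff_add vertex_coeff_pscale PS.scale_right_diff_distrib
      a_coeff_diff a_coeff_vertex_product vertex_product_one_neg add.commute)
  then show ?thesis by (simp add: B_def)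
qed

lemma vertex_anticommute:
  assumes K: "lam_prod n S \<alpha> \<beta> = - 2" and f: "f \<in> polys n"
  shows "vertex_coeff n S \<alpha> p (vertex_coeff n S \<beta> q f) + vertex_coeff n S \<beta> q (vertex_coeff n S \<alpha> p f) =
    pscale 2 (vertex_coeff n S (\<alpha> + \<beta>) (p + q) f)"
proof -
  define B where "B p q f = vertex_coeff n S \<alpha> p (vertex_coeff n S \<beta> q f) +
    vertex_coeff n S \<beta> q (vertex_coeff n S \<alpha> p f) - pscale 2 (vertex_coeff n S (\<alpha> + \<beta>) (p + q) f)" for p q f
  note K' = K[unfolded lam_prod_sym[of n S \<alpha>]]
  have "B p q f = 0"
  proof (rule heisenberg_uniqueness[of n B "lam n S \<alpha>" "lam n S \<beta>", OF _ _ _ _ _ _ f])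
    show "lookup (B p q 1) 0 = 0" for p q
      using two_point_values(2)[OF K, of "nat q"] two_point_values(2)[OF K', of "nat p"]
      by (auto simp: B_def lookup_minus lookup_add lookup_pscale lookup_vertex_product_one_0 lookup_vertex_coeff_one_0)
    show "a_coeff j i (B p q f) = B p q (a_coeff j i f) + pscale (lam n S \<alpha> j) (B (p - i) q f) +
        pscale (lam n S \<beta> j) (B p (q - i) f)" if "j \<in> {1..n}" "odd i" "f \<in> polys n" for p q j i f
      using that unfolding B_def a_coeff_diff a_coeff_add
      by (simp add: a_coeff_vertex_product a_coeff_pscale a_coeff_vertex_coeff lam_add PS.scale_right_distrib
          PS.scale_left_distrib PS.scale_right_diff_distrib mult.commute[of _ "2::complex"] distrib_left
          add_diff_eq diff_add_eq algebra_simps)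
  qed (simp_all add: B_def polys_diff polys_add polys_pscale polys_vertex_coeff vertex_coeff_add vertex_coeff_pscale
      PS.scale_right_diff_distrib PS.scale_right_distrib vertex_product_one_neg add.commute vertex_coeff_one_neg mult.commute)
  then show ?thesis by (simp add: B_def)
qed

text \<open>The right-hand side is the coefficient of the derivative of the delta function together with the Heisenberg
  operators. Its commutator with \<open>a\<^sub>i\<close> is a scalar, which matches the difference \<open>4 q - 4 (q - i)\<close> of the delta terms.\<close>

lemma vertex_uminus_commutator:
  assumes K: "lam_prod n S \<alpha> (- \<alpha>) = - 4" and f: "f \<in> polys n"
  shows "vertex_coeff n S \<alpha> p (vertex_coeff n S (- \<alpha>) q f) - vertex_coeff n S (- \<alpha>) q (vertex_coeff n S \<alpha> p f) =
    pscale (if p + q = 0 then 4 * of_int q else 0) f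
    + pscale 4 (\<Sum>j=1..n. pscale (lam n S \<alpha> j) (a_coeff j (- (p + q)) f))"
proof -
  define R where "R p q f = pscale (if p + q = 0 then 4 * of_int q else 0) f
    + pscale 4 (\<Sum>j=1..n. pscale (lam n S \<alpha> j) (a_coeff j (- (p + q)) f))" for p q :: int and f
  define B where "B p q f = vertex_coeff n S \<alpha> p (vertex_coeff n S (- \<alpha>) q f) -
    vertex_coeff n S (- \<alpha>) q (vertex_coeff n S \<alpha> p f) - R p q f" for p q f
  note K' = K[unfolded lam_prod_sym[of n S \<alpha>]]
  have a1: "a_coeff j i 1 = 0" if "i \<ge> 0" for j i
    using that by (auto simp: a_coeff_def not_less)
  have R: "a_coeff l i (R p q f) = R p q (a_coeff l i f) + pscale (lam n S \<alpha> l) (R (p - i) q f) -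
      pscale (lam n S \<alpha> l) (R p (q - i) f)" if l: "l \<in> {1..n}" and i: "odd i" for p q l i f
  proof -
    (* For even p + q the operator a_coeff j (-(p + q)) is 0, while p + q = i is odd. *)
    have c: "a_coeff l i (a_coeff j (- (p + q)) f) = a_coeff j (- (p + q)) (a_coeff l i f) +
        (if j = l then if p + q = i then pscale (of_int i) f else 0 else 0)" for j
    proof (cases "odd (p + q)")
      case True
      then show ?thesis using a_coeff_commutator[OF i, of "- (p + q)" l j] by auto
    next
      case False
      then have "p + q \<noteq> i" using i by auto
      with False show ?thesis by (simp add: a_coeff_def)
    qed
    have sh: "p - i + q = p + q - i" "p + (q - i) = p + q - i" by simp_all
    have "(\<Sum>j=1..n. pscale (lam n S \<alpha> j) (a_coeff l i (a_coeff j (- (p + q)) f))) =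
        (\<Sum>j=1..n. pscale (lam n S \<alpha> j) (a_coeff j (- (p + q)) (a_coeff l i f))) +
        (if p + q = i then pscale (lam n S \<alpha> l * of_int i) f else 0)"
      unfolding c PS.scale_right_distrib sum.distrib
      using l by (simp add: if_distrib[of "pscale _"] cong: if_cong)
    then show ?thesis
      unfolding R_def sh a_coeff_add a_coeff_pscale a_coeff_sum
      by (auto simp: PS.scale_right_distrib PS.scale_right_diff_distrib PS.scale_left_diff_distrib
          ring_distribs mult_ac)
  qed
  have "B p q f = 0"
  proof (rule heisenberg_uniqueness[of n B "lam n S \<alpha>" "lam n S (- \<alpha>)", OF _ _ _ _ _ _ f])
    show "lookup (B p q 1) 0 = 0" for p q
    proof -
      have "lookup (\<Sum>j=1..n. pscale (lam n S \<alpha> j) (a_coeff j (- (p + q)) 1)) 0 = 0"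
        using a1[of "- (p + q)"] lookup_a_coeff_0[of "- (p + q)"]
        by (cases "p + q > 0") (auto simp: lookup_sum lookup_pscale)
      then show ?thesis
        using two_point_values(3)[OF K, of "nat q"] two_point_values(3)[OF K', of "nat p"]
        by (auto simp: B_def R_def lookup_minus lookup_add lookup_pscale lookup_vertex_product_one_0 add_eq_0_iff)
    qed
    show "a_coeff j i (B p q f) = B p q (a_coeff j i f) + pscale (lam n S \<alpha> j) (B (p - i) q f) +
        pscale (lam n S (- \<alpha>) j) (B p (q - i) f)" if "j \<in> {1..n}" "odd i" "f \<in> polys n" for p q j i f
      using that unfolding B_def a_coeff_diff R[OF that(1,2)]
      by (simp add: a_coeff_vertex_product lam_uminus PS.scale_right_diff_distrib algebra_simps)
    show "B p q 1 = 0" if "p + q < 0" for p q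
      using that a1[of "- (p + q)"]
      by (simp add: B_def R_def vertex_product_one_neg add.commute)
    show "B p q f \<in> polys n" if "f \<in> polys n" for p q f
      unfolding B_def R_def using that by (auto intro!: polys_diff polys_add polys_sum polys_pscale polys_vertex_coeff polys_a_coeff)
  qed (simp_all add: B_def R_def polys_vertex_coeff vertex_coeff_add vertex_coeff_pscale a_coeff_add a_coeff_pscale
      PS.scale_right_diff_distrib PS.scale_right_distrib sum.distrib PS.scale_sum_right mult_ac)
  then show ?thesis by (simp add: B_def R_def)
qed

section \<open>The representation of the affine algebra\<close>

global_interpretation FS: vector_space fock_scale
  by (rule fock_scale_vector_space)

text \<open>The vectors whose components involve the variables \<open>x\<^sup>(\<^sup>j\<^sup>)\<^sub>r\<close> of \<open>V\<close> only.\<close>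

definition fock_space :: "nat \<Rightarrow> fock set" where
  "fock_space n = {w. \<forall>\<gamma>. lookup w \<gamma> \<in> polys n}"

lemma fock_spaceD: "w \<in> fock_space n \<Longrightarrow> lookup w \<gamma> \<in> polys n"
  by (simp add: fock_space_def)

lemma fock_space_zero [simp]: "0 \<in> fock_space n"
  by (simp add: fock_space_def)

lemma fock_space_add [intro]: "v \<in> fock_space n \<Longrightarrow> w \<in> fock_space n \<Longrightarrow> v + w \<in> fock_space n"
  by (simp add: fock_space_def lookup_add polys_add)

lemma fock_space_scale [intro]: "w \<in> fock_space n \<Longrightarrow> fock_scale c w \<in> fock_space n"
  by (simp add: fock_space_def lookup_fock_scale polys_pscale)

lemma fock_space_sum [intro]: "(\<And>a. a \<in> A \<Longrightarrow> f a \<in> fock_space n) \<Longrightarrow> sum f A \<in> fock_space n"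
  by (induction A rule: infinite_finite_induct) auto

lemma mod2_twice: "\<gamma> + \<gamma> = (0 :: lattice_mod2)"
proof -
  have "b + b = 0" for b :: bit by (cases b) simp_all
  then show ?thesis by (intro poly_mapping_eqI) (simp only: lookup_add lookup_zero)
qed

lemma mod2_cancel: "\<gamma> + (\<gamma> + \<delta>) = (\<delta> :: lattice_mod2)" "\<delta> + \<gamma> + \<gamma> = \<delta>"
  by (metis add.assoc add.left_neutral mod2_twice) (metis add.assoc add.right_neutral mod2_twice)

text \<open>The cocycle property that makes products of the operators \<open>e\<^sup>\<gamma> \<mapsto> \<nu>(\<alpha>, \<gamma>) e\<^sup>\<alpha>\<^sup>+\<^sup>\<gamma>\<close> projective.\<close>

lemma nu_lift2_add: "nu n \<alpha> (lift2 (mod2 \<beta> + \<gamma>)) = nu n \<alpha> \<beta> * nu n \<alpha> (lift2 \<gamma>)"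
  by (subst nu_cong_right[of _ "\<beta> + lift2 \<gamma>"]) (simp_all add: mod2_add nu_add_right)

subsection \<open>The operators pointwise\<close>

definition heis_poly :: "nat \<Rightarrow> (nat \<Rightarrow> cartan) \<Rightarrow> cartan \<Rightarrow> int \<Rightarrow> poly_x \<Rightarrow> poly_x" where
  "heis_poly n S h i f =
     pscale (1 / complex_of_real (sqrt 2)) (\<Sum>j=1..n. pscale (bform n h (S j)) (a_coeff j i f))"

lemma lookup_heisenberg: "lookup (heisenberg n S h i w) \<gamma> = heis_poly n S h i (lookup w \<gamma>)"
  by (auto simp: heisenberg_def Poly_Mapping.map.rep_eq heis_poly_def when_def)

lemma lookup_energy: "lookup (energy n w) \<gamma> = euler n (lookup w \<gamma>)"
  by (auto simp: energy_def Poly_Mapping.map.rep_eq euler_def when_def)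

lemma lookup_Gamma_coeff:
  "lookup (Gamma_coeff n S \<alpha> i w) \<delta> = pscale (1 / 2 * nu n \<alpha> (lift2 (mod2 \<alpha> + \<delta>)))
    (vertex_coeff n S \<alpha> (- i) (lookup w (mod2 \<alpha> + \<delta>)))"
proof -
  have "lookup (Gamma_coeff n S \<alpha> i w) \<delta> = (\<Sum>\<gamma>\<in>keys w. if \<gamma> = mod2 \<alpha> + \<delta>
      then pscale (1 / 2 * nu n \<alpha> (lift2 \<gamma>)) (vertex_coeff n S \<alpha> (- i) (lookup w \<gamma>)) else 0)"
    unfolding Gamma_coeff_def lookup_sum
    by (intro sum.cong refl) (auto simp: lookup_single when_def mod2_cancel)
  then show ?thesis by (simp add: in_keys_iff)
qed

lemma Gamma_coeff_add:
  "v \<in> fock_space n \<Longrightarrow> w \<in> fock_space n \<Longrightarrow>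
    Gamma_coeff n S \<alpha> i (v + w) = Gamma_coeff n S \<alpha> i v + Gamma_coeff n S \<alpha> i w"
  by (rule poly_mapping_eqI)
    (simp add: lookup_Gamma_coeff lookup_add vertex_coeff_add fock_spaceD PS.scale_right_distrib)

lemma Gamma_coeff_scale:
  "w \<in> fock_space n \<Longrightarrow> Gamma_coeff n S \<alpha> i (fock_scale c w) = fock_scale c (Gamma_coeff n S \<alpha> i w)"
  by (rule poly_mapping_eqI)
    (simp add: lookup_Gamma_coeff lookup_fock_scale vertex_coeff_pscale fock_spaceD mult_ac)

lemma fock_space_Gamma_coeff [intro]: "w \<in> fock_space n \<Longrightarrow> Gamma_coeff n S \<alpha> i w \<in> fock_space n"
  by (auto simp: fock_space_def lookup_Gamma_coeff)

lemma Gamma_coeff_zero [simp]: "Gamma_coeff n S \<alpha> i 0 = 0"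
  by (simp add: Gamma_coeff_def)

lemma Gamma_coeff_sum:
  "(\<And>a. a \<in> A \<Longrightarrow> f a \<in> fock_space n) \<Longrightarrow>
    Gamma_coeff n S \<alpha> i (sum f A) = (\<Sum>a\<in>A. Gamma_coeff n S \<alpha> i (f a))"
  by (induction A rule: infinite_finite_induct) (auto simp: Gamma_coeff_add fock_space_sum)

lemma heis_poly_add: "heis_poly n S h i (f + g) = heis_poly n S h i f + heis_poly n S h i g"
  by (simp add: heis_poly_def a_coeff_add PS.scale_right_distrib sum.distrib)

lemma heis_poly_pscale: "heis_poly n S h i (pscale c f) = pscale c (heis_poly n S h i f)"
  by (simp add: heis_poly_def a_coeff_pscale PS.scale_sum_right mult_ac)

lemma polys_heis_poly [intro]: "f \<in> polys n \<Longrightarrow> heis_poly n S h i f \<in> polys n"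
  by (auto simp: heis_poly_def intro!: polys_pscale polys_sum polys_a_coeff)

lemma heisenberg_add: "heisenberg n S h i (v + w) = heisenberg n S h i v + heisenberg n S h i w"
  by (rule poly_mapping_eqI) (simp add: lookup_heisenberg lookup_add heis_poly_add)

lemma heisenberg_scale: "heisenberg n S h i (fock_scale c w) = fock_scale c (heisenberg n S h i w)"
  by (rule poly_mapping_eqI) (simp add: lookup_heisenberg lookup_fock_scale heis_poly_pscale)

lemma heisenberg_zero [simp]: "heisenberg n S h i 0 = 0"
  by (rule poly_mapping_eqI) (simp add: lookup_heisenberg heis_poly_def)

lemma heisenberg_sum: "heisenberg n S h i (sum f A) = (\<Sum>a\<in>A. heisenberg n S h i (f a))"
  by (induction A rule: infinite_finite_induct) (auto simp: heisenberg_add)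

lemma fock_space_heisenberg [intro]: "w \<in> fock_space n \<Longrightarrow> heisenberg n S h i w \<in> fock_space n"
  by (auto simp: fock_space_def lookup_heisenberg)

lemma heisenberg_add_cartan: "heisenberg n S (h + h') i w = heisenberg n S h i w + heisenberg n S h' i w"
  by (rule poly_mapping_eqI)
    (simp add: lookup_heisenberg lookup_add heis_poly_def bform_add_left PS.scale_left_distrib
      PS.scale_right_distrib sum.distrib)

lemma heisenberg_pscale_cartan: "heisenberg n S (pscale c h) i w = fock_scale c (heisenberg n S h i w)"
  by (rule poly_mapping_eqI)
    (simp add: lookup_heisenberg lookup_fock_scale heis_poly_def bform_pscale_left PS.scale_sum_right mult_ac)

lemma heisenberg_zero_cartan [simp]: "heisenberg n S 0 i w = 0"
  by (rule poly_mapping_eqI) (simp add: lookup_heisenberg heis_poly_def)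

lemma heisenberg_even: "even i \<Longrightarrow> heisenberg n S h i w = 0"
  by (rule poly_mapping_eqI) (simp add: lookup_heisenberg heis_poly_def a_coeff_def)

lemma energy_add: "v \<in> fock_space n \<Longrightarrow> w \<in> fock_space n \<Longrightarrow> energy n (v + w) = energy n v + energy n w"
  by (rule poly_mapping_eqI) (simp add: lookup_energy lookup_add euler_add fock_spaceD)

lemma energy_scale: "w \<in> fock_space n \<Longrightarrow> energy n (fock_scale c w) = fock_scale c (energy n w)"
  by (rule poly_mapping_eqI) (simp add: lookup_energy lookup_fock_scale euler_pscale fock_spaceD)

lemma energy_zero [simp]: "energy n 0 = 0"
  by (rule poly_mapping_eqI) (simp add: lookup_energy)

lemma fock_space_energy [intro]: "w \<in> fock_space n \<Longrightarrow> energy n w \<in> fock_space n"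
  by (auto simp: fock_space_def lookup_energy)

lemma energy_sum:
  "(\<And>a. a \<in> A \<Longrightarrow> f a \<in> fock_space n) \<Longrightarrow> energy n (sum f A) = (\<Sum>a\<in>A. energy n (f a))"
  by (induction A rule: infinite_finite_induct) (auto simp: energy_add fock_space_sum)

subsection \<open>Commutators\<close>

text \<open>By Parseval's identity the sum over the orthonormal basis is \<open>(h|h')\<close>; the factor \<open>1/2\<close> is
  \<open>(1 / sqrt 2)\<^sup>2\<close>.\<close>

lemma heisenberg_commutator:
  assumes S: "orthonormal_basis n S" and h: "keys h \<subseteq> {1..n}" and i: "odd i"
  shows "heisenberg n S h i (heisenberg n S h' k w) - heisenberg n S h' k (heisenberg n S h i w) =
    fock_scale (if i + k = 0 then of_int i / 2 * bform n h h' else 0) w"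
proof (cases "odd k")
  case True
  define s where "s = 1 / complex_of_real (sqrt 2)"
  have s2: "s * s = 1 / 2" by (simp add: s_def flip: of_real_mult)
  have "heis_poly n S h i (heis_poly n S h' k f) = heis_poly n S h' k (heis_poly n S h i f) +
      pscale (if i + k = 0 then of_int i / 2 * bform n h h' else 0) f" for f
  proof -
    have "heis_poly n S h i (heis_poly n S h' k f) = pscale (s * s) (\<Sum>j=1..n. \<Sum>l=1..n.
        pscale (bform n h (S j) * bform n h' (S l)) (a_coeff j i (a_coeff l k f)))"
      by (simp add: heis_poly_def a_coeff_sum a_coeff_pscale PS.scale_sum_right s_def mult_ac)
    also have "\<dots> = pscale (s * s) (\<Sum>j=1..n. \<Sum>l=1..n.
        pscale (bform n h (S j) * bform n h' (S l)) (a_coeff l k (a_coeff j i f))) +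
        pscale (s * s) (\<Sum>j=1..n. \<Sum>l=1..n. if l = j then
        pscale (bform n h (S j) * bform n h' (S l)) (if i + k = 0 then pscale (of_int i) f else 0) else 0)"
      unfolding a_coeff_commutator[OF i True] PS.scale_right_distrib[symmetric] sum.distrib[symmetric]
      by (intro arg_cong[of _ _ "pscale _"] sum.cong refl)
        (auto simp: PS.scale_right_distrib)
    also have "pscale (s * s) (\<Sum>j=1..n. \<Sum>l=1..n.
        pscale (bform n h (S j) * bform n h' (S l)) (a_coeff l k (a_coeff j i f))) =
        heis_poly n S h' k (heis_poly n S h i f)"
      by (subst sum.swap) (simp add: heis_poly_def a_coeff_sum a_coeff_pscale PS.scale_sum_right s_def mult_ac)
    also have "pscale (s * s) (\<Sum>j=1..n. \<Sum>l=1..n. if l = j then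
        pscale (bform n h (S j) * bform n h' (S l)) (if i + k = 0 then pscale (of_int i) f else 0) else 0) =
        pscale (s * s * (\<Sum>j=1..n. bform n h (S j) * bform n h' (S j))) (if i + k = 0 then pscale (of_int i) f else 0)"
      by (simp add: PS.scale_sum_left sum_distrib_left PS.scale_sum_right)
    finally show ?thesis
      by (auto simp: orthonormal_basis_parseval[OF S h] s2 mult_ac)
  qed
  then show ?thesis
    by (intro poly_mapping_eqI) (simp add: lookup_minus lookup_heisenberg lookup_fock_scale)
next
  case False
  then have "i + k \<noteq> 0" using i by presburger
  with False show ?thesis by (simp add: heisenberg_even)
qed

lemma heisenberg_Gamma_commutator:
  assumes S: "orthonormal_basis n S" and h: "keys h \<subseteq> {1..n}" and i: "odd i" and w: "w \<in> fock_space n"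
  shows "heisenberg n S h i (Gamma_coeff n S \<beta> k w) - Gamma_coeff n S \<beta> k (heisenberg n S h i w) =
    fock_scale (bform n h (H_of \<beta>)) (Gamma_coeff n S \<beta> (i + k) w)"
proof -
  have "heis_poly n S h i (vertex_coeff n S \<beta> p f) = vertex_coeff n S \<beta> p (heis_poly n S h i f) +
      pscale (bform n h (H_of \<beta>)) (vertex_coeff n S \<beta> (p - i) f)" if f: "f \<in> polys n" for p f
  proof -
    define s where "s = 1 / complex_of_real (sqrt 2)"
    have "heis_poly n S h i (vertex_coeff n S \<beta> p f) =
        pscale s (\<Sum>j=1..n. pscale (bform n h (S j)) (vertex_coeff n S \<beta> p (a_coeff j i f))) +
        pscale s (\<Sum>j=1..n. pscale (bform n h (S j) * lam n S \<beta> j) (vertex_coeff n S \<beta> (p - i) f))"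
      by (simp add: heis_poly_def s_def a_coeff_vertex_coeff[OF _ i f] PS.scale_right_distrib sum.distrib)
    also have "pscale s (\<Sum>j=1..n. pscale (bform n h (S j) * lam n S \<beta> j) (vertex_coeff n S \<beta> (p - i) f)) =
        pscale (s * (\<Sum>j=1..n. bform n h (S j) * lam n S \<beta> j)) (vertex_coeff n S \<beta> (p - i) f)"
      by (simp add: PS.scale_sum_left sum_distrib_left PS.scale_sum_right)
    also have "s * (\<Sum>j=1..n. bform n h (S j) * lam n S \<beta> j) = (\<Sum>j=1..n. bform n h (S j) * bform n (H_of \<beta>) (S j))"
      by (simp add: lam_def s_def sum_distrib_left mult_ac)
    also have "pscale s (\<Sum>j=1..n. pscale (bform n h (S j)) (vertex_coeff n S \<beta> p (a_coeff j i f))) =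
        vertex_coeff n S \<beta> p (heis_poly n S h i f)"
    proof -
      have "vertex_coeff n S \<beta> p (heis_poly n S h i f) =
          pscale s (vertex_coeff n S \<beta> p (\<Sum>j=1..n. pscale (bform n h (S j)) (a_coeff j i f)))"
        unfolding heis_poly_def s_def[symmetric]
        by (rule vertex_coeff_pscale) (auto intro!: polys_sum polys_pscale polys_a_coeff f)
      also have "vertex_coeff n S \<beta> p (\<Sum>j=1..n. pscale (bform n h (S j)) (a_coeff j i f)) =
          (\<Sum>j=1..n. vertex_coeff n S \<beta> p (pscale (bform n h (S j)) (a_coeff j i f)))"
        by (rule vertex_coeff_sum) (auto intro!: polys_pscale polys_a_coeff f)
      also have "\<dots> = (\<Sum>j=1..n. pscale (bform n h (S j)) (vertex_coeff n S \<beta> p (a_coeff j i f)))"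
        by (intro sum.cong refl) (simp add: vertex_coeff_pscale f polys_a_coeff)
      finally show ?thesis by simp
    qed
    finally show ?thesis by (simp add: orthonormal_basis_parseval[OF S h])
  qed
  moreover have "- k - i = - i - k" by simp
  ultimately have "heis_poly n S h i (vertex_coeff n S \<beta> (- k) f) = vertex_coeff n S \<beta> (- k) (heis_poly n S h i f) +
      pscale (bform n h (H_of \<beta>)) (vertex_coeff n S \<beta> (- i - k) f)" if "f \<in> polys n" for f
    using that by metis
  then show ?thesis
    using w
    by (intro poly_mapping_eqI)
      (simp add: lookup_minus lookup_heisenberg lookup_fock_scale lookup_Gamma_coeff heis_poly_pscale fock_spaceD
        PS.scale_right_distrib mult_ac add.commute)
qed

lemma lookup_Gamma_product:
  assumes "w \<in> fock_space n"
  shows "lookup (Gamma_coeff n S \<alpha> i (Gamma_coeff n S \<beta> k w)) \<delta> =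
    pscale (nu n \<alpha> \<beta> * nu n (\<alpha> + \<beta>) (lift2 (mod2 (\<alpha> + \<beta>) + \<delta>)) / 4)
      (vertex_coeff n S \<alpha> (- i) (vertex_coeff n S \<beta> (- k) (lookup w (mod2 (\<alpha> + \<beta>) + \<delta>))))"
proof -
  define \<gamma> where "\<gamma> = mod2 (\<alpha> + \<beta>) + \<delta>"
  have a1: "mod2 \<beta> + (mod2 \<alpha> + \<delta>) = \<gamma>"
    by (simp add: \<gamma>_def mod2_add add_ac)
  then have a2: "mod2 \<alpha> + \<delta> = mod2 \<beta> + \<gamma>"
    using mod2_cancel(1) by metis
  show ?thesis
    unfolding lookup_Gamma_coeff a1 \<gamma>_def[symmetric]
    unfolding a2 nu_lift2_add
    using assms
    by (simp add: vertex_coeff_pscale polys_vertex_coeff fock_spaceD nu_add_left mult_ac)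
qed

text \<open>As \<open>\<nu>(\<beta>, \<alpha>) = (-1)\<^bsup>(\<alpha>|\<beta>)\<^esup> \<nu>(\<alpha>, \<beta>)\<close>, commutators of the operators \<open>\<Gamma>\<close> correspond to commutators of the
  coefficients \<open>V\<^sub>\<alpha>(p)\<close> if \<open>(\<alpha>|\<beta>)\<close> is even, and to anticommutators if it is odd.\<close>

lemma Gamma_commute:
  assumes n: "n \<in> {6, 7, 8}" and S: "orthonormal_basis n S" and k: "keys \<alpha> \<subseteq> {1..n}"
    and b: "bform n \<alpha> \<beta> = 0" and w: "w \<in> fock_space n"
  shows "Gamma_coeff n S \<alpha> i (Gamma_coeff n S \<beta> k w) = Gamma_coeff n S \<beta> k (Gamma_coeff n S \<alpha> i w)"
  using nu_commute[OF n, of \<beta> \<alpha>] b lam_prod_eq[OF S k, of \<beta>]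
    vertex_commute[of n S \<alpha> \<beta>] w
  by (intro poly_mapping_eqI) (simp add: lookup_Gamma_product add.commute[of \<beta>] fock_spaceD)

lemma Gamma_commutator_root:
  assumes n: "n \<in> {6, 7, 8}" and S: "orthonormal_basis n S" and k: "keys \<alpha> \<subseteq> {1..n}"
    and b: "bform n \<alpha> \<beta> = - 1" and w: "w \<in> fock_space n"
  shows "Gamma_coeff n S \<alpha> i (Gamma_coeff n S \<beta> k w) - Gamma_coeff n S \<beta> k (Gamma_coeff n S \<alpha> i w) =
    fock_scale (nu n \<alpha> \<beta>) (Gamma_coeff n S (\<alpha> + \<beta>) (i + k) w)" (is "?L = ?R")
proof (rule poly_mapping_eqI)
  fix \<delta>
  define \<gamma> where "\<gamma> = mod2 (\<alpha> + \<beta>) + \<delta>"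
  define c where "c = nu n \<alpha> \<beta> * nu n (\<alpha> + \<beta>) (lift2 \<gamma>) / 4"
  have K: "lam_prod n S \<alpha> \<beta> = - 2" using lam_prod_eq[OF S k] b by simp
  have nu: "nu n \<beta> \<alpha> = - nu n \<alpha> \<beta>" using nu_commute[OF n, of \<beta> \<alpha>] b by simp
  have "lookup ?L \<delta> =
      pscale c (vertex_coeff n S \<alpha> (- i) (vertex_coeff n S \<beta> (- k) (lookup w \<gamma>)) +
        vertex_coeff n S \<beta> (- k) (vertex_coeff n S \<alpha> (- i) (lookup w \<gamma>)))"
    by (simp add: lookup_minus lookup_Gamma_product[OF w] add.commute[of \<beta>] nu c_def \<gamma>_def PS.scale_right_distrib)
  also have "\<dots> = pscale (c * 2) (vertex_coeff n S (\<alpha> + \<beta>) (- (i + k)) (lookup w \<gamma>))"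
    using vertex_anticommute[OF K fock_spaceD[OF w], of "- i" "- k" \<gamma>] by simp
  also have "\<dots> = lookup ?R \<delta>"
    by (simp add: lookup_fock_scale lookup_Gamma_coeff c_def \<gamma>_def)
  finally show "lookup ?L \<delta> = lookup ?R \<delta>" .
qed

lemma Gamma_commutator_opposite:
  assumes n: "n \<in> {6, 7, 8}" and S: "orthonormal_basis n S" and r: "\<alpha> \<in> roots n" and w: "w \<in> fock_space n"
  shows "Gamma_coeff n S \<alpha> i (Gamma_coeff n S (- \<alpha>) k w) - Gamma_coeff n S (- \<alpha>) k (Gamma_coeff n S \<alpha> i w) =
    - fock_scale (if i + k = 0 then of_int i else 0) w - fock_scale 2 (heisenberg n S (H_of \<alpha>) (i + k) w)"
    (is "?L = ?R")
proof (rule poly_mapping_eqI)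
  fix \<delta>
  have K: "lam_prod n S \<alpha> (- \<alpha>) = - 4"
    using lam_prod_eq[OF S keys_roots[OF r], of "- \<alpha>"] roots_norm[OF r] by (simp add: bform_minus_right)
  have nu: "nu n \<alpha> (- \<alpha>) = - 1" "nu n (- \<alpha>) \<alpha> = - 1"
    using nu_root_self[OF n r] by (simp_all add: nu_uminus nu_uminus_right)
  have m0: "mod2 0 = 0" by (rule poly_mapping_eqI) simp
  have "lookup ?L \<delta> =
      pscale (- 1 / 4) (vertex_coeff n S \<alpha> (- i) (vertex_coeff n S (- \<alpha>) (- k) (lookup w \<delta>)) -
        vertex_coeff n S (- \<alpha>) (- k) (vertex_coeff n S \<alpha> (- i) (lookup w \<delta>)))"
    by (simp add: lookup_minus lookup_Gamma_product[OF w] nu m0 PS.scale_right_diff_distrib)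
  also have "\<dots> = pscale (if i + k = 0 then of_int k else 0) (lookup w \<delta>) -
      (\<Sum>j=1..n. pscale (lam n S \<alpha> j) (a_coeff j (i + k) (lookup w \<delta>)))"
  proof -
    have "- i + - k = 0 \<longleftrightarrow> i + k = 0" by auto
    moreover have "- (- i + - k) = i + k" by simp
    ultimately show ?thesis
      unfolding vertex_uminus_commutator[OF K fock_spaceD[OF w]]
      by (auto simp: PS.scale_right_distrib add.commute[of k i])
  qed
  also have "(if i + k = 0 then of_int k else 0) = - (if i + k = 0 then of_int i else 0 :: complex)"
    by (auto simp: add_eq_0_iff)
  also have "(\<Sum>j=1..n. pscale (lam n S \<alpha> j) (a_coeff j (i + k) (lookup w \<delta>))) =
      pscale 2 (heis_poly n S (H_of \<alpha>) (i + k) (lookup w \<delta>))"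
  proof -
    have "2 * (1 / complex_of_real (sqrt 2)) = complex_of_real (sqrt 2)"
      by (simp add: field_simps flip: of_real_mult)
    then show ?thesis
      unfolding heis_poly_def lam_def PS.scale_scale PS.scale_sum_right
      by (simp only: mult.assoc[symmetric])
  qed
  finally show "lookup ?L \<delta> = lookup ?R \<delta>"
    by (simp add: lookup_minus lookup_fock_scale lookup_heisenberg)
qed

subsection \<open>The loop algebra\<close>

lemma rep_loop_superset:
  assumes "finite A" "keys (snd X) \<subseteq> A"
  shows "rep_loop n S i X w = heisenberg n S (fst X) i w +
    (\<Sum>\<alpha>\<in>A. fock_scale (lookup (snd X) \<alpha> / 2) (Gamma_coeff n S \<alpha> i w))"
proof -
  have "(\<Sum>\<alpha>\<in>keys (snd X). fock_scale (lookup (snd X) \<alpha> / 2) (Gamma_coeff n S \<alpha> i w)) =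
      (\<Sum>\<alpha>\<in>A. fock_scale (lookup (snd X) \<alpha> / 2) (Gamma_coeff n S \<alpha> i w))"
    using assms by (intro sum.mono_neutral_left) (auto simp: in_keys_iff)
  then show ?thesis by (cases X) (simp add: rep_loop_def)
qed

lemma rep_loop_add: "rep_loop n S i (X + Y) w = rep_loop n S i X w + rep_loop n S i Y w"
proof -
  let ?A = "keys (snd X) \<union> keys (snd Y)"
  have "keys (snd (X + Y)) \<subseteq> ?A" using keys_add[of "snd X" "snd Y"] by simp
  then show ?thesis
    by (simp add: rep_loop_superset[of ?A] heisenberg_add_cartan lookup_add add_divide_distrib
        FS.scale_left_distrib sum.distrib)
qed

lemma rep_loop_scale: "rep_loop n S i (lie_scale c X) w = fock_scale c (rep_loop n S i X w)"
proof -
  have "keys (snd (lie_scale c X)) \<subseteq> keys (snd X)"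
    by (auto simp: lie_scale_def in_keys_iff lookup_pscale)
  then show ?thesis
    by (simp add: rep_loop_superset[of "keys (snd X)"])
      (simp add: lie_scale_def heisenberg_pscale_cartan lookup_pscale FS.scale_right_distrib FS.scale_sum_right)
qed

lemma rep_loop_zero [simp]: "rep_loop n S i 0 w = 0"
  by (simp add: rep_loop_def zero_prod_def)

lemma rep_loop_uminus: "rep_loop n S i (- X) w = - rep_loop n S i X w"
  using rep_loop_add[of n S i X "- X" w] by (simp add: eq_neg_iff_add_eq_0 add.commute)

lemma rep_loop_diff: "rep_loop n S i (X - Y) w = rep_loop n S i X w - rep_loop n S i Y w"
  using rep_loop_add[of n S i X "- Y" w] by (simp add: rep_loop_uminus)

lemma rep_loop_sum: "rep_loop n S i (sum f A) w = (\<Sum>a\<in>A. rep_loop n S i (f a) w)"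
  by (induction A rule: infinite_finite_induct) (simp_all add: rep_loop_add)

lemma rep_loop_X_elt: "rep_loop n S i (X_elt \<alpha>) w = fock_scale (1 / 2) (Gamma_coeff n S \<alpha> i w)"
  by (simp add: rep_loop_def X_elt_def)

lemma rep_loop_H_elt: "rep_loop n S i (H_elt h) w = heisenberg n S h i w"
  by (simp add: rep_loop_def H_elt_def)

lemma fock_space_rep_loop [intro]: "w \<in> fock_space n \<Longrightarrow> rep_loop n S i X w \<in> fock_space n"
  by (auto simp: rep_loop_superset[of "keys (snd X)" X] intro!: fock_space_add fock_space_sum fock_space_scale)

lemma rep_loop_add_right:
  "v \<in> fock_space n \<Longrightarrow> w \<in> fock_space n \<Longrightarrow>
    rep_loop n S i X (v + w) = rep_loop n S i X v + rep_loop n S i X w"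
  by (simp add: rep_loop_superset[of "keys (snd X)" X] heisenberg_add Gamma_coeff_add FS.scale_right_distrib sum.distrib)

lemma rep_loop_scale_right:
  "w \<in> fock_space n \<Longrightarrow> rep_loop n S i X (fock_scale c w) = fock_scale c (rep_loop n S i X w)"
  by (simp add: rep_loop_superset[of "keys (snd X)" X] heisenberg_scale Gamma_coeff_scale FS.scale_right_distrib
      FS.scale_sum_right mult.commute)

text \<open>The contribution of the pair \<open>X\<^sub>\<alpha> \<otimes> t\<^sup>i\<close>, \<open>X\<^sub>\<beta> \<otimes> t\<^sup>k\<close> to the action of a bracket; the second summand is the
  central term.\<close>

definition root_term :: "nat \<Rightarrow> (nat \<Rightarrow> cartan) \<Rightarrow> int \<Rightarrow> int \<Rightarrow> fock \<Rightarrow> lattice \<Rightarrow> lattice \<Rightarrow> fock" where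
  "root_term n S i k w \<alpha> \<beta> = rep_loop n S (i + k) (X_bracket n \<alpha> \<beta>) w +
     fock_scale (if i + k = 0 \<and> \<beta> = - \<alpha> then - of_int i / 2 else 0) w"

text \<open>The coefficient of \<open>\<Gamma>\<^sub>\<beta>\<close> at \<open>k\<close> represents \<open>X\<^sub>\<beta> + (-1)\<^sup>k X\<^sub>-\<^sub>\<beta>\<close>, so the commutator is compared with the contributions of
  \<open>\<beta>\<close> and of \<open>-\<beta>\<close>. Both sides have the same parity under \<open>\<beta> \<mapsto> -\<beta>\<close>, which reduces the proof to the case
  \<open>(\<alpha>|\<beta>) \<le> 0\<close>, where the contribution of \<open>-\<beta>\<close> vanishes.\<close>

lemma Gamma_commutator_root_term:
  assumes n: "n \<in> {6, 7, 8}" and S: "orthonormal_basis n S"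
    and r: "\<alpha> \<in> roots n" "\<beta> \<in> roots n" and w: "w \<in> fock_space n"
  shows "fock_scale (1 / 2) (Gamma_coeff n S \<alpha> i (Gamma_coeff n S \<beta> k w) - Gamma_coeff n S \<beta> k (Gamma_coeff n S \<alpha> i w)) =
    root_term n S i k w \<alpha> \<beta> + fock_scale (if even k then 1 else - 1) (root_term n S i k w \<alpha> (- \<beta>))"
proof -
  define e :: complex where "e = (if even k then 1 else - 1)"
  have base: "fock_scale (1 / 2) (Gamma_coeff n S \<alpha> i (Gamma_coeff n S \<beta> k w) - Gamma_coeff n S \<beta> k (Gamma_coeff n S \<alpha> i w)) =
    root_term n S i k w \<alpha> \<beta> + fock_scale e (root_term n S i k w \<alpha> (- \<beta>))"
    if r': "\<beta> \<in> roots n" and b: "bform n \<alpha> \<beta> \<le> 0" for \<beta>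
  proof -
    note na = roots_norm[OF r(1)] and nb = roots_norm[OF r'] and kb = keys_roots[OF r(1)]
    have rb: "- \<beta> \<in> roots n" using roots_uminus r' by blast
    have "bform n \<alpha> \<alpha> = 2 \<Longrightarrow> \<beta> = \<alpha> \<Longrightarrow> False" using b by simp
    then have ne: "\<beta> \<noteq> \<alpha>" using na by blast
    have "\<alpha> + - \<beta> \<notin> roots n"
      using add_in_roots_iff[OF r(1) rb] b by (simp add: bform_minus_right)
    then have "X_bracket n \<alpha> (- \<beta>) = 0" using ne by (simp add: X_bracket_def)
    then have neg0: "root_term n S i k w \<alpha> (- \<beta>) = 0"
      using ne by (auto simp: root_term_def)
    consider "\<beta> = - \<alpha>" | "bform n \<alpha> \<beta> = - 1" "\<beta> \<noteq> - \<alpha>" | "bform n \<alpha> \<beta> = 0" "\<beta> \<noteq> - \<alpha>"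
      using roots_bform_cases[OF n r(1) r'] b ne na by (auto simp: bform_minus_right)
    then show ?thesis
    proof cases
      case 1
      have "X_bracket n \<alpha> \<beta> = - H_elt (H_of \<alpha>)"
        using 1 roots_nonzero[of 0 n] by (auto simp: X_bracket_def)
      then have "root_term n S i k w \<alpha> \<beta> = - heisenberg n S (H_of \<alpha>) (i + k) w +
          fock_scale (if i + k = 0 then - of_int i / 2 else 0) w"
        using 1 by (simp add: root_term_def rep_loop_uminus rep_loop_H_elt)
      then show ?thesis
        unfolding neg0 unfolding 1 Gamma_commutator_opposite[OF n S r(1) w]
        by (auto simp: FS.scale_right_diff_distrib)
    next
      case 2
      then have "X_bracket n \<alpha> \<beta> = lie_scale (nu n \<alpha> \<beta>) (X_elt (\<alpha> + \<beta>))"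
        using add_in_roots_iff[OF r(1) r'] by (simp add: X_bracket_def)
      with 2 show ?thesis
        unfolding neg0 Gamma_commutator_root[OF n S kb 2(1) w]
        by (simp add: root_term_def rep_loop_scale rep_loop_X_elt mult.commute)
    next
      case 3
      then have "X_bracket n \<alpha> \<beta> = 0"
        using add_in_roots_iff[OF r(1) r'] by (auto simp: X_bracket_def eq_neg_iff_add_eq_0 add.commute)
      with 3 show ?thesis
        unfolding neg0 Gamma_commute[OF n S kb 3(1) w] by (simp add: root_term_def)
    qed
  qed
  show ?thesis
  proof (cases "bform n \<alpha> \<beta> \<le> 0")
    case True
    then show ?thesis using base[OF r(2)] by (simp add: e_def)
  next
    case False
    (* Now the pairing of alpha with -beta is negative. *)
    have "Gamma_coeff n S (- \<beta>) k v = fock_scale e (Gamma_coeff n S \<beta> k v)" for v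
      by (simp add: Gamma_coeff_uminus e_def)
    then have "fock_scale e (fock_scale (1 / 2) (Gamma_coeff n S \<alpha> i (Gamma_coeff n S \<beta> k w) - Gamma_coeff n S \<beta> k (Gamma_coeff n S \<alpha> i w))) =
      root_term n S i k w \<alpha> (- \<beta>) + fock_scale e (root_term n S i k w \<alpha> \<beta>)"
      using base[OF roots_uminus[OF r(2)]] False w
      by (simp add: bform_minus_right Gamma_coeff_scale fock_space_Gamma_coeff FS.scale_right_diff_distrib mult.commute)
    from arg_cong[OF this, of "fock_scale e"] show ?thesis
      by (auto simp: e_def FS.scale_right_distrib add.commute)
  qed
qed

lemma lie_partD:
  assumes "(h, x) \<in> lie_part n i"
  shows "keys h \<subseteq> {1..n}" "keys x \<subseteq> roots n" "even i \<Longrightarrow> h = 0"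
    "lookup x (- \<alpha>) = (if even i then 1 else - 1) * lookup x \<alpha>"
proof -
  have *: "(h, x) \<in> lie_alg n" "(- h, Poly_Mapping.map_key uminus x) = (if even i then (h, x) else - (h, x))"
    using assms by (simp_all add: lie_part_def sigma_def)
  show "keys h \<subseteq> {1..n}" "keys x \<subseteq> roots n" using *(1) by (simp_all add: lie_alg_def)
  show "h = 0" if "even i"
  proof (rule poly_mapping_eqI)
    fix k
    have "- h = h" using * that by simp
    then have "lookup (- h) k = lookup h k" by (simp only:)
    then show "lookup h k = lookup 0 k" by simp
  qed
  have "inj (uminus :: lattice \<Rightarrow> lattice)" by (simp add: inj_on_def)
  then have "lookup (Poly_Mapping.map_key uminus x) \<alpha> = lookup x (- \<alpha>)"
    by (simp add: map_key.rep_eq)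
  moreover have "Poly_Mapping.map_key uminus x = (if even i then x else - x)"
    using *(2) by (auto simp: uminus_prod_def split: if_splits)
  ultimately show "lookup x (- \<alpha>) = (if even i then 1 else - 1) * lookup x \<alpha>"
    by auto
qed

text \<open>Since \<open>y\<close> is an eigenvector of the involution, the substitution \<open>\<beta> \<mapsto> -\<beta>\<close> identifies the two halves of the
  right-hand side of the preceding relation after summation over \<open>\<beta>\<close>.\<close>

lemma root_part_commutator:
  assumes n: "n \<in> {6, 7, 8}" and S: "orthonormal_basis n S" and w: "w \<in> fock_space n"
    and x: "keys x \<subseteq> roots n" and y: "keys y \<subseteq> roots n"
    and y_sign: "\<And>\<beta>. lookup y (- \<beta>) = (if even k then 1 else - 1) * lookup y \<beta>"
  shows "(\<Sum>\<alpha>\<in>keys x. \<Sum>\<beta>\<in>keys y. fock_scale (lookup x \<alpha> * lookup y \<beta> / 4)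
      (Gamma_coeff n S \<alpha> i (Gamma_coeff n S \<beta> k w) - Gamma_coeff n S \<beta> k (Gamma_coeff n S \<alpha> i w))) =
    (\<Sum>\<alpha>\<in>keys x. \<Sum>\<beta>\<in>keys y. fock_scale (lookup x \<alpha> * lookup y \<beta>) (root_term n S i k w \<alpha> \<beta>))"
proof (rule sum.cong[OF refl])
  fix \<alpha> assume \<alpha>: "\<alpha> \<in> keys x"
  define e :: complex where "e = (if even k then 1 else - 1)"
  let ?F = "root_term n S i k w \<alpha>" and ?c = "\<lambda>\<beta>. lookup x \<alpha> * lookup y \<beta>"
  let ?C = "\<lambda>\<beta>. Gamma_coeff n S \<alpha> i (Gamma_coeff n S \<beta> k w) - Gamma_coeff n S \<beta> k (Gamma_coeff n S \<alpha> i w)"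
  have neg: "(\<Sum>\<beta>\<in>keys y. fock_scale (?c \<beta> * e) (?F (- \<beta>))) = (\<Sum>\<beta>\<in>keys y. fock_scale (?c \<beta>) (?F \<beta>))"
  proof (rule sum.reindex_bij_witness[of _ uminus uminus])
    fix \<beta>
    show "fock_scale (?c (- \<beta>)) (?F (- \<beta>)) = fock_scale (?c \<beta> * e) (?F (- \<beta>))"
      by (simp add: y_sign e_def)
  qed (auto simp: in_keys_iff y_sign)
  have "(\<Sum>\<beta>\<in>keys y. fock_scale (?c \<beta> / 4) (?C \<beta>)) =
      (\<Sum>\<beta>\<in>keys y. fock_scale (?c \<beta> / 2) (fock_scale (1 / 2) (?C \<beta>)))"
    by simp
  also have "\<dots> = (\<Sum>\<beta>\<in>keys y. fock_scale (?c \<beta> / 2) (?F \<beta> + fock_scale e (?F (- \<beta>))))"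
    using \<alpha> x y
    by (intro sum.cong refl arg_cong[of _ _ "fock_scale _"])
      (simp add: Gamma_commutator_root_term[OF n S _ _ w] subset_iff e_def)
  also have "\<dots> = fock_scale (1 / 2) ((\<Sum>\<beta>\<in>keys y. fock_scale (?c \<beta>) (?F \<beta>)) +
      (\<Sum>\<beta>\<in>keys y. fock_scale (?c \<beta> * e) (?F (- \<beta>))))"
    by (simp add: FS.scale_right_distrib FS.scale_sum_right sum.distrib)
  also have "\<dots> = (\<Sum>\<beta>\<in>keys y. fock_scale (?c \<beta>) (?F \<beta>))"
    unfolding neg FS.scale_left_distrib[symmetric] FS.scale_right_distrib by simp
  finally show "(\<Sum>\<beta>\<in>keys y. fock_scale (?c \<beta> / 4) (?C \<beta>)) = (\<Sum>\<beta>\<in>keys y. fock_scale (?c \<beta>) (?F \<beta>))" .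
qed

lemma heisenberg_Gamma_commutator':
  assumes "orthonormal_basis n S" "keys h \<subseteq> {1..n}" "even i \<Longrightarrow> h = 0" "w \<in> fock_space n"
  shows "heisenberg n S h i (Gamma_coeff n S \<beta> k w) =
    Gamma_coeff n S \<beta> k (heisenberg n S h i w) + fock_scale (bform n h (H_of \<beta>)) (Gamma_coeff n S \<beta> (i + k) w)"
  using heisenberg_Gamma_commutator[of n S h i w \<beta> k] assms
  by (cases "even i") (auto simp: algebra_simps)

text \<open>The commutator splits into the commutators of the Heisenberg parts with each other, of the Heisenberg parts with
  the root vectors, and of the root vectors with each other. The first and the last yield the central term.\<close>

lemma rep_loop_bracket:
  assumes n: "n \<in> {6, 7, 8}" and S: "orthonormal_basis n S" and w: "w \<in> fock_space n"
    and X: "X \<in> lie_part n i" and Y: "Y \<in> lie_part n k"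
  shows "rep_loop n S (i + k) (lie_bracket n X Y) w
      + fock_scale (if i + k = 0 then of_int i / 2 * lie_form n X Y else 0) w =
    rep_loop n S i X (rep_loop n S k Y w) - rep_loop n S k Y (rep_loop n S i X w)"
proof -
  obtain h x h' y where XY: "X = (h, x)" "Y = (h', y)" by (cases X, cases Y)
  note x = lie_partD[OF X[unfolded XY]] and y = lie_partD[OF Y[unfolded XY]]
  let ?G = "Gamma_coeff n S" and ?H = "heisenberg n S"
  let ?c = "\<lambda>\<alpha> \<beta>. lookup x \<alpha> * lookup y \<beta>"
  let ?B = "\<Sum>\<alpha>\<in>keys x. \<Sum>\<beta>\<in>keys y. fock_scale (?c \<alpha> \<beta>) (rep_loop n S (i + k) (X_bracket n \<alpha> \<beta>) w)"
  let ?K = "\<lambda>\<alpha> \<beta>. fock_scale (if i + k = 0 \<and> \<beta> = - \<alpha> then - of_int i / 2 else 0) w"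
  let ?p = "\<lambda>\<alpha>. lookup x \<alpha> * lookup y (- \<alpha>)"
  let ?k = "fock_scale (if i + k = 0 then - of_int i / 2 * (\<Sum>\<alpha>\<in>keys x. ?p \<alpha>) else 0) w"
  define P where "P = (\<Sum>\<alpha>\<in>keys x. \<Sum>\<beta>\<in>keys y. fock_scale (?c \<alpha> \<beta> / 4)
      (?G \<alpha> i (?G \<beta> k w)))"
  define P' where "P' = (\<Sum>\<alpha>\<in>keys x. \<Sum>\<beta>\<in>keys y. fock_scale (?c \<alpha> \<beta> / 4)
      (?G \<beta> k (?G \<alpha> i w)))"
  have HH: "?H h i (?H h' k w) - ?H h' k (?H h i w) =
      fock_scale (if i + k = 0 then of_int i / 2 * bform n h h' else 0) w"
    using heisenberg_commutator[OF S x(1), of i h' k w] x(3) by (cases "even i") auto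
  have 1: "rep_loop n S i X (rep_loop n S k Y w) = ?H h i (?H h' k w)
      + (\<Sum>\<beta>\<in>keys y. fock_scale (lookup y \<beta> / 2) (?H h i (?G \<beta> k w)))
      + (\<Sum>\<alpha>\<in>keys x. fock_scale (lookup x \<alpha> / 2) (?G \<alpha> i (?H h' k w))) + P"
    using w
    by (simp add: XY rep_loop_def heisenberg_add heisenberg_sum heisenberg_scale Gamma_coeff_add
        Gamma_coeff_sum Gamma_coeff_scale fock_space_sum fock_space_scale fock_space_Gamma_coeff
        fock_space_heisenberg FS.scale_right_distrib sum.distrib FS.scale_sum_right P_def)
  have 2: "rep_loop n S k Y (rep_loop n S i X w) = ?H h' k (?H h i w)
      + (\<Sum>\<alpha>\<in>keys x. fock_scale (lookup x \<alpha> / 2) (?H h' k (?G \<alpha> i w)))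
      + (\<Sum>\<beta>\<in>keys y. fock_scale (lookup y \<beta> / 2) (?G \<beta> k (?H h i w))) + P'"
    using w
    by (simp add: XY rep_loop_def heisenberg_add heisenberg_sum heisenberg_scale Gamma_coeff_add
        Gamma_coeff_sum Gamma_coeff_scale fock_space_sum fock_space_scale fock_space_Gamma_coeff
        fock_space_heisenberg FS.scale_right_distrib sum.distrib FS.scale_sum_right P'_def
        sum.swap[of _ "keys x"] mult.commute)
  have 3: "(\<Sum>\<beta>\<in>keys y. fock_scale (lookup y \<beta> / 2) (?H h i (?G \<beta> k w))) =
      (\<Sum>\<beta>\<in>keys y. fock_scale (lookup y \<beta> / 2) (?G \<beta> k (?H h i w))) +
      (\<Sum>\<beta>\<in>keys y. fock_scale (lookup y \<beta> * bform n h (H_of \<beta>) / 2) (?G \<beta> (i + k) w))"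
    using heisenberg_Gamma_commutator'[OF S x(1,3) w]
    by (simp add: FS.scale_right_distrib sum.distrib)
  have 4: "(\<Sum>\<alpha>\<in>keys x. fock_scale (lookup x \<alpha> / 2) (?H h' k (?G \<alpha> i w))) =
      (\<Sum>\<alpha>\<in>keys x. fock_scale (lookup x \<alpha> / 2) (?G \<alpha> i (?H h' k w))) +
      (\<Sum>\<alpha>\<in>keys x. fock_scale (lookup x \<alpha> * bform n h' (H_of \<alpha>) / 2) (?G \<alpha> (i + k) w))"
    using heisenberg_Gamma_commutator'[OF S y(1,3) w]
    by (simp add: FS.scale_right_distrib sum.distrib add.commute[of k i])
  have "P - P' = (\<Sum>\<alpha>\<in>keys x. \<Sum>\<beta>\<in>keys y. fock_scale (?c \<alpha> \<beta>) (root_term n S i k w \<alpha> \<beta>))"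
    unfolding root_part_commutator[OF n S w x(2) y(2) y(4), symmetric]
    by (simp add: P_def P'_def FS.scale_right_diff_distrib sum_subtractf)
  also have "\<dots> = ?B + ?k"
  proof -
    have "(\<Sum>\<beta>\<in>keys y. fock_scale (?c \<alpha> \<beta>) (?K \<alpha> \<beta>)) =
        fock_scale (if i + k = 0 then - of_int i / 2 * ?p \<alpha> else 0) w" for \<alpha>
    proof -
      have "(\<Sum>\<beta>\<in>keys y. fock_scale (?c \<alpha> \<beta>) (?K \<alpha> \<beta>)) =
        (\<Sum>\<beta>\<in>keys y. if \<beta> = - \<alpha> then fock_scale (if i + k = 0 then - of_int i / 2 * (?c \<alpha> \<beta>) else 0) w else 0)"
        by (intro sum.cong refl) (auto simp: mult.commute)
      then show ?thesis by (auto simp: in_keys_iff)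
    qed
    then have "(\<Sum>\<alpha>\<in>keys x. \<Sum>\<beta>\<in>keys y. fock_scale (?c \<alpha> \<beta>) (?K \<alpha> \<beta>)) =
        fock_scale (\<Sum>\<alpha>\<in>keys x. if i + k = 0 then - of_int i / 2 * ?p \<alpha> else 0) w"
      by (simp only: FS.scale_sum_left)
    also have "(\<Sum>\<alpha>\<in>keys x. if i + k = 0 then - of_int i / 2 * ?p \<alpha> else 0) =
        (if i + k = 0 then - of_int i / 2 * (\<Sum>\<alpha>\<in>keys x. ?p \<alpha>) else 0)"
      by (simp only: sum_distrib_left) simp
    finally show ?thesis
      unfolding root_term_def FS.scale_right_distrib sum.distrib by (simp only:)
  qed
  finally have PP: "P - P' = ?B + ?k" .
  have "rep_loop n S (i + k) (lie_bracket n X Y) w =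
      ?B
      + (\<Sum>\<beta>\<in>keys y. fock_scale (lookup y \<beta> * bform n h (H_of \<beta>) / 2) (?G \<beta> (i + k) w))
      - (\<Sum>\<alpha>\<in>keys x. fock_scale (lookup x \<alpha> * bform n h' (H_of \<alpha>) / 2) (?G \<alpha> (i + k) w))"
    by (simp add: XY rep_loop_add rep_loop_diff rep_loop_sum rep_loop_scale rep_loop_X_elt)
  moreover have "fock_scale (if i + k = 0 then of_int i / 2 * lie_form n X Y else 0) w =
      fock_scale (if i + k = 0 then of_int i / 2 * bform n h h' else 0) w +
      ?k"
    by (simp add: XY right_diff_distrib FS.scale_left_diff_distrib)
  ultimately show ?thesis
    unfolding 1 2 3 4 using PP HH by (simp add: algebra_simps)
qed

subsection \<open>The derivation\<close>

lemma euler_sum: "(\<And>a. a \<in> A \<Longrightarrow> f a \<in> polys n) \<Longrightarrow> euler n (sum f A) = (\<Sum>a\<in>A. euler n (f a))"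
  by (induction A rule: infinite_finite_induct) (auto simp: euler_add polys_sum)

lemma energy_heisenberg:
  assumes "w \<in> fock_space n"
  shows "energy n (heisenberg n S h i w) = heisenberg n S h i (energy n w) - fock_scale (of_int i) (heisenberg n S h i w)"
proof (cases "even i")
  case False
  have "euler n (heis_poly n S h i f) = heis_poly n S h i (euler n f) - pscale (of_int i) (heis_poly n S h i f)"
    if f: "f \<in> polys n" for f
  proof -
    let ?g = "\<lambda>j. pscale (bform n h (S j)) (a_coeff j i f)"
    have "euler n (heis_poly n S h i f) = pscale (1 / complex_of_real (sqrt 2)) (\<Sum>j=1..n. euler n (?g j))"
      unfolding heis_poly_def
      by (subst euler_pscale, (auto intro!: polys_sum polys_pscale polys_a_coeff f)[1])
        (subst euler_sum, auto intro!: polys_pscale polys_a_coeff f)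
    also have "(\<Sum>j=1..n. euler n (?g j)) = (\<Sum>j=1..n. pscale (bform n h (S j)) (a_coeff j i (euler n f)) -
        pscale (of_int i) (?g j))"
      by (intro sum.cong refl)
        (simp add: euler_pscale polys_a_coeff f euler_a_coeff[OF _ False f] PS.scale_right_diff_distrib mult.commute)
    finally show ?thesis
      by (simp add: heis_poly_def sum_subtractf PS.scale_right_diff_distrib PS.scale_sum_right mult_ac)
  qed
  then show ?thesis using assms
    by (intro poly_mapping_eqI)
      (simp add: lookup_energy lookup_minus lookup_heisenberg lookup_fock_scale fock_spaceD)
qed (simp add: heisenberg_even)

lemma energy_Gamma_coeff:
  assumes "w \<in> fock_space n"
  shows "energy n (Gamma_coeff n S \<alpha> i w) = Gamma_coeff n S \<alpha> i (energy n w) - fock_scale (of_int i) (Gamma_coeff n S \<alpha> i w)"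
  using assms
  by (intro poly_mapping_eqI)
    (simp add: lookup_energy lookup_minus lookup_Gamma_coeff lookup_fock_scale fock_spaceD euler_pscale
      polys_vertex_coeff euler_vertex_coeff PS.scale_right_diff_distrib mult.commute)

lemma energy_rep_loop:
  assumes "w \<in> fock_space n"
  shows "energy n (rep_loop n S i X w) = rep_loop n S i X (energy n w) - fock_scale (of_int i) (rep_loop n S i X w)"
proof -
  have "energy n (\<Sum>\<alpha>\<in>keys (snd X). fock_scale (lookup (snd X) \<alpha> / 2) (Gamma_coeff n S \<alpha> i w)) =
      (\<Sum>\<alpha>\<in>keys (snd X). fock_scale (lookup (snd X) \<alpha> / 2) (Gamma_coeff n S \<alpha> i (energy n w)))
      - fock_scale (of_int i) (\<Sum>\<alpha>\<in>keys (snd X). fock_scale (lookup (snd X) \<alpha> / 2) (Gamma_coeff n S \<alpha> i w))"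
    using assms
    by (simp add: energy_sum fock_space_scale fock_space_Gamma_coeff energy_scale energy_Gamma_coeff
        FS.scale_right_diff_distrib sum_subtractf FS.scale_sum_right mult.commute)
  then show ?thesis
    using assms
    by (simp add: rep_loop_superset[of "keys (snd X)" X] energy_add fock_space_heisenberg fock_space_sum
        fock_space_scale fock_space_Gamma_coeff energy_heisenberg FS.scale_right_distrib)
qed

subsection \<open>The affine algebra\<close>

definition rep_loops :: "nat \<Rightarrow> (nat \<Rightarrow> cartan) \<Rightarrow> (int \<Rightarrow>\<^sub>0 lie) \<Rightarrow> fock \<Rightarrow> fock" where
  "rep_loops n S u w = (\<Sum>i\<in>keys u. rep_loop n S i (lookup u i) w)"

lemma rep_eq: "rep n S (u, k, d) w = rep_loops n S u w + fock_scale k w - fock_scale d (energy n w)"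
  by (simp add: rep_def rep_loops_def)

lemma rep_loops_superset:
  "finite A \<Longrightarrow> keys u \<subseteq> A \<Longrightarrow> rep_loops n S u w = (\<Sum>i\<in>A. rep_loop n S i (lookup u i) w)"
  unfolding rep_loops_def by (rule sum.mono_neutral_left) (auto simp: in_keys_iff)

lemma rep_loops_add: "rep_loops n S (u + u') w = rep_loops n S u w + rep_loops n S u' w"
  using keys_add[of u u']
  by (simp add: rep_loops_superset[of "keys u \<union> keys u'"] lookup_add rep_loop_add sum.distrib)

lemma rep_loops_zero [simp]: "rep_loops n S 0 w = 0"
  by (simp add: rep_loops_def)

lemma rep_loops_diff: "rep_loops n S (u - u') w = rep_loops n S u w - rep_loops n S u' w"
  using rep_loops_add[of n S "u - u'" u' w] by simp

lemma rep_loops_sum: "rep_loops n S (sum f A) w = (\<Sum>a\<in>A. rep_loops n S (f a) w)"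
  by (induction A rule: infinite_finite_induct) (simp_all add: rep_loops_add)

lemma rep_loops_single: "rep_loops n S (single i X) w = rep_loop n S i X w"
  by (simp add: rep_loops_def)

lemma rep_loops_scale: "rep_loops n S (Poly_Mapping.map (lie_scale c) u) w = fock_scale c (rep_loops n S u w)"
proof -
  have l: "lookup (Poly_Mapping.map (lie_scale c) u) i = lie_scale c (lookup u i)" for i
    by (auto simp: Poly_Mapping.map.rep_eq when_def lie_scale_def zero_prod_def)
  then have "keys (Poly_Mapping.map (lie_scale c) u) \<subseteq> keys u"
    by (auto simp: in_keys_iff lie_scale_def zero_prod_def)
  then show ?thesis
    by (simp add: rep_loops_superset[of "keys u"] l rep_loop_scale FS.scale_sum_right)
qed

lemma fock_space_rep_loops [intro]: "w \<in> fock_space n \<Longrightarrow> rep_loops n S u w \<in> fock_space n"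
  by (auto simp: rep_loops_def)

lemma rep_loops_add_right:
  "v \<in> fock_space n \<Longrightarrow> w \<in> fock_space n \<Longrightarrow> rep_loops n S u (v + w) = rep_loops n S u v + rep_loops n S u w"
  by (simp add: rep_loops_def rep_loop_add_right sum.distrib)

lemma rep_loops_scale_right:
  "w \<in> fock_space n \<Longrightarrow> rep_loops n S u (fock_scale c w) = fock_scale c (rep_loops n S u w)"
  by (simp add: rep_loops_def rep_loop_scale_right FS.scale_sum_right)

lemma rep_loop_zero_right [simp]: "rep_loop n S i X 0 = 0"
  using rep_loop_scale_right[of 0 n S i X 0] by simp

lemma rep_loop_sum_right:
  "(\<And>a. a \<in> A \<Longrightarrow> f a \<in> fock_space n) \<Longrightarrow> rep_loop n S i X (sum f A) = (\<Sum>a\<in>A. rep_loop n S i X (f a))"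
  by (induction A rule: infinite_finite_induct) (auto simp: rep_loop_add_right fock_space_sum)

text \<open>By bilinearity this is the sum of the bracket relations of the loop algebra. The derivation contributes through
  \<open>[energy, \<pi>(X \<otimes> t\<^sup>i)] = - i \<pi>(X \<otimes> t\<^sup>i)\<close>.\<close>

lemma rep_bracket:
  assumes n: "n \<in> {6, 7, 8}" and S: "orthonormal_basis n S" and w: "w \<in> fock_space n"
    and x: "x \<in> affine_alg n" and y: "y \<in> affine_alg n"
  shows "rep n S (affine_bracket n x y) w = rep n S x (rep n S y w) - rep n S y (rep n S x w)"
proof -
  obtain u k d u' k' d' where xy: "x = (u, k, d)" "y = (u', k', d')"
    by (cases x, cases y)
  have u: "lookup u i \<in> lie_part n i" and u': "lookup u' i \<in> lie_part n i" for i
    using x y by (auto simp: xy affine_alg_def)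
  define R where "R = rep_loops n S u"
  define R' where "R' = rep_loops n S u'"
  define D where "D = (\<Sum>i\<in>keys u. fock_scale (of_int i) (rep_loop n S i (lookup u i) w))"
  define D' where "D' = (\<Sum>i\<in>keys u'. fock_scale (of_int i) (rep_loop n S i (lookup u' i) w))"
  have E: "energy n (R w) = R (energy n w) - D"
    using w by (simp add: R_def D_def rep_loops_def energy_sum fock_space_rep_loop energy_rep_loop sum_subtractf)
  have E': "energy n (R' w) = R' (energy n w) - D'"
    using w by (simp add: R'_def D'_def rep_loops_def energy_sum fock_space_rep_loop energy_rep_loop sum_subtractf)
  have lin: "R (v - v') = R v - R v'" "R' (v - v') = R' v - R' v'" "energy n (v - v') = energy n v - energy n v'"
    if "v \<in> fock_space n" "v' \<in> fock_space n" for v v'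
  proof -
    have *: "v - v' = v + fock_scale (- 1) v'" by simp
    show "R (v - v') = R v - R v'" "R' (v - v') = R' v - R' v'" "energy n (v - v') = energy n v - energy n v'"
      unfolding * using that
      by (simp_all only: R_def R'_def rep_loops_add_right rep_loops_scale_right energy_add energy_scale
          fock_space_scale) simp_all
  qed
  have "rep n S x (rep n S y w) - rep n S y (rep n S x w) = (R (R' w) - R' (R w)) + fock_scale d D' - fock_scale d' D"
    using w
    by (simp add: E E' xy rep_eq R_def[symmetric] R'_def[symmetric] lin fock_space_add fock_space_scale fock_space_energy
        fock_space_rep_loops[folded R_def] fock_space_rep_loops[of w n S u, folded R_def]
        fock_space_rep_loops[of w n S u', folded R'_def]
        rep_loops_add_right[of _ n _ S u, folded R_def] rep_loops_add_right[of _ n _ S u', folded R'_def]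
        rep_loops_scale_right[of _ n S u, folded R_def] rep_loops_scale_right[of _ n S u', folded R'_def]
        energy_add energy_scale FS.scale_right_distrib FS.scale_right_diff_distrib algebra_simps)
  also have "R (R' w) - R' (R w) = (\<Sum>i\<in>keys u. \<Sum>j\<in>keys u'.
      rep_loop n S i (lookup u i) (rep_loop n S j (lookup u' j) w) -
      rep_loop n S j (lookup u' j) (rep_loop n S i (lookup u i) w))"
  proof -
    have "R (R' w) = (\<Sum>i\<in>keys u. \<Sum>j\<in>keys u'. rep_loop n S i (lookup u i) (rep_loop n S j (lookup u' j) w))"
      using w by (simp add: R_def R'_def rep_loops_def rep_loop_sum_right fock_space_rep_loop)
    moreover have "R' (R w) = (\<Sum>i\<in>keys u. \<Sum>j\<in>keys u'. rep_loop n S j (lookup u' j) (rep_loop n S i (lookup u i) w))"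
      using w by (subst sum.swap) (simp add: R_def R'_def rep_loops_def rep_loop_sum_right fock_space_rep_loop)
    ultimately show ?thesis by (simp add: sum_subtractf)
  qed
  also have "\<dots> = (\<Sum>i\<in>keys u. \<Sum>j\<in>keys u'.
      rep_loop n S (i + j) (lie_bracket n (lookup u i) (lookup u' j)) w)
      + (\<Sum>i\<in>keys u. \<Sum>j\<in>keys u'.
      fock_scale (if i + j = 0 then of_int i / 2 * lie_form n (lookup u i) (lookup u' j) else 0) w)"
    unfolding rep_loop_bracket[OF n S w u u', symmetric] by (simp add: sum.distrib)
  also have "(\<Sum>i\<in>keys u. \<Sum>j\<in>keys u'.
      fock_scale (if i + j = 0 then of_int i / 2 * lie_form n (lookup u i) (lookup u' j) else 0) w) =
      fock_scale (\<Sum>i\<in>keys u. of_int i / 2 * lie_form n (lookup u i) (lookup u' (- i))) w"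
  proof -
    have form0: "lie_form n X 0 = 0" for X
      by (cases X) (simp add: zero_prod_def)
    have "(\<Sum>j\<in>keys u'. fock_scale (if i + j = 0 then of_int i / 2 * lie_form n (lookup u i) (lookup u' j) else 0) w) =
        fock_scale (of_int i / 2 * lie_form n (lookup u i) (lookup u' (- i))) w" for i
    proof -
      have "(\<Sum>j\<in>keys u'. fock_scale (if i + j = 0 then of_int i / 2 * lie_form n (lookup u i) (lookup u' j) else 0) w) =
        (\<Sum>j\<in>keys u'. if j = - i then fock_scale (of_int i / 2 * lie_form n (lookup u i) (lookup u' j)) w else 0)"
        by (intro sum.cong refl) (auto simp: add_eq_0_iff)
      then show ?thesis by (simp add: in_keys_iff form0)
    qed
    then show ?thesis by (simp only: FS.scale_sum_left)
  qed
  finally show ?thesis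
    by (simp add: xy rep_eq rep_loops_add rep_loops_diff rep_loops_sum rep_loops_single rep_loop_scale
        D_def D'_def FS.scale_sum_right algebra_simps)
qed

theorem rep_lie_module:
  assumes n: "n \<in> {6, 7, 8}" and S: "orthonormal_basis n S" and W: "W \<subseteq> fock_space n"
    and sub: "lie_submodule (affine_alg n) fock_scale (rep n S) W"
  shows "lie_module (affine_alg n) affine_scale (affine_bracket n) fock_scale (rep n S) W"
  unfolding lie_module_def
proof (intro conjI ballI allI)
  note lin = rep_loops_add_right rep_loops_scale_right energy_add energy_scale
  fix x y v w c assume x: "x \<in> affine_alg n" and y: "y \<in> affine_alg n"
  obtain u k d u' k' d' where xy: "x = (u, k, d)" "y = (u', k', d')"
    by (cases x, cases y)
  assume "v \<in> W"
  then have v: "v \<in> fock_space n" using W by blast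
  show "rep n S (affine_bracket n x y) v = rep n S x (rep n S y v) - rep n S y (rep n S x v)"
    by (rule rep_bracket[OF n S v x y])
  show "rep n S (x + y) v = rep n S x v + rep n S y v"
    by (simp add: xy rep_eq rep_loops_add FS.scale_left_distrib)
  show "rep n S (affine_scale c x) v = fock_scale c (rep n S x v)"
    by (simp add: xy affine_scale_def rep_eq rep_loops_scale FS.scale_right_distrib FS.scale_right_diff_distrib)
  show "rep n S x (fock_scale c v) = fock_scale c (rep n S x v)"
    using v by (simp add: xy rep_eq lin FS.scale_right_distrib FS.scale_right_diff_distrib mult.commute)
  assume "w \<in> W"
  then have "w \<in> fock_space n" using W by blast
  then show "rep n S x (v + w) = rep n S x v + rep n S x w"
    using v by (simp add: xy rep_eq lin FS.scale_right_distrib)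
qed (rule sub)

section \<open>The twisted group algebra\<close>

text \<open>The character \<open>e\<^sup>\<gamma> \<mapsto> \<nu>(\<alpha>, \<gamma>) e\<^sup>\<gamma>\<close>, an automorphism of the group algebra.\<close>

definition sign_op :: "nat \<Rightarrow> lattice \<Rightarrow> group_alg \<Rightarrow> group_alg" where
  "sign_op n \<alpha> v = (\<Sum>\<gamma>\<in>keys v. single \<gamma> (nu n \<alpha> (lift2 \<gamma>) * lookup v \<gamma>))"

text \<open>The operator \<open>e\<^sup>\<gamma> \<mapsto> \<nu>(\<alpha>, \<gamma>) e\<^sup>\<alpha>\<^sup>+\<^sup>\<gamma>\<close>, through which \<open>\<Gamma>\<^sub>\<alpha>\<close> acts on the first tensor factor.\<close>

definition shift_op :: "nat \<Rightarrow> lattice \<Rightarrow> group_alg \<Rightarrow> group_alg" where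
  "shift_op n \<alpha> v = single (mod2 \<alpha>) 1 * sign_op n \<alpha> v"

lemma lookup_sign_op: "lookup (sign_op n \<alpha> v) \<gamma> = nu n \<alpha> (lift2 \<gamma>) * lookup v \<gamma>"
  by (simp add: sign_op_def lookup_sum lookup_single when_def in_keys_iff)

lemma lookup_single_mult_mod2: "lookup (single \<mu> 1 * v) \<delta> = lookup v (\<mu> + \<delta>)"
  for v :: group_alg
proof -
  have "lookup (single \<mu> 1 * v) \<delta> = (\<Sum>q. lookup v q when \<delta> = \<mu> + q)"
    by (simp add: lookup_mult lookup_single when_mult)
  also have "(\<lambda>q. lookup v q when \<delta> = \<mu> + q) = (\<lambda>q. lookup v q when q = \<mu> + \<delta>)"
    by (auto simp: fun_eq_iff when_def mod2_cancel)
  finally show ?thesis by simp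
qed

lemma lookup_shift_op:
  "lookup (shift_op n \<alpha> v) \<delta> = nu n \<alpha> (lift2 (mod2 \<alpha> + \<delta>)) * lookup v (mod2 \<alpha> + \<delta>)"
  by (simp add: shift_op_def lookup_single_mult_mod2 lookup_sign_op)

lemma shift_op_add: "shift_op n \<alpha> (v + w) = shift_op n \<alpha> v + shift_op n \<alpha> w"
  by (rule poly_mapping_eqI) (simp add: lookup_shift_op lookup_add distrib_left)

lemma shift_op_pscale: "shift_op n \<alpha> (pscale c v) = pscale c (shift_op n \<alpha> v)"
  by (rule poly_mapping_eqI) (simp add: lookup_shift_op lookup_pscale)

lemma shift_op_zero [simp]: "shift_op n \<alpha> 0 = 0"
  by (rule poly_mapping_eqI) (simp add: lookup_shift_op)

lemma shift_op_sum: "shift_op n \<alpha> (sum f A) = (\<Sum>a\<in>A. shift_op n \<alpha> (f a))"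
  by (induction A rule: infinite_finite_induct) (auto simp: shift_op_add)

lemma shift_op_uminus: "shift_op n (- \<alpha>) v = shift_op n \<alpha> v"
  by (rule poly_mapping_eqI) (simp add: lookup_shift_op mod2_uminus nu_uminus)

lemma shift_op_plus: "shift_op n (\<alpha> + \<beta>) v = pscale (nu n \<alpha> \<beta>) (shift_op n \<alpha> (shift_op n \<beta> v))"
proof (rule poly_mapping_eqI)
  fix \<delta>
  define \<gamma> where "\<gamma> = mod2 (\<alpha> + \<beta>) + \<delta>"
  have a1: "mod2 \<beta> + (mod2 \<alpha> + \<delta>) = \<gamma>"
    by (simp add: \<gamma>_def mod2_add add_ac)
  then have a2: "mod2 \<alpha> + \<delta> = mod2 \<beta> + \<gamma>"
    using mod2_cancel(1) by metis
  have "nu n \<alpha> \<beta> * (nu n \<alpha> \<beta> * c) = c" for c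
    by (simp add: mult.assoc[symmetric])
  then show "lookup (shift_op n (\<alpha> + \<beta>) v) \<delta> = lookup (pscale (nu n \<alpha> \<beta>) (shift_op n \<alpha> (shift_op n \<beta> v))) \<delta>"
    unfolding lookup_pscale lookup_shift_op a1 \<gamma>_def[symmetric]
    unfolding a2 nu_lift2_add by (simp add: nu_add_left mult_ac)
qed

lemma sign_op_add: "sign_op n \<alpha> (v + w) = sign_op n \<alpha> v + sign_op n \<alpha> w"
  by (rule poly_mapping_eqI) (simp add: lookup_sign_op lookup_add distrib_left)

lemma sign_op_zero [simp]: "sign_op n \<alpha> 0 = 0"
  by (rule poly_mapping_eqI) (simp add: lookup_sign_op)

lemma sign_op_single: "sign_op n \<alpha> (single \<gamma> c) = single \<gamma> (nu n \<alpha> (lift2 \<gamma>) * c)"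
  by (rule poly_mapping_eqI) (simp add: lookup_sign_op lookup_single when_def)

lemma sign_op_mult: "sign_op n \<alpha> (v * w) = sign_op n \<alpha> v * sign_op n \<alpha> w"
proof (induction v rule: poly_mapping_induct_single)
  case (single \<gamma> c)
  show ?case
  proof (induction w rule: poly_mapping_induct_single)
    case (single \<delta> d)
    show ?case
      using nu_lift2_add[of n \<alpha> "lift2 \<gamma>" \<delta>] by (simp add: mult_single sign_op_single mult_ac add.commute)
  qed (simp_all add: sign_op_add distrib_left)
qed (simp_all add: sign_op_add distrib_right)

lemma lift2_zero [simp]: "lift2 0 = 0"
  by (rule poly_mapping_eqI) (simp add: lift2_def Poly_Mapping.map.rep_eq)

lemma sign_op_one [simp]: "sign_op n \<alpha> 1 = 1"
  using sign_op_single[of n \<alpha> 0 1] by simp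

lemma sign_op_prod: "sign_op n \<alpha> (prod f A) = (\<Prod>a\<in>A. sign_op n \<alpha> (f a))"
  by (induction A rule: infinite_finite_induct) (simp_all add: sign_op_mult)

text \<open>The effect of the operator for \<open>\<alpha>\<^sub>j\<close> on the signs \<open>c\<^sub>1, \<dots>, c\<^sub>n\<close>. The list entry \<open>cs ! (k - 1)\<close> is \<open>c\<^sub>k\<close>.\<close>

definition flip :: "nat \<Rightarrow> nat \<Rightarrow> complex list \<Rightarrow> complex list" where
  "flip n j cs = map (\<lambda>k. (if k = j then 1 else nu_simple n j k) * cs ! (k - 1)) [1..<n + 1]"

text \<open>The \<open>j\<close>-th factor is reproduced up to the scalar \<open>-\<i> c\<^sub>j\<close> because
  \<open>e\<^bsup>\<alpha>\<^sub>j\<^esup> (1 - \<i> c\<^sub>j e\<^bsup>\<alpha>\<^sub>j\<^esup>) = -\<i> c\<^sub>j (1 + \<i> c\<^sub>j e\<^bsup>\<alpha>\<^sub>j\<^esup>)\<close>; the sign \<open>\<nu>(\<alpha>\<^sub>j, \<alpha>\<^sub>k)\<close> is absorbed into \<open>c\<^sub>k\<close>.\<close>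

lemma shift_op_v_elt:
  assumes len: "length cs = n" and j: "j \<in> {1..n}" and c: "cs ! (j - 1) \<in> {1, - 1}"
  shows "shift_op n (simple_root j) (v_elt cs) = pscale (- \<i> * cs ! (j - 1)) (v_elt (flip n j cs))"
proof -
  define c where "c k = cs ! (k - 1)" for k
  define E where "E k a = 1 + single (mod2 (simple_root k)) (\<i> * a)" for k and a :: complex
  have sE: "sign_op n (simple_root j) (E k a) = E k (nu_simple n j k * a)" if "k \<in> {1..n}" for k a
    using nu_cong_right[of "lift2 (mod2 (simple_root k))" "simple_root k" n "simple_root j"] that j
    by (simp add: E_def sign_op_add sign_op_single nu_simple_root mult_ac)
  have cc: "c j * c j = 1" using c by (auto simp: c_def)
  have Ej: "single (mod2 (simple_root j)) 1 * E j (nu_simple n j j * c j) = pscale (- \<i> * c j) (E j (c j))"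
    using cc
    by (simp add: E_def distrib_left mult_single mod2_twice PS.scale_right_distrib pscale_single nu_simple_def
        pscale_one mult_ac)
  have flip: "flip n j cs ! (k - 1) = (if k = j then 1 else nu_simple n j k) * c k" if "k \<in> {1..n}" for k
  proof -
    have "flip n j cs ! (k - 1) = (if 1 + (k - 1) = j then 1 else nu_simple n j (1 + (k - 1))) * cs ! (1 + (k - 1) - 1)"
      unfolding flip_def using that by (subst nth_map_upt) auto
    then show ?thesis using that by (simp add: c_def)
  qed
  have "shift_op n (simple_root j) (v_elt cs) =
      single (mod2 (simple_root j)) 1 * (\<Prod>k=1..n. sign_op n (simple_root j) (E k (c k)))"
    by (simp add: shift_op_def v_elt_def len sign_op_prod E_def c_def)
  also have "\<dots> = single (mod2 (simple_root j)) 1 * (\<Prod>k=1..n. E k (nu_simple n j k * c k))"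
    by (simp add: sE)
  also have "\<dots> = (single (mod2 (simple_root j)) 1 * E j (nu_simple n j j * c j)) *
      (\<Prod>k\<in>{1..n} - {j}. E k (nu_simple n j k * c k))"
    using j by (subst prod.remove[of _ j]) (simp_all add: mult.assoc)
  also have "\<dots> = pscale (- \<i> * c j) (E j (c j) * (\<Prod>k\<in>{1..n} - {j}. E k (nu_simple n j k * c k)))"
    unfolding Ej by (rule pscale_mult_left)
  also have "E j (c j) * (\<Prod>k\<in>{1..n} - {j}. E k (nu_simple n j k * c k)) =
      (\<Prod>k=1..n. E k ((if k = j then 1 else nu_simple n j k) * c k))"
    using j by (subst (2) prod.remove[of _ j]) (auto intro!: prod.cong)
  also have "\<dots> = v_elt (flip n j cs)"
    using flip by (simp add: v_elt_def E_def flip_def[of n j cs] del: nth_map)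
  finally show ?thesis by (simp add: c_def)
qed

text \<open>So the nodes outside \<open>nu_set n\<close> act diagonally on the vectors \<open>v(c\<^sub>1, \<dots>, c\<^sub>n)\<close>, with eigenvalues \<open>-\<i> c\<^sub>j\<close>, while those in
  \<open>nu_set n\<close> change the signs at their neighbours, which lie outside of it.\<close>

lemma flip_id: "length cs = n \<Longrightarrow> j \<notin> nu_set n \<Longrightarrow> flip n j cs = cs"
  by (auto simp: flip_def nu_simple_def intro!: nth_equalityI)

text \<open>The algebra homomorphism \<open>e\<^sup>\<gamma> \<mapsto> 1\<close>.\<close>

definition augment :: "group_alg \<Rightarrow> complex" where
  "augment v = (\<Sum>\<gamma>\<in>keys v. lookup v \<gamma>)"

lemma augment_add: "augment (v + w) = augment v + augment w"
  unfolding augment_def by (rule setsum_keys_plus_distrib) auto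

lemma augment_single: "augment (single \<gamma> c) = c"
  by (simp add: augment_def)

lemma augment_mult: "augment (v * w) = augment v * augment w"
proof (induction v rule: poly_mapping_induct_single)
  case (single \<gamma> c)
  show ?case
    by (induction w rule: poly_mapping_induct_single)
      (simp_all add: mult_single augment_single augment_add distrib_left, simp add: augment_def)
qed (simp_all add: augment_add distrib_right, simp add: augment_def)

text \<open>The augmentation of \<open>v(c\<^sub>1, \<dots>, c\<^sub>n)\<close> is the product of the numbers \<open>1 + \<i> c\<^sub>j\<close>, none of which is \<open>0\<close>.\<close>

lemma v_elt_nonzero:
  assumes "set cs \<subseteq> {1, - 1}"
  shows "v_elt cs \<noteq> 0"
proof -
  have one: "augment 1 = 1" using augment_single[of 0 1] by simp
  have "augment (prod f A) = (\<Prod>a\<in>A. augment (f a))" for f :: "nat \<Rightarrow> group_alg" and A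
    by (induction A rule: infinite_finite_induct) (simp_all add: augment_mult one)
  then have "augment (v_elt cs) = (\<Prod>j=1..length cs. 1 + \<i> * cs ! (j - 1))"
    by (simp add: v_elt_def augment_add one augment_single)
  also have "\<dots> \<noteq> 0"
  proof -
    have "1 + \<i> * cs ! (j - 1) \<noteq> 0" if "j \<in> {1..length cs}" for j
    proof -
      have "cs ! (j - 1) \<in> set cs" using that by (intro nth_mem) auto
      then have "cs ! (j - 1) = 1 \<or> cs ! (j - 1) = - 1" using assms by auto
      then show ?thesis by (auto simp: complex_eq_iff)
    qed
    then show ?thesis by simp
  qed
  finally show ?thesis by (auto simp: augment_def)
qed

subsection \<open>Eigenvectors\<close>

text \<open>Among the nonzero elements of an invariant subspace, one with the shortest expansion in the given
  simultaneous eigenvectors has only one term: if \<open>i\<close> and \<open>i'\<close> occur in \<open>v\<close> with different eigenvalues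
  \<open>\<mu>\<close> and \<open>\<mu>'\<close> of \<open>T\<close>, then \<open>T v - \<mu> v\<close> and \<open>T v - \<mu>' v\<close> are shorter, and one of them is not \<open>0\<close>.\<close>

lemma invariant_subspace_contains_eigenvector:
  fixes T :: "'k \<Rightarrow> group_alg \<Rightarrow> group_alg" and b :: "'i \<Rightarrow> group_alg"
  assumes T_sum: "\<And>k f A. k \<in> K \<Longrightarrow> T k (sum f (A :: 'i set)) = (\<Sum>a\<in>A. T k (f a))"
    and T_scale: "\<And>k c v. k \<in> K \<Longrightarrow> T k (pscale c v) = pscale c (T k v)"
    and N: "PS.subspace N" and TN: "\<And>k v. k \<in> K \<Longrightarrow> v \<in> N \<Longrightarrow> T k v \<in> N"
    and I: "finite I"
    and eig: "\<And>k i. k \<in> K \<Longrightarrow> i \<in> I \<Longrightarrow> T k (b i) = pscale (\<mu> k i) (b i)"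
    and sep: "\<And>i i'. i \<in> I \<Longrightarrow> i' \<in> I \<Longrightarrow> i \<noteq> i' \<Longrightarrow> \<exists>k\<in>K. \<mu> k i \<noteq> \<mu> k i'"
    and v: "(\<Sum>i\<in>I. pscale (a i) (b i)) \<in> N" "(\<Sum>i\<in>I. pscale (a i) (b i)) \<noteq> 0"
  shows "\<exists>i\<in>I. b i \<in> N"
  using I eig sep v
proof (induction "card I" arbitrary: I a rule: less_induct)
  case less
  let ?v = "\<Sum>i\<in>I. pscale (a i) (b i)"
  show ?case
  proof (cases "\<exists>i\<in>I. \<exists>i'\<in>I. i \<noteq> i'")
    case True
    then obtain i i' k where i: "i \<in> I" "i' \<in> I" "k \<in> K" "\<mu> k i \<noteq> \<mu> k i'"
      using less.prems(3) by metis
    have red: "T k ?v - pscale (\<mu> k l) ?v = (\<Sum>m\<in>I - {l}. pscale (a m * (\<mu> k m - \<mu> k l)) (b m))"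
      if "l \<in> I" for l
    proof -
      have "T k ?v - pscale (\<mu> k l) ?v = (\<Sum>m\<in>I. pscale (a m * (\<mu> k m - \<mu> k l)) (b m))"
        using i(3) by (simp add: T_sum T_scale less.prems(2) PS.scale_sum_right PS.scale_left_diff_distrib
            right_diff_distrib sum_subtractf mult.commute)
      also have "\<dots> = (\<Sum>m\<in>I - {l}. pscale (a m * (\<mu> k m - \<mu> k l)) (b m))"
        using less.prems(1) that by (intro sum.mono_neutral_right) auto
      finally show ?thesis .
    qed
    have inN: "T k ?v - pscale (\<mu> k l) ?v \<in> N" for l
      using N TN[OF i(3)] less.prems(4) by (intro PS.subspace_diff PS.subspace_scale)
    have "pscale (\<mu> k i - \<mu> k i') ?v \<noteq> 0" using i(4) less.prems(5) by simp
    then have "T k ?v - pscale (\<mu> k i) ?v \<noteq> 0 \<or> T k ?v - pscale (\<mu> k i') ?v \<noteq> 0"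
      by (auto simp: PS.scale_left_diff_distrib)
    then obtain l where l: "l \<in> I" "T k ?v - pscale (\<mu> k l) ?v \<noteq> 0" using i by blast
    have "card (I - {l}) < card I" using less.prems(1) l(1) by (rule card_Diff1_less)
    then have "\<exists>m\<in>I - {l}. b m \<in> N"
      using l red[OF l(1)] inN[of l] less.prems(1-3)
      by (intro less.hyps[of _ "\<lambda>m. a m * (\<mu> k m - \<mu> k l)"]) auto
    then show ?thesis by blast
  next
    case False
    have "I \<noteq> {}" using less.prems(5) by auto
    then obtain i where i: "I = {i}" using False by blast
    then have "a i \<noteq> 0" "pscale (a i) (b i) \<in> N" using less.prems(4,5) by auto
    then have "pscale (1 / a i) (pscale (a i) (b i)) \<in> N" using N PS.subspace_scale by blast
    then show ?thesis using i \<open>a i \<noteq> 0\<close> by simp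
  qed
qed

lemma span_image_expansion:
  fixes b :: "'i \<Rightarrow> group_alg"
  assumes "v \<in> PS.span (b ` I)" and I: "finite I"
  shows "\<exists>a. v = (\<Sum>i\<in>I. pscale (a i) (b i))"
proof -
  obtain J where J: "J \<subseteq> I" "inj_on b J" "b ` I = b ` J"
    using subset_image_inj[of "b ` I" b I] by blast
  have "finite (b ` J)" using I J(1) finite_subset by blast
  then obtain u where "v = (\<Sum>x\<in>b ` J. pscale (u x) x)"
    using assms(1) unfolding J(3) by (auto simp: PS.span_finite)
  also have "\<dots> = (\<Sum>i\<in>J. pscale (u (b i)) (b i))"
    by (simp add: sum.reindex[OF J(2)])
  also have "\<dots> = (\<Sum>i\<in>I. pscale (if i \<in> J then u (b i) else 0) (b i))"
    using I J(1) by (intro sum.mono_neutral_cong_left) auto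
  finally show ?thesis by (rule exI[of _ "\<lambda>i. if i \<in> J then u (b i) else 0"])
qed

section \<open>Submodules of the Fock space\<close>

lemma lookup_tensor: "lookup (tensor v f) \<gamma> = pscale (lookup v \<gamma>) f"
  by (simp add: tensor_def Poly_Mapping.map.rep_eq when_def)

lemma tensor_fock_space: "f \<in> polys n \<Longrightarrow> tensor v f \<in> fock_space n"
  by (auto simp: fock_space_def lookup_tensor)

lemma tensor_pscale: "tensor v (pscale c f) = fock_scale c (tensor v f)"
  "tensor (pscale c v) f = fock_scale c (tensor v f)"
  by (rule poly_mapping_eqI; simp add: lookup_tensor lookup_fock_scale lookup_pscale mult_ac)+

lemma tensor_add: "tensor v (f + g) = tensor v f + tensor v g" "tensor (v + w) f = tensor v f + tensor w f"
  by (rule poly_mapping_eqI; simp add: lookup_tensor lookup_add PS.scale_right_distrib PS.scale_left_distrib)+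

lemma tensor_zero [simp]: "tensor 0 f = 0" "tensor v 0 = 0"
  by (rule poly_mapping_eqI; simp add: lookup_tensor)+

lemma Gamma_coeff_tensor:
  "f \<in> polys n \<Longrightarrow> Gamma_coeff n S \<alpha> i (tensor v f) =
    tensor (shift_op n \<alpha> v) (pscale (1 / 2) (vertex_coeff n S \<alpha> (- i) f))"
  by (rule poly_mapping_eqI)
    (simp add: lookup_Gamma_coeff lookup_tensor lookup_shift_op vertex_coeff_pscale)

lemma heisenberg_tensor: "heisenberg n S h i (tensor v f) = tensor v (heis_poly n S h i f)"
  by (rule poly_mapping_eqI) (simp add: lookup_heisenberg lookup_tensor heis_poly_pscale)

lemma energy_tensor: "f \<in> polys n \<Longrightarrow> energy n (tensor v f) = tensor v (euler n f)"
  by (rule poly_mapping_eqI) (simp add: lookup_energy lookup_tensor euler_pscale)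

lemma rep_loops_zero_right [simp]: "rep_loops n S u 0 = 0"
  by (simp add: rep_loops_def)

lemma tensor_space_subset: "tensor_space M (polys n) \<subseteq> fock_space n"
proof -
  have "FS.subspace (fock_space n)" by (rule FS.subspaceI) auto
  then show ?thesis
    unfolding tensor_space_def by (intro FS.span_minimal) (auto intro: tensor_fock_space)
qed

lemma tensor_in_tensor_space: "v \<in> M \<Longrightarrow> f \<in> P \<Longrightarrow> tensor v f \<in> tensor_space M P"
  unfolding tensor_space_def by (intro FS.span_base) blast

lemma subspace_tensor_space: "FS.subspace (tensor_space M P)"
  by (simp add: tensor_space_def)

text \<open>On a pure tensor, \<open>\<Gamma>\<^sub>\<alpha>\<close> acts through the shift operator of \<open>\<alpha>\<close> on the first factor, and the Heisenberg and
  energy operators act on the second factor alone.\<close>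

lemma tensor_space_submodule:
  assumes M: "\<And>\<alpha> v. \<alpha> \<in> roots n \<Longrightarrow> v \<in> M \<Longrightarrow> shift_op n \<alpha> v \<in> M"
  shows "lie_submodule (affine_alg n) fock_scale (rep n S) (tensor_space M (polys n))"
  unfolding lie_submodule_def
proof (intro conjI ballI subspace_tensor_space)
  let ?W = "tensor_space M (polys n)"
  note sub = subspace_tensor_space[of M "polys n"]
  fix x w assume x: "x \<in> affine_alg n" and w: "w \<in> ?W"
  obtain u k d where xu: "x = (u, k, d)" by (cases x)
  have loop: "rep_loop n S i (lookup u i) (tensor v f) \<in> ?W" if v: "v \<in> M" and f: "f \<in> polys n" for i v f
  proof -
    obtain h y where hy: "lookup u i = (h, y)" by (cases "lookup u i")
    moreover have "lookup u i \<in> lie_part n i" using x by (auto simp: xu affine_alg_def)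
    ultimately have "(h, y) \<in> lie_part n i" by simp
    note y = lie_partD(2)[OF this]
    show ?thesis
      unfolding hy rep_loop_def using y v f
      by (auto simp: heisenberg_tensor Gamma_coeff_tensor
          intro!: FS.subspace_add[OF sub] FS.subspace_sum[OF sub] FS.subspace_scale[OF sub] tensor_in_tensor_space M)
  qed
  from w have "w \<in> FS.span {tensor v f | v f. v \<in> M \<and> f \<in> polys n}"
    by (simp add: tensor_space_def)
  then have "w \<in> fock_space n \<and> rep n S x w \<in> ?W"
  proof (induction rule: FS.span_induct)
    show "FS.subspace {w. w \<in> fock_space n \<and> rep n S x w \<in> ?W}"
    proof (rule FS.subspaceI)
      show "0 \<in> {w. w \<in> fock_space n \<and> rep n S x w \<in> ?W}"
        by (simp add: xu rep_eq FS.subspace_0[OF sub])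
    next
      fix v w assume *: "v \<in> {w. w \<in> fock_space n \<and> rep n S x w \<in> ?W}" "w \<in> {w. w \<in> fock_space n \<and> rep n S x w \<in> ?W}"
      then have "rep n S x (v + w) = rep n S x v + rep n S x w"
        by (simp add: xu rep_eq rep_loops_add_right energy_add FS.scale_right_distrib)
      then show "v + w \<in> {w. w \<in> fock_space n \<and> rep n S x w \<in> ?W}"
        using * FS.subspace_add[OF sub] by auto
    next
      fix c w assume *: "w \<in> {w. w \<in> fock_space n \<and> rep n S x w \<in> ?W}"
      then have "rep n S x (fock_scale c w) = fock_scale c (rep n S x w)"
        by (simp add: xu rep_eq rep_loops_scale_right energy_scale FS.scale_right_distrib
            FS.scale_right_diff_distrib mult.commute)
      then show "fock_scale c w \<in> {w. w \<in> fock_space n \<and> rep n S x w \<in> ?W}"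
        using * FS.subspace_scale[OF sub] by auto
    qed
  next
    fix w assume "w \<in> {tensor v f | v f. v \<in> M \<and> f \<in> polys n}"
    then obtain v f where vf: "w = tensor v f" "v \<in> M" "f \<in> polys n" by blast
    have "rep n S x w \<in> ?W"
      unfolding xu rep_eq rep_loops_def vf(1)
      using vf loop
      by (auto simp: energy_tensor intro!: FS.subspace_diff[OF sub] FS.subspace_add[OF sub] FS.subspace_sum[OF sub]
          FS.subspace_scale[OF sub] tensor_in_tensor_space)
    then show "w \<in> fock_space n \<and> rep n S x w \<in> ?W" using vf tensor_fock_space by blast
  qed
  then show "rep n S x w \<in> ?W" by blast
qed

subsection \<open>Irreducibility\<close>

lemma loop_elt_affine_alg: "X \<in> lie_part n i \<Longrightarrow> loop_elt X i \<in> affine_alg n"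
proof -
  have "Poly_Mapping.map_key uminus 0 = (0 :: lattice \<Rightarrow>\<^sub>0 complex)"
    by (rule poly_mapping_eqI) (simp add: map_key.rep_eq inj_on_def)
  then have "0 \<in> lie_part n j" for j
    by (simp add: lie_part_def lie_alg_def sigma_def zero_prod_def)
  then show "X \<in> lie_part n i \<Longrightarrow> ?thesis"
    by (auto simp: affine_alg_def loop_elt_def lookup_single when_def)
qed

lemma H_elt_lie_part: "keys h \<subseteq> {1..n} \<Longrightarrow> odd i \<Longrightarrow> H_elt h \<in> lie_part n i"
proof -
  have "Poly_Mapping.map_key uminus 0 = (0 :: lattice \<Rightarrow>\<^sub>0 complex)"
    by (rule poly_mapping_eqI) (simp add: map_key.rep_eq inj_on_def)
  then show "keys h \<subseteq> {1..n} \<Longrightarrow> odd i \<Longrightarrow> ?thesis"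
    by (simp add: lie_part_def lie_alg_def sigma_def H_elt_def uminus_prod_def)
qed

lemma X_elt_lie_part:
  assumes "\<alpha> \<in> roots n"
  shows "X_elt \<alpha> + X_elt (- \<alpha>) \<in> lie_part n 0"
proof -
  have "keys (single \<alpha> 1 + single (- \<alpha>) (1::complex)) \<subseteq> roots n"
    using keys_add[of "single \<alpha> 1" "single (- \<alpha>) (1::complex)"] assms roots_uminus[OF assms] by auto
  moreover have "Poly_Mapping.map_key uminus (single \<alpha> 1 + single (- \<alpha>) 1) = single \<alpha> 1 + single (- \<alpha>) (1::complex)"
    by (rule poly_mapping_eqI) (auto simp: map_key.rep_eq inj_on_def lookup_add lookup_single when_def)
  ultimately show ?thesis
    by (simp add: lie_part_def lie_alg_def sigma_def X_elt_def)
qed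

definition total_degree :: "(nat \<times> nat \<Rightarrow>\<^sub>0 nat) \<Rightarrow> nat" where
  "total_degree m = (\<Sum>e\<in>keys m. lookup m e)"

lemma total_degree_add_single: "total_degree (m + single e 1) = total_degree m + 1"
  unfolding total_degree_def by (subst setsum_keys_plus_distrib) auto

definition constant_part :: "fock \<Rightarrow> group_alg" where
  "constant_part w = Poly_Mapping.map (\<lambda>f. lookup f 0) w"

lemma lookup_constant_part: "lookup (constant_part w) \<gamma> = lookup (lookup w \<gamma>) 0"
  by (simp add: constant_part_def Poly_Mapping.map.rep_eq when_def)

text \<open>On pure tensors the constant part is a multiple of the first factor.\<close>

lemma constant_part_tensor_space:
  assumes M: "PS.subspace M" and w: "w \<in> tensor_space M P"
  shows "constant_part w \<in> M"
proof -
  from w have "w \<in> FS.span {tensor v f | v f. v \<in> M \<and> f \<in> P}"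
    by (simp add: tensor_space_def)
  then show ?thesis
  proof (induction rule: FS.span_induct)
    have "constant_part 0 = 0" "constant_part (v + w) = constant_part v + constant_part w"
      "constant_part (fock_scale c v) = pscale c (constant_part v)" for v w c
      by (rule poly_mapping_eqI; simp add: lookup_constant_part lookup_add lookup_fock_scale lookup_pscale)+
    then show "FS.subspace {w. constant_part w \<in> M}"
      by (intro FS.subspaceI) (simp_all add: PS.subspace_0[OF M] PS.subspace_add[OF M] PS.subspace_scale[OF M])
  next
    fix w assume "w \<in> {tensor v f | v f. v \<in> M \<and> f \<in> P}"
    then obtain v f where vf: "w = tensor v f" "v \<in> M" by blast
    have "constant_part w = pscale (lookup f 0) v"
      by (rule poly_mapping_eqI) (simp add: vf lookup_constant_part lookup_tensor lookup_pscale)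
    then show "constant_part w \<in> M" using vf PS.subspace_scale[OF M] by simp
  qed
qed

lemma heis_poly_basis:
  assumes S: "orthonormal_basis n S" and j: "j \<in> {1..n}"
  shows "heis_poly n S (S j) i f = pscale (1 / complex_of_real (sqrt 2)) (a_coeff j i f)"
proof -
  have "(\<Sum>k=1..n. pscale (bform n (S j) (S k)) (a_coeff k i f)) = (\<Sum>k=1..n. if k = j then a_coeff k i f else 0)"
    using S j by (intro sum.cong refl) (auto simp: orthonormal_basis_def)
  then show ?thesis using j by (simp add: heis_poly_def)
qed

text \<open>The annihilation operators take a nonzero element of a submodule to a nonzero element of degree \<open>0\<close>.\<close>

lemma submodule_contains_vacuum:
  assumes S: "orthonormal_basis n S" and M: "PS.subspace M"
    and U: "U \<subseteq> tensor_space M (polys n)"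
    and ann: "\<And>j i w. j \<in> {1..n} \<Longrightarrow> odd i \<Longrightarrow> w \<in> U \<Longrightarrow> heisenberg n S (S j) i w \<in> U"
    and u: "u \<in> U" "u \<noteq> 0"
  shows "\<exists>v\<in>M. v \<noteq> 0 \<and> tensor v 1 \<in> U"
proof -
  (* Induction on a bound N for the total degree of u. If all derivatives of u vanish, u is constant. *)
  have "\<exists>v\<in>M. v \<noteq> 0 \<and> tensor v 1 \<in> U"
    if "u \<in> U" "u \<noteq> 0" "\<And>\<gamma> m. lookup (lookup u \<gamma>) m \<noteq> 0 \<Longrightarrow> total_degree m \<le> N" for N u
    using that
  proof (induction N arbitrary: u rule: less_induct)
    case (less N)
    have uf: "lookup u \<gamma> \<in> polys n" for \<gamma>
      using less.prems(1) U tensor_space_subset fock_spaceD by blast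
    have lk: "lookup (heisenberg n S (S j) (int r) u) \<gamma> = pscale (1 / complex_of_real (sqrt 2)) (x_deriv j r (lookup u \<gamma>))"
      if "j \<in> {1..n}" "odd r" for j r \<gamma>
      using that odd_pos[OF that(2)] by (simp add: lookup_heisenberg heis_poly_basis[OF S] a_coeff_def)
    show ?case
    proof (cases "\<exists>j\<in>{1..n}. \<exists>r. odd r \<and> heisenberg n S (S j) (int r) u \<noteq> 0")
      case True
      then obtain j r where jr: "j \<in> {1..n}" "odd r" and ne: "heisenberg n S (S j) (int r) u \<noteq> 0" by blast
      have deg: "total_degree m + 1 \<le> N" if "lookup (lookup (heisenberg n S (S j) (int r) u) \<gamma>) m \<noteq> 0" for \<gamma> m
      proof -
        have "lookup (lookup u \<gamma>) (m + single (j, r) 1) \<noteq> 0"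
          using that by (simp add: lk[OF jr] lookup_pscale lookup_x_deriv_eq_0_iff)
        from less.prems(3)[OF this] show ?thesis by (simp add: total_degree_add_single)
      qed
      have "N > 0"
      proof (rule ccontr)
        assume "\<not> N > 0"
        then have "lookup (lookup (heisenberg n S (S j) (int r) u) \<gamma>) m = 0" for \<gamma> m
          using deg[of \<gamma> m] by auto
        then have "heisenberg n S (S j) (int r) u = 0"
          by (intro poly_mapping_eqI) simp
        with ne show False ..
      qed
      then show ?thesis
        using less.IH[of "N - 1" "heisenberg n S (S j) (int r) u"] deg ann[OF jr(1), of "int r" u] jr ne less.prems(1)
        by fastforce
    next
      case False
      have "x_deriv j r (lookup u \<gamma>) = 0" if "j \<in> {1..n}" "odd r" for j r \<gamma>
      proof -
        have "heisenberg n S (S j) (int r) u = 0" using False that by blast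
        then show ?thesis using lk[OF that, of \<gamma>] by simp
      qed
      then have const: "lookup u \<gamma> = pscale (lookup (lookup u \<gamma>) 0) 1" for \<gamma>
        by (intro polys_constant[OF uf])
      have "tensor (constant_part u) 1 = u"
      proof (rule poly_mapping_eqI)
        show "lookup (tensor (constant_part u) 1) \<gamma> = lookup u \<gamma>" for \<gamma>
          unfolding lookup_tensor lookup_constant_part using const[of \<gamma>] by (rule sym)
      qed
      moreover from this have "constant_part u \<noteq> 0" using less.prems(2) by auto
      moreover have "constant_part u \<in> M" using constant_part_tensor_space[OF M] less.prems(1) U by blast
      ultimately show ?thesis using less.prems(1) by auto
    qed
  qed
  moreover have "\<exists>N. \<forall>\<gamma> m. lookup (lookup u \<gamma>) m \<noteq> 0 \<longrightarrow> total_degree m \<le> N"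
  proof -
    have "finite (total_degree ` (\<Union>\<gamma>\<in>keys u. keys (lookup u \<gamma>)))" by simp
    then obtain N where N: "\<forall>d\<in>total_degree ` (\<Union>\<gamma>\<in>keys u. keys (lookup u \<gamma>)). d \<le> N"
      unfolding finite_nat_set_iff_bounded_le by blast
    have "total_degree m \<le> N" if "lookup (lookup u \<gamma>) m \<noteq> 0" for \<gamma> m
    proof -
      have "\<gamma> \<in> keys u" "m \<in> keys (lookup u \<gamma>)" using that by (auto simp: in_keys_iff)
      then show ?thesis using N by blast
    qed
    then show ?thesis by blast
  qed
  ultimately show ?thesis using u by blast
qed

text \<open>A nonzero submodule \<open>U\<close> contains some \<open>v \<otimes> 1\<close>. The space \<open>N\<close> of all such \<open>v\<close> is stable under the shift operators,
  because \<open>V\<^sub>\<alpha>(0) 1 = 1\<close>, so it is everything, and the creation operators generate the tensor space from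
  \<open>M \<otimes> 1\<close>.\<close>

theorem tensor_space_irreducible:
  assumes n: "n \<in> {6, 7, 8}" and S: "orthonormal_basis n S"
    and M: "PS.subspace M" "M \<noteq> {0}" "\<And>\<alpha> v. \<alpha> \<in> roots n \<Longrightarrow> v \<in> M \<Longrightarrow> shift_op n \<alpha> v \<in> M"
    and irr: "\<And>N. PS.subspace N \<Longrightarrow> N \<subseteq> M \<Longrightarrow> N \<noteq> {0} \<Longrightarrow>
      (\<And>j v. j \<in> {1..n} \<Longrightarrow> v \<in> N \<Longrightarrow> shift_op n (simple_root j) v \<in> N) \<Longrightarrow> M \<subseteq> N"
  shows "irreducible_level_one n S (tensor_space M (polys n))"
  unfolding irreducible_level_one_def irreducible_lie_module_def
proof (intro conjI ballI allI impI rep_K)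
  let ?W = "tensor_space M (polys n)"
  show "lie_module (affine_alg n) affine_scale (affine_bracket n) fock_scale (rep n S) ?W"
    by (rule rep_lie_module[OF n S tensor_space_subset tensor_space_submodule[OF M(3)]])
  obtain v where v: "v \<in> M" "v \<noteq> 0" using M(1,2) PS.subspace_0 by blast
  then obtain \<gamma> where "lookup v \<gamma> \<noteq> 0" by (metis lookup_zero poly_mapping_eqI)
  then have "lookup (lookup (tensor v 1) \<gamma>) 0 \<noteq> 0" by (simp add: lookup_tensor lookup_pscale)
  then have "tensor v 1 \<noteq> 0" by auto
  moreover have "tensor v 1 \<in> ?W" using v by (intro tensor_in_tensor_space) auto
  ultimately show "?W \<noteq> {0}" by blast
next
  let ?W = "tensor_space M (polys n)"
  fix U assume "U \<subseteq> ?W \<and> lie_submodule (affine_alg n) fock_scale (rep n S) U"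
  then have U: "U \<subseteq> ?W" "FS.subspace U" "\<And>x w. x \<in> affine_alg n \<Longrightarrow> w \<in> U \<Longrightarrow> rep n S x w \<in> U"
    by (auto simp: lie_submodule_def)
  have heis: "heisenberg n S (S j) i w \<in> U" if "j \<in> {1..n}" "odd i" "w \<in> U" for j i w
  proof -
    have "keys (S j) \<subseteq> {1..n}" using S that(1) by (auto simp: orthonormal_basis_def)
    from loop_elt_affine_alg[OF H_elt_lie_part[OF this that(2)]] show ?thesis
      using U(3) that(3) rep_H by metis
  qed
  have Gamma: "Gamma_coeff n S \<alpha> 0 w \<in> U" if "\<alpha> \<in> roots n" "w \<in> U" for \<alpha> w
    using U(3)[OF loop_elt_affine_alg[OF X_elt_lie_part[OF that(1)]] that(2)] rep_X[OF that(1), of S 0] by simp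
  show "U = {0} \<or> U = ?W"
  proof (cases "U = {0}")
    case False
    define N where "N = {v \<in> M. tensor v 1 \<in> U}"
    obtain u where "u \<in> U" "u \<noteq> 0" using False FS.subspace_0[OF U(2)] by blast
    then obtain v where "v \<in> N" "v \<noteq> 0"
      using submodule_contains_vacuum[OF S M(1) U(1) heis] by (auto simp: N_def)
    moreover have "PS.subspace N"
      by (rule PS.subspaceI)
        (auto simp: N_def tensor_add tensor_pscale PS.subspace_0[OF M(1)] FS.subspace_0[OF U(2)]
          intro: PS.subspace_add[OF M(1)] PS.subspace_scale[OF M(1)] FS.subspace_add[OF U(2)] FS.subspace_scale[OF U(2)])
    moreover have "shift_op n (simple_root j) v \<in> N" if j: "j \<in> {1..n}" and v: "v \<in> N" for j v
    proof -
      have r: "simple_root j \<in> roots n" using j by (rule roots.simple)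
      have "fock_scale (1 / 2) (tensor (shift_op n (simple_root j) v) 1) \<in> U"
        using Gamma[OF r, of "tensor v 1"] v
        by (simp add: N_def Gamma_coeff_tensor vertex_coeff_one_0 tensor_pscale)
      (* The factor 2 compensates the factor 1/2 in the vertex operator. *)
      from FS.subspace_scale[OF U(2) this, of 2] show ?thesis
        using M(3)[OF r] v by (simp add: N_def)
    qed
    ultimately have MN: "M \<subseteq> N" by (intro irr) (auto simp: N_def)
    have "tensor v f \<in> U" if v: "v \<in> M" and f: "f \<in> polys n" for v f
      using f
    proof (induction rule: polys_induct)
      case one
      then show ?case using v MN by (auto simp: N_def)
    next
      case (x_var j r f)
      have r: "r > 0" using x_var odd_pos by blast
      have "heisenberg n S (S j) (- int r) (tensor v f) \<in> U" using x_var by (intro heis) auto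
      then have "fock_scale (of_nat r / complex_of_real (sqrt 2)) (tensor v (x_var j r * f)) \<in> U"
        using x_var r
        by (simp add: heisenberg_tensor heis_poly_basis[OF S] a_coeff_def tensor_pscale)
      from FS.subspace_scale[OF U(2) this, of "complex_of_real (sqrt 2) / of_nat r"] show ?case
        using r by simp
    qed (auto simp: tensor_add tensor_pscale intro: FS.subspace_add[OF U(2)] FS.subspace_scale[OF U(2)])
    then have "?W \<subseteq> U"
      unfolding tensor_space_def by (intro FS.span_minimal[OF _ U(2)]) auto
    then show ?thesis using U(1) by blast
  qed simp
qed

subsection \<open>Spans of the vectors \<open>v(c\<^sub>1, \<dots>, c\<^sub>n)\<close>\<close>

text \<open>The shift operators are multiplicative in \<open>\<alpha>\<close> up to sign, so stability for the simple roots extends to the whole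
  root lattice.\<close>

lemma shift_op_invariant:
  assumes M: "PS.subspace M" and simple: "\<And>j v. j \<in> {1..n} \<Longrightarrow> v \<in> M \<Longrightarrow> shift_op n (simple_root j) v \<in> M"
    and \<alpha>: "\<alpha> \<in> roots n" and v: "v \<in> M"
  shows "shift_op n \<alpha> v \<in> M"
proof -
  define L where "L = {\<alpha>. \<forall>v\<in>M. shift_op n \<alpha> v \<in> M}"
  have L_add: "\<alpha> + \<beta> \<in> L" if "\<alpha> \<in> L" "\<beta> \<in> L" for \<alpha> \<beta>
    using that by (auto simp: L_def shift_op_plus intro: PS.subspace_scale[OF M])
  have L_uminus: "- \<alpha> \<in> L" if "\<alpha> \<in> L" for \<alpha>
    using that by (simp add: L_def shift_op_uminus)
  have mod0: "mod2 0 = 0" by (rule poly_mapping_eqI) simp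
  have "shift_op n 0 v = v" for v
    by (rule poly_mapping_eqI) (simp add: lookup_shift_op mod0)
  then have L_0: "0 \<in> L" by (simp add: L_def)
  have L_nat: "single j (int k) \<in> L" if "j \<in> {1..n}" for j k
  proof (induction k)
    case (Suc k)
    have "single j (int (Suc k)) = simple_root j + single j (int k)"
      by (simp add: simple_root_def flip: single_add)
    then show ?case using Suc L_add[of "simple_root j"] simple[OF that] by (simp add: L_def)
  qed (simp add: L_0)
  have L_int: "single j m \<in> L" if "j \<in> {1..n}" for j m
  proof (cases "m \<ge> 0")
    case True
    then show ?thesis using L_nat[OF that, of "nat m"] by simp
  next
    case False
    then show ?thesis using L_uminus[OF L_nat[OF that, of "nat (- m)"]] by (simp add: single_uminus)
  qed
  from \<alpha> have "\<alpha> \<in> L"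
  proof (induction rule: roots.induct)
    case (simple j)
    then show ?case using assms(2) by (simp add: L_def)
  next
    case (reflect \<beta> j)
    then show ?case using L_add[OF reflect.IH L_uminus[OF L_int[OF reflect(2)]]] by simp
  qed
  then show ?thesis using v by (simp add: L_def)
qed

text \<open>The signs at the nodes outside \<open>nu_set n\<close> separate the vectors, so an invariant subspace contains one of them, and
  the sign changes induced by the nodes in it lead from it to all others.\<close>

theorem span_v_elt_irreducible:
  assumes n: "n \<in> {6, 7, 8}" and S: "orthonormal_basis n S"
    and I: "finite I" "I \<noteq> {}" "\<And>cs. cs \<in> I \<Longrightarrow> length cs = n" "\<And>cs. cs \<in> I \<Longrightarrow> set cs \<subseteq> {1, - 1}"
    and flip: "\<And>cs j. cs \<in> I \<Longrightarrow> j \<in> {1..n} \<Longrightarrow> flip n j cs \<in> I"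
    and sep: "\<And>cs cs'. cs \<in> I \<Longrightarrow> cs' \<in> I \<Longrightarrow> (\<And>j. j \<in> {1..n} - nu_set n \<Longrightarrow> cs ! (j - 1) = cs' ! (j - 1)) \<Longrightarrow> cs = cs'"
    and trans: "\<And>Q cs cs'. cs \<in> I \<Longrightarrow> cs' \<in> I \<Longrightarrow> Q cs \<Longrightarrow>
      (\<And>cs j. cs \<in> I \<Longrightarrow> j \<in> {1..n} \<Longrightarrow> Q cs \<Longrightarrow> Q (flip n j cs)) \<Longrightarrow> Q cs'"
  shows "irreducible_level_one n S (tensor_space (lin_span (v_elt ` I)) (polys n))"
proof (rule tensor_space_irreducible[OF n S])
  let ?M = "lin_span (v_elt ` I)"
  show "PS.subspace ?M" by simp
  have entry: "cs ! (j - 1) \<in> {1, - 1}" if "cs \<in> I" "j \<in> {1..n}" for cs j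
  proof -
    have "cs ! (j - 1) \<in> set cs" using that I(3)[OF that(1)] by (intro nth_mem) auto
    then show ?thesis using I(4)[OF that(1)] by blast
  qed
  have shift: "shift_op n (simple_root j) (v_elt cs) = pscale (- \<i> * cs ! (j - 1)) (v_elt (flip n j cs))"
    if "cs \<in> I" "j \<in> {1..n}" for cs j
    using shift_op_v_elt[OF I(3) _ entry] that by blast
  obtain cs where "cs \<in> I" using I(2) by blast
  then have "v_elt cs \<in> ?M" "v_elt cs \<noteq> 0"
    using v_elt_nonzero[OF I(4)] by (auto intro: PS.span_base)
  then show "?M \<noteq> {0}" by blast
  have simple: "shift_op n (simple_root j) v \<in> ?M" if j: "j \<in> {1..n}" and v: "v \<in> ?M" for j v
    using v
  proof (induction rule: PS.span_induct)
    show "PS.subspace {v. shift_op n (simple_root j) v \<in> ?M}"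
      by (rule PS.subspaceI) (auto simp: shift_op_add shift_op_pscale PS.span_zero intro: PS.span_add PS.span_scale)
  next
    fix v assume "v \<in> v_elt ` I"
    then obtain cs where cs: "cs \<in> I" "v = v_elt cs" by blast
    have "v_elt (flip n j cs) \<in> ?M" using flip[OF cs(1) j] by (intro PS.span_base imageI)
    then show "shift_op n (simple_root j) v \<in> ?M"
      unfolding cs(2) shift[OF cs(1) j] by (rule PS.span_scale)
  qed
  show "shift_op n \<alpha> v \<in> ?M" if "\<alpha> \<in> roots n" "v \<in> ?M" for \<alpha> v
    using shift_op_invariant[OF _ simple that] by simp
  fix N assume N: "PS.subspace N" "N \<subseteq> ?M" "N \<noteq> {0}"
    and inv: "\<And>j v. j \<in> {1..n} \<Longrightarrow> v \<in> N \<Longrightarrow> shift_op n (simple_root j) v \<in> N"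
  obtain v where v: "v \<in> N" "v \<noteq> 0" using N(1,3) PS.subspace_0 by blast
  then obtain a where a: "v = (\<Sum>cs\<in>I. pscale (a cs) (v_elt cs))"
    using span_image_expansion[OF _ I(1)] N(2) by blast
  have "\<exists>cs\<in>I. v_elt cs \<in> N"
  proof (rule invariant_subspace_contains_eigenvector[where T = "\<lambda>j. shift_op n (simple_root j)"
        and K = "{1..n} - nu_set n" and \<mu> = "\<lambda>j cs. - \<i> * cs ! (j - 1)" and a = a])
    fix cs cs' assume "cs \<in> I" "cs' \<in> I" "cs \<noteq> cs'"
    then show "\<exists>j\<in>{1..n} - nu_set n. - \<i> * cs ! (j - 1) \<noteq> - \<i> * cs' ! (j - 1)"
      using sep[of cs cs'] by (metis mult_cancel_left neg_equal_0_iff_equal complex_i_not_zero)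
  next
    fix j cs assume "j \<in> {1..n} - nu_set n" "cs \<in> I"
    then show "shift_op n (simple_root j) (v_elt cs) = pscale (- \<i> * cs ! (j - 1)) (v_elt cs)"
      using shift[of cs j] flip_id[OF I(3), of cs j] by simp
  qed (use N(1) inv I(1) v a in \<open>auto simp: shift_op_sum shift_op_pscale\<close>)
  then obtain cs where cs: "cs \<in> I" "v_elt cs \<in> N" by blast
  have "v_elt cs' \<in> N" if cs': "cs' \<in> I" for cs'
  proof (rule trans[of cs cs' "\<lambda>cs. v_elt cs \<in> N", OF cs(1) cs' cs(2)])
    fix cs j assume *: "cs \<in> I" "j \<in> {1..n}" "v_elt cs \<in> N"
    define c where "c = - \<i> * cs ! (j - 1)"
    have "c \<noteq> 0" using entry[OF *(1,2)] by (auto simp: c_def)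
    have "pscale c (v_elt (flip n j cs)) \<in> N"
      using inv[OF *(2,3)] shift[OF *(1,2)] by (simp only: c_def)
    from PS.subspace_scale[OF N(1) this, of "1 / c"] show "v_elt (flip n j cs) \<in> N"
      using \<open>c \<noteq> 0\<close> by simp
  qed
  then show "?M \<subseteq> N" by (intro PS.span_minimal[OF _ N(1)]) auto
qed

section \<open>The modules of type \<open>E\<^sub>6\<close>, \<open>E\<^sub>7\<close>, \<open>E\<^sub>8\<close>\<close>

lemma flip_E6:
  "flip 6 1 [c1, b2, c3, b4, c5, b6] = [c1, - b2, c3, b4, c5, b6]"
  "flip 6 3 [c1, b2, c3, b4, c5, b6] = [c1, - b2, c3, - b4, c5, - b6]"
  "flip 6 5 [c1, b2, c3, b4, c5, b6] = [c1, b2, c3, - b4, c5, b6]"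
  by (simp_all add: flip_def nu_simple_def joined_def branch_node_def nu_set_def upt_rec doubleton_eq_iff)

lemma flip_E7:
  "flip 7 1 [c1, b2, c3, b4, c5, b6, b7] = [c1, - b2, c3, b4, c5, b6, b7]"
  "flip 7 3 [c1, b2, c3, b4, c5, b6, b7] = [c1, - b2, c3, - b4, c5, b6, - b7]"
  "flip 7 5 [c1, b2, c3, b4, c5, b6, b7] = [c1, b2, c3, - b4, c5, - b6, b7]"
  by (simp_all add: flip_def nu_simple_def joined_def branch_node_def nu_set_def upt_rec doubleton_eq_iff)

lemma flip_E8:
  "flip 8 1 [c1, b2, c3, b4, c5, b6, c7, b8] = [c1, - b2, c3, b4, c5, b6, c7, b8]"
  "flip 8 3 [c1, b2, c3, b4, c5, b6, c7, b8] = [c1, - b2, c3, - b4, c5, b6, c7, b8]"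
  "flip 8 5 [c1, b2, c3, b4, c5, b6, c7, b8] = [c1, b2, c3, - b4, c5, - b6, c7, - b8]"
  "flip 8 7 [c1, b2, c3, b4, c5, b6, c7, b8] = [c1, b2, c3, b4, c5, - b6, c7, b8]"
  by (simp_all add: flip_def nu_simple_def joined_def branch_node_def nu_set_def upt_rec doubleton_eq_iff)

lemma finite_sign_lists: "I \<subseteq> {cs. set cs \<subseteq> {1, - 1 :: complex} \<and> length cs = n} \<Longrightarrow> finite I"
  by (rule finite_subset[OF _ finite_lists_length_eq]) auto

definition sgns :: "complex set" where "sgns = {1, - 1}"

lemma sgns_iff [simp]: "1 \<in> sgns" "- b \<in> sgns \<longleftrightarrow> b \<in> sgns"
  by (auto simp: sgns_def neg_equal_iff_equal minus_equation_iff)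

lemma sgns_cases: "x \<in> sgns \<Longrightarrow> y \<in> sgns \<Longrightarrow> x = y \<or> x = - y"
  by (auto simp: sgns_def)

text \<open>Node 1 changes \<open>b\<^sub>2\<close>, node 5 changes \<open>b\<^sub>4\<close>, and node 3 changes all three signs, so together they generate all sign
  changes.\<close>

lemma E6_irreducible:
  assumes S: "orthonormal_basis 6 S" and c: "c1 \<in> sgns" "c3 \<in> sgns" "c5 \<in> sgns"
  shows "irreducible_level_one 6 S (tensor_space (lin_span {v_elt [c1, b2, c3, b4, c5, b6] | b2 b4 b6.
    b2 \<in> sgns \<and> b4 \<in> sgns \<and> b6 \<in> sgns}) (polys 6))"
proof -
  define I where "I = {[c1, b2, c3, b4, c5, b6] | b2 b4 b6. b2 \<in> sgns \<and> b4 \<in> sgns \<and> b6 \<in> sgns}"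
  have "irreducible_level_one 6 S (tensor_space (lin_span (v_elt ` I)) (polys 6))"
  proof (rule span_v_elt_irreducible[OF _ S])
    have "[c1, 1, c3, 1, c5, 1] \<in> I" by (auto simp: I_def)
    then show "I \<noteq> {}" by blast
    show len: "length cs = 6" and "set cs \<subseteq> {1, - 1}" if "cs \<in> I" for cs
      unfolding sgns_def[symmetric] using that c by (auto simp: I_def)
    then show "finite I" by (intro finite_sign_lists[of _ 6]) blast
    show "flip 6 j cs \<in> I" if cs: "cs \<in> I" and j: "j \<in> {1..6}" for j cs
    proof (cases "j \<in> nu_set 6")
      case True
      then have "j = 1 \<or> j = 3 \<or> j = 5" by (simp add: nu_set_def)
      then show ?thesis using cs by (auto simp: I_def flip_E6)
    qed (use cs len flip_id in simp)
    show "cs = cs'" if I: "cs \<in> I" "cs' \<in> I"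
      and eq: "\<And>j. j \<in> {1..6} - nu_set 6 \<Longrightarrow> cs ! (j - 1) = cs' ! (j - 1)" for cs cs'
      using I eq[of 2] eq[of 4] eq[of 6] by (auto simp: I_def nu_set_def)
    fix Q cs cs' assume I: "cs \<in> I" "cs' \<in> I" and Q: "Q cs"
      and step: "\<And>cs j. cs \<in> I \<Longrightarrow> j \<in> {1..6} \<Longrightarrow> Q cs \<Longrightarrow> Q (flip 6 j cs)"
    define P where "P b2 b4 b6 \<longleftrightarrow> b2 \<in> sgns \<and> b4 \<in> sgns \<and> b6 \<in> sgns \<and> Q [c1, b2, c3, b4, c5, b6]" for b2 b4 b6
    have P: "P (- b2) b4 b6" "P b2 (- b4) b6" "P (- b2) (- b4) (- b6)" if "P b2 b4 b6" for b2 b4 b6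
    proof -
      have "[c1, b2, c3, b4, c5, b6] \<in> I" "Q [c1, b2, c3, b4, c5, b6]"
        using that by (auto simp: P_def I_def)
      from step[OF this(1) _ this(2), of 1] step[OF this(1) _ this(2), of 3] step[OF this(1) _ this(2), of 5]
      show "P (- b2) b4 b6" "P b2 (- b4) b6" "P (- b2) (- b4) (- b6)"
        using that by (auto simp: P_def flip_E6)
    qed
    have P6: "P b2 b4 (- b6)" if "P b2 b4 b6" for b2 b4 b6
      using P(1)[OF P(2)[OF P(3)[OF that]]] by simp
    obtain b2 b4 b6 where b: "cs = [c1, b2, c3, b4, c5, b6]" "P b2 b4 b6"
      using I(1) Q by (auto simp: I_def P_def)
    obtain b2' b4' b6' where b': "cs' = [c1, b2', c3, b4', c5, b6']" "b2' \<in> sgns" "b4' \<in> sgns" "b6' \<in> sgns"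
      using I(2) unfolding I_def by blast
    have "P b2' b4 b6" using b b' sgns_cases[of b2' b2] P(1)[of b2 b4 b6] by (auto simp: P_def)
    then have "P b2' b4' b6" using b b' sgns_cases[of b4' b4] P(2)[of b2' b4 b6] by (auto simp: P_def)
    then have "P b2' b4' b6'" using b b' sgns_cases[of b6' b6] P6[of b2' b4' b6] by (auto simp: P_def)
    then show "Q cs'" by (simp add: b' P_def)
  qed simp
  moreover have "v_elt ` I = {v_elt [c1, b2, c3, b4, c5, b6] | b2 b4 b6. b2 \<in> sgns \<and> b4 \<in> sgns \<and> b6 \<in> sgns}"
    unfolding I_def by blast
  ultimately show ?thesis by simp
qed

text \<open>Node 1 changes \<open>b\<^sub>2\<close>, and nodes 3 and 5 change two of \<open>b\<^sub>4\<close>, \<open>b\<^sub>6\<close>, \<open>b\<^sub>7\<close> at a time. This preserves \<open>b\<^sub>4 b\<^sub>6 b\<^sub>7\<close>, and it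
  is transitive on the triples with a given product.\<close>

lemma E7_irreducible:
  assumes S: "orthonormal_basis 7 S" and c: "c1 \<in> sgns" "c3 \<in> sgns" "c5 \<in> sgns" "c \<in> sgns"
  shows "irreducible_level_one 7 S (tensor_space (lin_span {v_elt [c1, b2, c3, b4, c5, b6, b7] | b2 b4 b6 b7.
    b2 \<in> sgns \<and> b4 \<in> sgns \<and> b6 \<in> sgns \<and> b7 \<in> sgns \<and> b4 * b6 * b7 = c}) (polys 7))"
proof -
  define I where "I = {[c1, b2, c3, b4, c5, b6, b7] | b2 b4 b6 b7.
    b2 \<in> sgns \<and> b4 \<in> sgns \<and> b6 \<in> sgns \<and> b7 \<in> sgns \<and> b4 * b6 * b7 = c}"
  have "irreducible_level_one 7 S (tensor_space (lin_span (v_elt ` I)) (polys 7))"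
  proof (rule span_v_elt_irreducible[OF _ S])
    have "[c1, 1, c3, 1, c5, 1, c] \<in> I" using c by (auto simp: I_def)
    then show "I \<noteq> {}" by blast
    show len: "length cs = 7" and "set cs \<subseteq> {1, - 1}" if "cs \<in> I" for cs
      unfolding sgns_def[symmetric] using that c by (auto simp: I_def)
    then show "finite I" by (intro finite_sign_lists[of _ 7]) blast
    show "flip 7 j cs \<in> I" if cs: "cs \<in> I" and j: "j \<in> {1..7}" for j cs
    proof (cases "j \<in> nu_set 7")
      case True
      then have "j = 1 \<or> j = 3 \<or> j = 5" by (simp add: nu_set_def)
      then show ?thesis using cs by (auto simp: I_def flip_E7)
    qed (use cs len flip_id in simp)
    show "cs = cs'" if I: "cs \<in> I" "cs' \<in> I"
      and eq: "\<And>j. j \<in> {1..7} - nu_set 7 \<Longrightarrow> cs ! (j - 1) = cs' ! (j - 1)" for cs cs'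
    proof -
      obtain b2 b4 b6 b7 b2' b4' b6' b7'
        where "cs = [c1, b2, c3, b4, c5, b6, b7]" "cs' = [c1, b2', c3, b4', c5, b6', b7']"
        using I unfolding I_def by blast
      then show ?thesis using eq[of 2] eq[of 4] eq[of 6] eq[of 7] by (simp add: nu_set_def)
    qed
    fix Q cs cs' assume I: "cs \<in> I" "cs' \<in> I" and Q: "Q cs"
      and step: "\<And>cs j. cs \<in> I \<Longrightarrow> j \<in> {1..7} \<Longrightarrow> Q cs \<Longrightarrow> Q (flip 7 j cs)"
    define P where "P b2 b4 b6 b7 \<longleftrightarrow> b2 \<in> sgns \<and> b4 \<in> sgns \<and> b6 \<in> sgns \<and> b7 \<in> sgns \<and>
      b4 * b6 * b7 = c \<and> Q [c1, b2, c3, b4, c5, b6, b7]" for b2 b4 b6 b7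
    have P: "P (- b2) b4 b6 b7" "P (- b2) (- b4) b6 (- b7)" "P b2 (- b4) (- b6) b7"
      if "P b2 b4 b6 b7" for b2 b4 b6 b7
    proof -
      have "[c1, b2, c3, b4, c5, b6, b7] \<in> I" "Q [c1, b2, c3, b4, c5, b6, b7]"
        using that by (auto simp: P_def I_def)
      from step[OF this(1) _ this(2), of 1] step[OF this(1) _ this(2), of 3] step[OF this(1) _ this(2), of 5]
      show "P (- b2) b4 b6 b7" "P (- b2) (- b4) b6 (- b7)" "P b2 (- b4) (- b6) b7"
        using that by (auto simp: P_def flip_E7)
    qed
    have P47: "P b2 (- b4) b6 (- b7)" if "P b2 b4 b6 b7" for b2 b4 b6 b7
      using P(1)[OF P(2)[OF that]] by simp
    obtain b2 b4 b6 b7 where b: "cs = [c1, b2, c3, b4, c5, b6, b7]" "P b2 b4 b6 b7"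
      using I(1) Q by (auto simp: I_def P_def)
    obtain b2' b4' b6' b7' where b': "cs' = [c1, b2', c3, b4', c5, b6', b7']"
      "b2' \<in> sgns" "b4' \<in> sgns" "b6' \<in> sgns" "b7' \<in> sgns" "b4' * b6' * b7' = c"
      using I(2) unfolding I_def by blast
    have "P b2' b4 b6 b7" using b b' sgns_cases[of b2' b2] P(1)[of b2 b4 b6 b7] by (auto simp: P_def)
    moreover have "b6 \<in> sgns" "b7 \<in> sgns" using b by (simp_all add: P_def)
    ultimately have "\<exists>a. P b2' a b6' b7" using sgns_cases[OF b'(4)] P(3) by metis
    then obtain a where "P b2' a b6' b7" ..
    then have "\<exists>a. P b2' a b6' b7'" using sgns_cases[OF b'(5) \<open>b7 \<in> sgns\<close>] P47 by metis
    then obtain a' where a': "P b2' a' b6' b7'" ..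
    then have "a' * (b6' * b7') = b4' * (b6' * b7')" using b' by (simp add: P_def mult.assoc)
    then have "a' = b4'" using b' by (auto simp: sgns_def)
    then show "Q cs'" using a' by (simp add: b' P_def)
  qed simp
  moreover have "v_elt ` I = {v_elt [c1, b2, c3, b4, c5, b6, b7] | b2 b4 b6 b7.
    b2 \<in> sgns \<and> b4 \<in> sgns \<and> b6 \<in> sgns \<and> b7 \<in> sgns \<and> b4 * b6 * b7 = c}"
    unfolding I_def by blast
  ultimately show ?thesis by simp
qed

text \<open>Nodes 1 and 7 change \<open>b\<^sub>2\<close> and \<open>b\<^sub>6\<close>. Node 3 changes \<open>b\<^sub>2\<close> and \<open>b\<^sub>4\<close>, hence \<open>b\<^sub>4\<close> can be changed alone; node 5 changes
  \<open>b\<^sub>4\<close>, \<open>b\<^sub>6\<close> and \<open>b\<^sub>8\<close>, hence so can \<open>b\<^sub>8\<close>.\<close>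

lemma E8_irreducible:
  assumes S: "orthonormal_basis 8 S" and c: "c1 \<in> sgns" "c3 \<in> sgns" "c5 \<in> sgns" "c7 \<in> sgns"
  shows "irreducible_level_one 8 S (tensor_space (lin_span {v_elt [c1, b2, c3, b4, c5, b6, c7, b8] | b2 b4 b6 b8.
    b2 \<in> sgns \<and> b4 \<in> sgns \<and> b6 \<in> sgns \<and> b8 \<in> sgns}) (polys 8))"
proof -
  define I where "I = {[c1, b2, c3, b4, c5, b6, c7, b8] | b2 b4 b6 b8.
    b2 \<in> sgns \<and> b4 \<in> sgns \<and> b6 \<in> sgns \<and> b8 \<in> sgns}"
  have "irreducible_level_one 8 S (tensor_space (lin_span (v_elt ` I)) (polys 8))"
  proof (rule span_v_elt_irreducible[OF _ S])
    have "[c1, 1, c3, 1, c5, 1, c7, 1] \<in> I" by (auto simp: I_def)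
    then show "I \<noteq> {}" by blast
    show len: "length cs = 8" and "set cs \<subseteq> {1, - 1}" if "cs \<in> I" for cs
      unfolding sgns_def[symmetric] using that c by (auto simp: I_def)
    then show "finite I" by (intro finite_sign_lists[of _ 8]) blast
    show "flip 8 j cs \<in> I" if cs: "cs \<in> I" and j: "j \<in> {1..8}" for j cs
    proof (cases "j \<in> nu_set 8")
      case True
      then have "j = 1 \<or> j = 3 \<or> j = 5 \<or> j = 7" by (simp add: nu_set_def)
      then show ?thesis using cs by (auto simp: I_def flip_E8)
    qed (use cs len flip_id in simp)
    show "cs = cs'" if I: "cs \<in> I" "cs' \<in> I"
      and eq: "\<And>j. j \<in> {1..8} - nu_set 8 \<Longrightarrow> cs ! (j - 1) = cs' ! (j - 1)" for cs cs'
      using I eq[of 2] eq[of 4] eq[of 6] eq[of 8] by (auto simp: I_def nu_set_def)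
    fix Q cs cs' assume I: "cs \<in> I" "cs' \<in> I" and Q: "Q cs"
      and step: "\<And>cs j. cs \<in> I \<Longrightarrow> j \<in> {1..8} \<Longrightarrow> Q cs \<Longrightarrow> Q (flip 8 j cs)"
    define P where "P b2 b4 b6 b8 \<longleftrightarrow> b2 \<in> sgns \<and> b4 \<in> sgns \<and> b6 \<in> sgns \<and> b8 \<in> sgns \<and>
      Q [c1, b2, c3, b4, c5, b6, c7, b8]" for b2 b4 b6 b8
    have P: "P (- b2) b4 b6 b8" "P (- b2) (- b4) b6 b8" "P b2 (- b4) (- b6) (- b8)" "P b2 b4 (- b6) b8"
      if "P b2 b4 b6 b8" for b2 b4 b6 b8
    proof -
      have "[c1, b2, c3, b4, c5, b6, c7, b8] \<in> I" "Q [c1, b2, c3, b4, c5, b6, c7, b8]"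
        using that by (auto simp: P_def I_def)
      from step[OF this(1) _ this(2), of 1] step[OF this(1) _ this(2), of 3] step[OF this(1) _ this(2), of 5]
        step[OF this(1) _ this(2), of 7]
      show "P (- b2) b4 b6 b8" "P (- b2) (- b4) b6 b8" "P b2 (- b4) (- b6) (- b8)" "P b2 b4 (- b6) b8"
        using that by (auto simp: P_def flip_E8)
    qed
    have P4: "P b2 (- b4) b6 b8" if "P b2 b4 b6 b8" for b2 b4 b6 b8
      using P(1)[OF P(2)[OF that]] by simp
    have P8: "P b2 b4 b6 (- b8)" if "P b2 b4 b6 b8" for b2 b4 b6 b8
      using P4[OF P(4)[OF P(3)[OF that]]] by simp
    obtain b2 b4 b6 b8 where b: "cs = [c1, b2, c3, b4, c5, b6, c7, b8]" "P b2 b4 b6 b8"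
      using I(1) Q by (auto simp: I_def P_def)
    obtain b2' b4' b6' b8' where b': "cs' = [c1, b2', c3, b4', c5, b6', c7, b8']"
      "b2' \<in> sgns" "b4' \<in> sgns" "b6' \<in> sgns" "b8' \<in> sgns"
      using I(2) unfolding I_def by blast
    have "P b2' b4 b6 b8" using b b' sgns_cases[of b2' b2] P(1)[of b2 b4 b6 b8] by (auto simp: P_def)
    then have "P b2' b4' b6 b8" using b b' sgns_cases[of b4' b4] P4[of b2' b4 b6 b8] by (auto simp: P_def)
    then have "P b2' b4' b6' b8" using b b' sgns_cases[of b6' b6] P(4)[of b2' b4' b6 b8] by (auto simp: P_def)
    then have "P b2' b4' b6' b8'" using b b' sgns_cases[of b8' b8] P8[of b2' b4' b6' b8] by (auto simp: P_def)
    then show "Q cs'" by (simp add: b' P_def)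
  qed simp
  moreover have "v_elt ` I = {v_elt [c1, b2, c3, b4, c5, b6, c7, b8] | b2 b4 b6 b8.
    b2 \<in> sgns \<and> b4 \<in> sgns \<and> b6 \<in> sgns \<and> b8 \<in> sgns}"
    unfolding I_def by blast
  ultimately show ?thesis by simp
qed

theorem theorem4p3:
  shows
    "(\<forall>S. orthonormal_basis 6 S \<longrightarrow>
       (\<forall>c\<^sub>1\<in>{1, - 1}. \<forall>c\<^sub>3\<in>{1, - 1}. \<forall>c\<^sub>5\<in>{1, - 1}.
          irreducible_level_one 6 S
            (tensor_space
              (lin_span {v_elt [c\<^sub>1, b\<^sub>2, c\<^sub>3, b\<^sub>4, c\<^sub>5, b\<^sub>6] | b\<^sub>2 b\<^sub>4 b\<^sub>6.
                 b\<^sub>2 \<in> {1, - 1} \<and> b\<^sub>4 \<in> {1, - 1} \<and> b\<^sub>6 \<in> {1, - 1}})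
              (polys 6)))) \<and>
     (\<forall>S. orthonormal_basis 7 S \<longrightarrow>
       (\<forall>c\<^sub>1\<in>{1, - 1}. \<forall>c\<^sub>3\<in>{1, - 1}. \<forall>c\<^sub>5\<in>{1, - 1}. \<forall>c\<in>{1, - 1}.
          irreducible_level_one 7 S
            (tensor_space
              (lin_span {v_elt [c\<^sub>1, b\<^sub>2, c\<^sub>3, b\<^sub>4, c\<^sub>5, b\<^sub>6, b\<^sub>7] | b\<^sub>2 b\<^sub>4 b\<^sub>6 b\<^sub>7.
                 b\<^sub>2 \<in> {1, - 1} \<and> b\<^sub>4 \<in> {1, - 1} \<and> b\<^sub>6 \<in> {1, - 1} \<and> b\<^sub>7 \<in> {1, - 1} \<and>
                 b\<^sub>4 * b\<^sub>6 * b\<^sub>7 = c})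
              (polys 7)))) \<and>
     (\<forall>S. orthonormal_basis 8 S \<longrightarrow>
       (\<forall>c\<^sub>1\<in>{1, - 1}. \<forall>c\<^sub>3\<in>{1, - 1}. \<forall>c\<^sub>5\<in>{1, - 1}. \<forall>c\<^sub>7\<in>{1, - 1}.
          irreducible_level_one 8 S
            (tensor_space
              (lin_span {v_elt [c\<^sub>1, b\<^sub>2, c\<^sub>3, b\<^sub>4, c\<^sub>5, b\<^sub>6, c\<^sub>7, b\<^sub>8] | b\<^sub>2 b\<^sub>4 b\<^sub>6 b\<^sub>8.
                 b\<^sub>2 \<in> {1, - 1} \<and> b\<^sub>4 \<in> {1, - 1} \<and> b\<^sub>6 \<in> {1, - 1} \<and> b\<^sub>8 \<in> {1, - 1}})
              (polys 8))))"
  by (intro conjI allI impI ballI E6_irreducible[unfolded sgns_def] E7_irreducible[unfolded sgns_def]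
      E8_irreducible[unfolded sgns_def])

end
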